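(* Consider path detection in $\mathbb{V}_m=\{1,\dots,m\}^d$ with loopless paths of length $[m^\alpha]$, $0<\alpha<1$, and signal parameters $\theta_m>0$. Let $t\in\mathbb{R}$ be fixed such that $0<p_0(t)<p_c$. Then the test based on $S_m(t)$ is asymptotically powerful if $$\liminf_{m\to\infty}\theta_m>\theta_*^+(t),$$ and asymptotically powerless if $$\limsup_{m\to\infty}\theta_m<\theta_*^-(t),$$ where $\theta_*^+(t)$ is the unique solution $\theta$ to $d\,\zeta^1_{p_\theta(t)}=\alpha\,\zeta_{p_0(t)}$ and $\theta_*^-(t)$ is the unique solution $\theta$ to $d\,\zeta_{p_\theta(t)}=\alpha\,\zeta_{p_0(t)}$.
   Context: Let $d\ge 1$; $\mathbb{V}_m=\{1,\dots,m\}^d$ carries the nearest-neighbour graph structure of $\mathbb{Z}^d$. $F_0$ is a distribution function on $\mathbb{R}$ with finite non-zero variance such that $\varphi(\theta)=\int e^{x\theta}\,dF_0(x)$ is finite for $\theta\in[0,\theta_\infty)$, where $\theta_\infty>0$; $F_\theta$ is the distribution with density $\exp(\theta x-\log\varphi(\theta))$ with respect to $F_0$, $\theta\in[0,\theta_\infty)$. Write $p_\theta(t)=\mathbb{P}(X>t)$ for $X\sim F_\theta$. Testing problem: independent variables $(X_v)_{v\in\mathbb{V}_m}$ are observed. Under $\mathbb{H}_0^m$, $X_v\sim F_0$ for all $v$. For $K$ in a class $\mathcal{K}_m$ of connected node subsets, under $\mathbb{H}_{1,K}^m$, $X_v\sim F_{\theta_m}$ for $v\in K$ and $X_v\sim F_0$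 for $v\notin K$. In path detection, $\mathcal{K}_m$ is the class of (node sets of) loopless, i.e. self-avoiding, nearest-neighbour paths within $\mathbb{V}_m$ of length (number of nodes) $[m^\alpha]$, $[\cdot]$ being the integer part. The worst-case risk of a $\{0,1\}$-valued test $T$ is $\gamma_m(T)=\mathbb{P}(T=1\mid\mathbb{H}_0^m)+\max_{K\in\mathcal{K}_m}\mathbb{P}(T=0\mid\mathbb{H}_{1,K}^m)$. A sequence $(T_m)$ is asymptotically powerful if $\gamma_m(T_m)\to0$, and asymptotically powerless if $\liminf_m\gamma_m(T_m)\ge1$. The test based on a statistic rejects for large values of it (value above a critical value $c_m$): it is called asymptotically powerful if this holds for some choice of $(c_m)$ and asymptotically powerless if this holds for every choice of $(c_m)$. $S_m(t)$ is the size of the largest open cluster at threshold $t$, i.e. of the largest connected component of the subgraph of $\mathbb{V}_m$ induced by $\{v: X_v>t\}$. Percolation: in site percolation on $\mathbb{Z}^d$ with parameter $p$ (nodes open independently with probability $p$), $S$ is the size of the open cluster containing the origin ($0$ if the origin is closed), and $p_c$ is the supremum of $p\in(0,1)$ with $S<\infty$ almost surely. For $0<p<p_c$, $\zeta_p=-\lim_{k\to\infty}\frac1k\log\mathbb{P}(S\ge k)=-\lim_{k\to\infty}\frac1k\log\mathbb{P}(S=k)$ (the limits exist), and $\zeta_p=0$ for $p\ge p_c$. The function $\zeta_p$ is continuous and strictly decreasing on $(0,p_c]$, and $p_\theta(t)$ is continuous and strictly increasing in $\theta$. Finally $\zeta^1_p=\log(1/p)$ (the function $\zeta_p$ in dimension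 one). *)

theory Defs
  imports "HOL-Probability.Probability"
begin

section \<open>The lattice and clusters\<close>

text \<open>Nodes of the \<open>d\<close>-dimensional lattice are elements of \<open>int ^ 'd\<close>, with \<open>d = CARD('d)\<close>.\<close>

definition adjacent :: "int ^ 'd \<Rightarrow> int ^ 'd \<Rightarrow> bool" where
  "adjacent v w \<longleftrightarrow> (\<Sum>i\<in>UNIV. \<bar>v $ i - w $ i\<bar>) = 1"

definition grid :: "nat \<Rightarrow> (int ^ 'd) set" where
  "grid m = {v. \<forall>i. 1 \<le> v $ i \<and> v $ i \<le> int m}"

text \<open>The connected component of \<open>v\<close> in the subgraph induced by \<open>A\<close>; it is empty if \<open>v \<notin> A\<close>.\<close>

definition cluster :: "(int ^ 'd) set \<Rightarrow> int ^ 'd \<Rightarrow> (int ^ 'd) set" where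
  "cluster A v = {w. v \<in> A \<and> (v, w) \<in> {(x, y). x \<in> A \<and> y \<in> A \<and> adjacent x y}\<^sup>*}"

section \<open>Site percolation\<close>

definition site_percolation :: "real \<Rightarrow> (int ^ 'd \<Rightarrow> bool) measure" where
  "site_percolation p = (\<Pi>\<^sub>M v\<in>UNIV. measure_pmf (bernoulli_pmf p))"

definition origin_cluster_size :: "(int ^ 'd \<Rightarrow> bool) \<Rightarrow> enat" where
  "origin_cluster_size \<omega> =
     (let C = cluster {v. \<omega> v} 0 in if finite C then enat (card C) else \<infinity>)"

definition critical_prob :: "'d::finite itself \<Rightarrow> real" where
  "critical_prob _ =
     Sup {p. 0 < p \<and> p < 1 \<and>
             (AE \<omega> in (site_percolation p :: (int ^ 'd \<Rightarrow> bool) measure).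
                origin_cluster_size \<omega> < \<infinity>)}"

definition cluster_tail :: "'d::finite itself \<Rightarrow> real \<Rightarrow> nat \<Rightarrow> real" where
  "cluster_tail _ p k =
     (let P = (site_percolation p :: (int ^ 'd \<Rightarrow> bool) measure)
      in measure P {\<omega> \<in> space P. enat k \<le> origin_cluster_size \<omega>})"

definition zeta :: "'d::finite itself \<Rightarrow> real \<Rightarrow> real" where
  "zeta D p =
     (if p < critical_prob D then - lim (\<lambda>k. ln (cluster_tail D p k) / real k) else 0)"

text \<open>The closed form of the function \<open>\<zeta>\<close> in dimension one.\<close>

definition zeta1 :: "real \<Rightarrow> real" where
  "zeta1 p = ln (1 / p)"

section \<open>The exponential family\<close>

text \<open>The half-open interval from \<open>0\<close> to \<open>\<theta>max\<close>, whose right end point may be infinite.\<close>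

definition param_range :: "ereal \<Rightarrow> real set" where
  "param_range \<theta>max = {\<theta>. 0 \<le> \<theta> \<and> ereal \<theta> < \<theta>max}"

definition mgf :: "real measure \<Rightarrow> real \<Rightarrow> real" where
  "mgf F\<^sub>0 \<theta> = (\<integral>x. exp (x * \<theta>) \<partial>F\<^sub>0)"

definition tilted :: "real measure \<Rightarrow> real \<Rightarrow> real measure" where
  "tilted F\<^sub>0 \<theta> = density F\<^sub>0 (\<lambda>x. ennreal (exp (\<theta> * x - ln (mgf F\<^sub>0 \<theta>))))"

definition exceed_prob :: "real measure \<Rightarrow> real \<Rightarrow> real \<Rightarrow> real" where
  "exceed_prob F\<^sub>0 t \<theta> = measure (tilted F\<^sub>0 \<theta>) {t<..}"

section \<open>Path detection\<close>

definition path_class :: "real \<Rightarrow> nat \<Rightarrow> (int ^ 'd) set set" where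
  "path_class \<alpha> m =
     set ` {vs. set vs \<subseteq> grid m \<and> distinct vs \<and> successively adjacent vs \<and>
                length vs = nat \<lfloor>real m powr \<alpha>\<rfloor>}"

definition null_law :: "real measure \<Rightarrow> nat \<Rightarrow> (int ^ 'd \<Rightarrow> real) measure" where
  "null_law F\<^sub>0 m = (\<Pi>\<^sub>M v\<in>grid m. F\<^sub>0)"

definition alt_law ::
  "real measure \<Rightarrow> real \<Rightarrow> nat \<Rightarrow> (int ^ 'd) set \<Rightarrow> (int ^ 'd \<Rightarrow> real) measure" where
  "alt_law F\<^sub>0 \<theta> m K = (\<Pi>\<^sub>M v\<in>grid m. if v \<in> K then tilted F\<^sub>0 \<theta> else F\<^sub>0)"

text \<open>A test is identified with its rejection predicate.\<close>

definition path_risk ::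
  "real measure \<Rightarrow> (nat \<Rightarrow> real) \<Rightarrow> real \<Rightarrow> nat \<Rightarrow> ((int ^ 'd \<Rightarrow> real) \<Rightarrow> bool) \<Rightarrow> real" where
  "path_risk F\<^sub>0 \<theta> \<alpha> m T =
     measure (null_law F\<^sub>0 m) {x \<in> space (null_law F\<^sub>0 m). T x} +
     Max ((\<lambda>K. measure (alt_law F\<^sub>0 (\<theta> m) m K) {x \<in> space (alt_law F\<^sub>0 (\<theta> m) m K). \<not> T x})
            ` path_class \<alpha> m)"

text \<open>
  In the next two definitions \<open>R m T\<close> is the risk of the test \<open>T\<close> in the problem of size \<open>m\<close>, and
  \<open>S m\<close> is the statistic used in that problem.
\<close>

definition asymp_powerful ::
  "(nat \<Rightarrow> ('x \<Rightarrow> bool) \<Rightarrow> real) \<Rightarrow> (nat \<Rightarrow> 'x \<Rightarrow> real) \<Rightarrow> bool" where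
  "asymp_powerful R S \<longleftrightarrow> (\<exists>c. (\<lambda>m. R m (\<lambda>x. S m x > c m)) \<longlonglongrightarrow> 0)"

definition asymp_powerless ::
  "(nat \<Rightarrow> ('x \<Rightarrow> bool) \<Rightarrow> real) \<Rightarrow> (nat \<Rightarrow> 'x \<Rightarrow> real) \<Rightarrow> bool" where
  "asymp_powerless R S \<longleftrightarrow>
     (\<forall>c. liminf (\<lambda>m. ereal (R m (\<lambda>x. S m x > c m))) \<ge> 1)"

text \<open>On \<open>nat\<close>, the supremum of the empty set (which arises for \<open>m = 0\<close>) is \<open>0\<close>.\<close>

definition largest_cluster :: "real \<Rightarrow> nat \<Rightarrow> (int ^ 'd \<Rightarrow> real) \<Rightarrow> nat" where
  "largest_cluster t m x = (SUP v\<in>grid m. card (cluster {v \<in> grid m. x v > t} v))"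

definition unique_solution :: "real set \<Rightarrow> (real \<Rightarrow> bool) \<Rightarrow> real \<Rightarrow> bool" where
  "unique_solution I E \<theta> \<longleftrightarrow> \<theta> \<in> I \<and> E \<theta> \<and> (\<forall>\<theta>'\<in>I. E \<theta>' \<longrightarrow> \<theta>' = \<theta>)"

end

theory Submission
  imports Defs "HOL-Real_Asymp.Real_Asymp"
begin

text \<open>
  Put \<open>k = \<lceil>c * ln m\<rceil>\<close>. Under the null hypothesis the largest cluster is below \<open>k\<close> if \<open>c > d / \<zeta>\<close>, by a union
  bound over the nodes, and above \<open>k\<close> if \<open>c < d / \<zeta>\<close>, by independence in disjoint boxes of side
  \<open>2 * k + 1\<close>, where \<open>\<zeta>\<close> belongs to \<open>p\<^sub>0(t)\<close>. Above \<open>\<theta>\<^sup>+\<close> one can choose \<open>c > d / \<zeta>\<close> such that the path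
  contains an open segment of length \<open>k\<close>. Below \<open>\<theta>\<^sup>-\<close> one can choose \<open>c < d / \<zeta>\<close> such that a union bound
  over the path excludes clusters of size \<open>k\<close> that meet the path, even at the raised level; the clusters
  that avoid the path are no larger than under the null hypothesis.

  The rate \<open>\<zeta>\<close> exists by concatenation of lattice animals and Fekete's lemma. Its strict monotonicity
  where it is positive follows from \<open>P\<^sub>q(E) \<le> P\<^sub>p(E)\<^sup>g\<close>, \<open>q = p\<^sup>g\<close>, \<open>g \<ge> 1\<close>, for increasing events \<open>E\<close>. That
  \<open>\<zeta> > 0\<close> below the critical probability is not needed: if \<open>\<zeta> = 0\<close> at \<open>p\<^sub>0(t)\<close>, then the equation for
  \<open>\<theta>\<^sup>+\<close> has no solution and that for \<open>\<theta>\<^sup>-\<close> has the solution \<open>0\<close>.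
\<close>

section \<open>Finite products of Bernoulli variables\<close>

text \<open>Up to logarithms everything is a power of \<open>m\<close>. The union bound over the
  grid is of order \<open>m^(d - c * \<zeta>)\<close>, the expected number of open segments on a
  path \<open>m^(\<alpha> - c * zeta1)\<close>, and the union bound over a path
  \<open>m^(\<alpha> - c * \<zeta>)\<close>, the last two with rates at the raised level. The
  equations for the thresholds describe the points where the admissible windows for \<open>c\<close>
  close.

  A cluster of at least \<open>k\<close> nodes has a witness of \<open>k\<close> nodes within
  distance \<open>k\<close> of its root. Hence the relevant probabilities are finite sums,
  accessible to induction over the nodes, and product measures enter mainly through one transfer
  lemma.

  Gluing is carried out for the probabilities that the cluster equals a given finite set, not for
  the tail, since the glued set determines its parts. Returning from exact sizes to the tail takes a
  telescoping sum whose remainder is the probability of an infinite cluster; this is where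
  subcriticality enters.

  For powerlessness the critical values are arbitrary, so the lower bound for the risk has to be
  uniform in them.\<close>

text \<open>The probability that the random set of open nodes of \<open>B\<close> satisfies \<open>E\<close>, where \<open>v\<close> is open with
  probability \<open>p v\<close>, independently of the other nodes.\<close>

definition bprob :: "'a set \<Rightarrow> ('a \<Rightarrow> real) \<Rightarrow> ('a set \<Rightarrow> bool) \<Rightarrow> real" where
  "bprob B p E = (\<Sum>A | A \<subseteq> B \<and> E A. (\<Prod>v\<in>A. p v) * (\<Prod>v\<in>B - A. 1 - p v))"

lemma bprob_empty [simp]: "bprob {} p E = of_bool (E {})"
proof (cases "E {}")
  case True
  then have "{A. A \<subseteq> {} \<and> E A} = {{}}"
    by auto
  with True show ?thesis
    by (simp add: bprob_def)
next
  case False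
  then have "{A. A \<subseteq> {} \<and> E A} = {}"
    by auto
  with False show ?thesis
    by (simp only: bprob_def) simp
qed

text \<open>Condition on the state of \<open>x\<close>. This recursion drives the inductions over
  nodes; most of them generalise over the event because the open branch changes it.\<close>

lemma bprob_insert:
  assumes "finite B" "x \<notin> B"
  shows "bprob (insert x B) p E =
           p x * bprob B p (\<lambda>A. E (insert x A)) + (1 - p x) * bprob B p E"
proof -
  let ?w = "\<lambda>B A. (\<Prod>v\<in>A. p v) * (\<Prod>v\<in>B - A. 1 - p v)"
  let ?S1 = "{A. A \<subseteq> B \<and> E (insert x A)}" and ?S0 = "{A. A \<subseteq> B \<and> E A}"
  have fin: "finite ?S1" "finite ?S0"
    using assms(1) by auto
  have split: "{A. A \<subseteq> insert x B \<and> E A} = insert x ` ?S1 \<union> ?S0"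
  proof (intro equalityI subsetI)
    fix A assume A: "A \<in> {A. A \<subseteq> insert x B \<and> E A}"
    show "A \<in> insert x ` ?S1 \<union> ?S0"
    proof (cases "x \<in> A")
      case True
      then have "A = insert x (A - {x})" by auto
      moreover from True A have "A - {x} \<in> ?S1" by (auto simp: insert_absorb)
      ultimately show ?thesis by blast
    next
      case False
      with A show ?thesis by auto
    qed
  qed auto
  have inj: "inj_on (insert x) ?S1"
    using assms(2) by (intro inj_onI) (auto dest: insert_ident[THEN iffD1, rotated 2])
  have 1: "?w (insert x B) (insert x A) = p x * ?w B A" if "A \<in> ?S1" for A
  proof -
    have "finite A" "x \<notin> A" using that assms finite_subset by auto
    moreover have "insert x B - insert x A = B - A" using assms(2) by auto
    ultimately show ?thesis by simp
  qed
  have 0: "?w (insert x B) A = (1 - p x) * ?w B A" if "A \<in> ?S0" for A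
  proof -
    have "insert x B - A = insert x (B - A)" using that assms(2) by auto
    then show ?thesis using assms by simp
  qed
  have "bprob (insert x B) p E = sum (?w (insert x B)) (insert x ` ?S1 \<union> ?S0)"
    unfolding bprob_def split ..
  also have "\<dots> = sum (?w (insert x B)) (insert x ` ?S1) + sum (?w (insert x B)) ?S0"
    using fin assms(2) by (intro sum.union_disjoint) auto
  also have "sum (?w (insert x B)) (insert x ` ?S1) = (\<Sum>A\<in>?S1. p x * ?w B A)"
    unfolding sum.reindex[OF inj] o_def by (rule sum.cong[OF refl 1])
  also have "sum (?w (insert x B)) ?S0 = (\<Sum>A\<in>?S0. (1 - p x) * ?w B A)"
    by (rule sum.cong[OF refl 0])
  finally show ?thesis
    by (simp add: bprob_def sum_distrib_left)
qed

lemma bprob_cong: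
  assumes "\<And>v. v \<in> B \<Longrightarrow> p v = q v" "\<And>A. A \<subseteq> B \<Longrightarrow> E A \<longleftrightarrow> F A"
  shows "bprob B p E = bprob B q F"
proof -
  have "{A. A \<subseteq> B \<and> E A} = {A. A \<subseteq> B \<and> F A}" using assms(2) by auto
  moreover have "(\<Prod>v\<in>A. p v) * (\<Prod>v\<in>B - A. 1 - p v) = (\<Prod>v\<in>A. q v) * (\<Prod>v\<in>B - A. 1 - q v)"
    if "A \<subseteq> B" for A
    using that assms(1) by (intro arg_cong2[where f="(*)"] prod.cong) auto
  ultimately show ?thesis
    unfolding bprob_def by (intro sum.cong) auto
qed

lemma bprob_True: "finite B \<Longrightarrow> bprob B p (\<lambda>_. True) = 1"
  by (induction B rule: finite_induct) (auto simp: bprob_insert)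

lemma bprob_mono_event:
  assumes "finite B" "\<And>v. v \<in> B \<Longrightarrow> p v \<in> {0..1}" "\<And>A. A \<subseteq> B \<Longrightarrow> E A \<Longrightarrow> F A"
  shows "bprob B p E \<le> bprob B p F"
  unfolding bprob_def using assms
  by (intro sum_mono2) (auto intro!: mult_nonneg_nonneg prod_nonneg)

lemma bprob_nonneg: "finite B \<Longrightarrow> (\<And>v. v \<in> B \<Longrightarrow> p v \<in> {0..1}) \<Longrightarrow> 0 \<le> bprob B p E"
  unfolding bprob_def by (auto intro!: sum_nonneg mult_nonneg_nonneg prod_nonneg)

lemma bprob_le_1: "finite B \<Longrightarrow> (\<And>v. v \<in> B \<Longrightarrow> p v \<in> {0..1}) \<Longrightarrow> bprob B p E \<le> 1"
  using bprob_mono_event[of B p E "\<lambda>_. True"] by (simp add: bprob_True)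

lemma bprob_disj_exact:
  assumes "finite B" "\<And>A. A \<subseteq> B \<Longrightarrow> E A \<Longrightarrow> F A \<Longrightarrow> False"
  shows "bprob B p (\<lambda>A. E A \<or> F A) = bprob B p E + bprob B p F"
proof -
  have "{A. A \<subseteq> B \<and> (E A \<or> F A)} = {A. A \<subseteq> B \<and> E A} \<union> {A. A \<subseteq> B \<and> F A}" by auto
  then show ?thesis
    unfolding bprob_def using assms by (simp only:) (intro sum.union_disjoint; auto)
qed

lemma bprob_not:
  assumes "finite B"
  shows "bprob B p (\<lambda>A. \<not> E A) = 1 - bprob B p E"
proof -
  have "bprob B p (\<lambda>A. E A \<or> \<not> E A) = bprob B p E + bprob B p (\<lambda>A. \<not> E A)"
    using assms by (rule bprob_disj_exact) auto
  then show ?thesis using bprob_True[OF assms, of p] by simp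
qed

lemma bprob_disj_le:
  assumes "finite B" "\<And>v. v \<in> B \<Longrightarrow> p v \<in> {0..1}"
  shows "bprob B p (\<lambda>A. E A \<or> F A) \<le> bprob B p E + bprob B p F"
proof -
  have "bprob B p (\<lambda>A. E A \<or> F A) = bprob B p (\<lambda>A. E A \<or> (F A \<and> \<not> E A))"
    by (rule bprob_cong) auto
  also have "\<dots> = bprob B p E + bprob B p (\<lambda>A. F A \<and> \<not> E A)"
    using assms(1) by (rule bprob_disj_exact) auto
  also have "bprob B p (\<lambda>A. F A \<and> \<not> E A) \<le> bprob B p F"
    using assms by (intro bprob_mono_event) auto
  finally show ?thesis by simp
qed

lemma bprob_False [simp]: "bprob B p (\<lambda>_. False) = 0"
  by (simp add: bprob_def)

lemma bprob_Ex_le: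
  assumes "finite B" "\<And>v. v \<in> B \<Longrightarrow> p v \<in> {0..1}" "finite J"
  shows "bprob B p (\<lambda>A. \<exists>j\<in>J. E j A) \<le> (\<Sum>j\<in>J. bprob B p (E j))"
  using assms(3)
proof (induction J rule: finite_induct)
  case (insert j J)
  have "bprob B p (\<lambda>A. \<exists>i\<in>insert j J. E i A) = bprob B p (\<lambda>A. E j A \<or> (\<exists>i\<in>J. E i A))"
    by (rule bprob_cong) auto
  also have "\<dots> \<le> bprob B p (E j) + bprob B p (\<lambda>A. \<exists>i\<in>J. E i A)"
    using assms by (intro bprob_disj_le) auto
  finally show ?case using insert by simp
qed simp

lemma bprob_Ex_disjoint:
  assumes "finite B" "finite J"
    "\<And>i j A. i \<in> J \<Longrightarrow> j \<in> J \<Longrightarrow> E i A \<Longrightarrow> E j A \<Longrightarrow> i = j"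
  shows "bprob B p (\<lambda>A. \<exists>j\<in>J. E j A) = (\<Sum>j\<in>J. bprob B p (E j))"
  using assms(2,3)
proof (induction J rule: finite_induct)
  case (insert j J)
  have "bprob B p (\<lambda>A. \<exists>i\<in>insert j J. E i A) = bprob B p (\<lambda>A. E j A \<or> (\<exists>i\<in>J. E i A))"
    by (rule bprob_cong) auto
  also have "\<dots> = bprob B p (E j) + bprob B p (\<lambda>A. \<exists>i\<in>J. E i A)"
    using assms(1) insert.hyps insert.prems by (intro bprob_disj_exact) blast+
  also have "bprob B p (\<lambda>A. \<exists>i\<in>J. E i A) = (\<Sum>j\<in>J. bprob B p (E j))"
    using insert.prems by (intro insert.IH) blast
  finally show ?case using insert by simp
qed simp

text \<open>Conditioning on one node gives an average of an open and a closed branch. For an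
  increasing event the open branch is at least as large, so moving weight to it cannot lower the
  average.\<close>

lemma bprob_mono_increasing:
  assumes "finite B" "\<And>v. v \<in> B \<Longrightarrow> 0 \<le> p v \<and> p v \<le> q v \<and> q v \<le> 1"
    and "\<And>A A'. A \<subseteq> A' \<Longrightarrow> E A \<Longrightarrow> E A'"
  shows "bprob B p E \<le> bprob B q E"
  using assms
proof (induction B arbitrary: E rule: finite_induct)
  case (insert x B)
  let ?E1 = "\<lambda>A. E (insert x A)"
  have r: "bprob B q E \<le> bprob B q ?E1"
  proof (rule bprob_mono_event)
    show "q v \<in> {0..1}" if "v \<in> B" for v
      using insert.prems(1)[of v] that by auto
    show "?E1 A" if "E A" for A
      using insert.prems(2)[of A "insert x A"] that by blast
  qed fact
  have i1: "bprob B p ?E1 \<le> bprob B q ?E1"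
  proof (rule insert.IH)
    show "?E1 A'" if "A \<subseteq> A'" "?E1 A" for A A'
      using insert.prems(2)[of "insert x A" "insert x A'"] that by blast
  qed (use insert.prems(1) in blast)
  have i0: "bprob B p E \<le> bprob B q E"
    using insert.prems by (intro insert.IH) blast+
  have px: "0 \<le> p x" "p x \<le> q x" "q x \<le> 1"
    using insert.prems(1)[of x] by auto
  have "p x * bprob B p ?E1 + (1 - p x) * bprob B p E \<le>
        p x * bprob B q ?E1 + (1 - p x) * bprob B q E"
    using i1 i0 px by (intro add_mono mult_left_mono) auto
  also have "\<dots> = bprob B q E + p x * (bprob B q ?E1 - bprob B q E)"
    by (simp add: algebra_simps)
  also have "\<dots> \<le> bprob B q E + q x * (bprob B q ?E1 - bprob B q E)"
    using px r by (intro add_mono mult_right_mono) auto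
  also have "\<dots> = q x * bprob B q ?E1 + (1 - q x) * bprob B q E"
    by (simp add: algebra_simps)
  finally show ?case
    using insert.hyps by (simp add: bprob_insert)
qed simp

text \<open>The dual induction, for an event that is decreasing in the nodes of \<open>K\<close>
  alone. Off \<open>K\<close> the two families agree, so there both branches keep their
  weights.\<close>

lemma bprob_antimono_on:
  assumes "finite B" "\<And>v. v \<in> B \<Longrightarrow> 0 \<le> p v \<and> p v \<le> q v \<and> q v \<le> 1"
    and "\<And>v. v \<in> B - K \<Longrightarrow> p v = q v"
    and "\<And>A v. v \<in> K \<Longrightarrow> E (insert v A) \<Longrightarrow> E A"
  shows "bprob B q E \<le> bprob B p E"
  using assms
proof (induction B arbitrary: E rule: finite_induct)
  case (insert x B)
  let ?E1 = "\<lambda>A. E (insert x A)"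
  have i1: "bprob B q ?E1 \<le> bprob B p ?E1"
  proof (rule insert.IH)
    show "?E1 A" if "v \<in> K" "?E1 (insert v A)" for A v
      using insert.prems(3)[of v "insert x A"] that by (simp add: insert_commute)
  qed (use insert.prems in blast)+
  have i0: "bprob B q E \<le> bprob B p E"
    using insert.prems by (intro insert.IH) blast+
  have px: "0 \<le> p x" "p x \<le> q x" "q x \<le> 1"
    using insert.prems(1)[of x] by auto
  have "q x * bprob B q ?E1 + (1 - q x) * bprob B q E \<le>
        q x * bprob B p ?E1 + (1 - q x) * bprob B p E"
    using i1 i0 px by (intro add_mono mult_left_mono) auto
  also have "\<dots> \<le> p x * bprob B p ?E1 + (1 - p x) * bprob B p E"
  proof (cases "x \<in> K")
    case True
    have r: "bprob B p ?E1 \<le> bprob B p E"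
    proof (rule bprob_mono_event)
      show "p v \<in> {0..1}" if "v \<in> B" for v
        using insert.prems(1)[of v] that by auto
      show "E A" if "?E1 A" for A
        using insert.prems(3)[OF True] that by blast
    qed fact
    have "(q x - p x) * bprob B p ?E1 \<le> (q x - p x) * bprob B p E"
      using px r by (intro mult_left_mono) auto
    then show ?thesis by (simp add: algebra_simps)
  next
    case False
    then show ?thesis using insert.prems(2)[of x] by simp
  qed
  finally show ?case
    using insert.hyps by (simp add: bprob_insert)
qed simp

section \<open>Marginals, independence and cylinder events\<close>

lemma bprob_restrict:
  assumes "finite B"
  shows "bprob B p (\<lambda>A. E (A \<inter> B')) = bprob (B \<inter> B') p E"
  using assms
proof (induction B arbitrary: E rule: finite_induct)
  case (insert x B)
  show ?case
  proof (cases "x \<in> B'")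
    case True
    then have "bprob (insert x B) p (\<lambda>A. E (A \<inter> B')) =
      p x * bprob B p (\<lambda>A. E (insert x (A \<inter> B'))) + (1 - p x) * bprob B p (\<lambda>A. E (A \<inter> B'))"
      using insert.hyps by (simp add: bprob_insert)
    also have "\<dots> = bprob (insert x (B \<inter> B')) p E"
      using insert.hyps insert.IH[of E] insert.IH[of "\<lambda>A. E (insert x A)"]
      by (simp add: bprob_insert)
    finally show ?thesis using True by simp
  next
    case False
    then have "bprob (insert x B) p (\<lambda>A. E (A \<inter> B')) = bprob B p (\<lambda>A. E (A \<inter> B'))"
      using insert.hyps by (simp add: bprob_insert algebra_simps)
    then show ?thesis using insert.IH False by simp
  qed
qed simp

lemma bprob_indep:
  assumes "finite B1" "finite B2" "B1 \<inter> B2 = {}"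
  shows "bprob (B1 \<union> B2) p (\<lambda>A. E (A \<inter> B1) \<and> F (A \<inter> B2)) = bprob B1 p E * bprob B2 p F"
  using assms(1,3)
proof (induction B1 arbitrary: E rule: finite_induct)
  case empty
  show ?case
    by (cases "E {}") (auto intro!: bprob_cong simp: Int_absorb2)
next
  case (insert x B)
  have x: "x \<notin> B \<union> B2" and d: "B \<inter> B2 = {}" using insert by auto
  have "bprob (insert x B \<union> B2) p (\<lambda>A. E (A \<inter> insert x B) \<and> F (A \<inter> B2)) =
    p x * bprob (B \<union> B2) p (\<lambda>A. E (insert x A \<inter> insert x B) \<and> F (insert x A \<inter> B2)) +
    (1 - p x) * bprob (B \<union> B2) p (\<lambda>A. E (A \<inter> insert x B) \<and> F (A \<inter> B2))"
    using x insert.hyps assms(2) by (simp add: bprob_insert del: Int_insert_left Int_insert_right)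
  also have "bprob (B \<union> B2) p (\<lambda>A. E (insert x A \<inter> insert x B) \<and> F (insert x A \<inter> B2)) =
      bprob (B \<union> B2) p (\<lambda>A. E (insert x (A \<inter> B)) \<and> F (A \<inter> B2))"
  proof (rule bprob_cong)
    fix A assume "A \<subseteq> B \<union> B2"
    have "insert x A \<inter> insert x B = insert x (A \<inter> B)" "insert x A \<inter> B2 = A \<inter> B2"
      using x by auto
    then show "(E (insert x A \<inter> insert x B) \<and> F (insert x A \<inter> B2)) = (E (insert x (A \<inter> B)) \<and> F (A \<inter> B2))"
      by simp
  qed simp
  also have "\<dots> = bprob B p (\<lambda>A. E (insert x A)) * bprob B2 p F"
    by (rule insert.IH[OF d])
  also have "bprob (B \<union> B2) p (\<lambda>A. E (A \<inter> insert x B) \<and> F (A \<inter> B2)) =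
      bprob (B \<union> B2) p (\<lambda>A. E (A \<inter> B) \<and> F (A \<inter> B2))"
  proof (rule bprob_cong)
    fix A assume "A \<subseteq> B \<union> B2"
    then have "A \<inter> insert x B = A \<inter> B" using x by auto
    then show "(E (A \<inter> insert x B) \<and> F (A \<inter> B2)) = (E (A \<inter> B) \<and> F (A \<inter> B2))" by simp
  qed simp
  also have "\<dots> = bprob B p E * bprob B2 p F"
    by (rule insert.IH[OF d])
  finally show ?case
    using insert.hyps by (simp add: bprob_insert algebra_simps)
qed

lemma bprob_indep_family:
  assumes "finite J" "\<And>j. j \<in> J \<Longrightarrow> finite (D j)" "disjoint_family_on D J"
  shows "bprob (\<Union>j\<in>J. D j) p (\<lambda>A. \<forall>j\<in>J. E j (A \<inter> D j)) = (\<Prod>j\<in>J. bprob (D j) p (E j))"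
  using assms
proof (induction J rule: finite_induct)
  case (insert j J)
  let ?U = "\<Union>i\<in>J. D i"
  have dj: "D j \<inter> ?U = {}"
    using insert.prems(2) insert.hyps(2) by (fastforce simp: disjoint_family_on_def)
  have "bprob (\<Union>i\<in>insert j J. D i) p (\<lambda>A. \<forall>i\<in>insert j J. E i (A \<inter> D i)) =
        bprob (D j \<union> ?U) p (\<lambda>A. E j (A \<inter> D j) \<and> (\<forall>i\<in>J. E i ((A \<inter> ?U) \<inter> D i)))"
  proof (rule bprob_cong[THEN trans[rotated]])
    fix A
    have "(A \<inter> ?U) \<inter> D i = A \<inter> D i" if "i \<in> J" for i using that by auto
    then show "(\<forall>i\<in>insert j J. E i (A \<inter> D i)) =
        (E j (A \<inter> D j) \<and> (\<forall>i\<in>J. E i ((A \<inter> ?U) \<inter> D i)))" by simp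
  qed simp_all
  also have "\<dots> = bprob (D j) p (E j) * bprob ?U p (\<lambda>A. \<forall>i\<in>J. E i (A \<inter> D i))"
    using insert.prems(1) insert.hyps dj by (intro bprob_indep) auto
  also have "bprob ?U p (\<lambda>A. \<forall>i\<in>J. E i (A \<inter> D i)) = (\<Prod>j\<in>J. bprob (D j) p (E j))"
    using insert.prems by (intro insert.IH) (auto simp: disjoint_family_on_def)
  finally show ?case using insert.hyps by simp
qed simp

lemma bprob_cylinder:
  assumes "finite B" "C \<subseteq> B" "D \<subseteq> B" "C \<inter> D = {}"
  shows "bprob B p (\<lambda>A. C \<subseteq> A \<and> A \<inter> D = {}) = (\<Prod>v\<in>C. p v) * (\<Prod>v\<in>D. 1 - p v)"
proof -
  have fin: "finite C" "finite D" using assms(1-3) by (auto intro: finite_subset)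
  have C: "bprob C p (\<lambda>A. C \<subseteq> A) = (\<Prod>v\<in>C. p v)"
  proof -
    have "{A. A \<subseteq> C \<and> C \<subseteq> A} = {C}" by auto
    then show ?thesis by (simp add: bprob_def)
  qed
  have D: "bprob D p (\<lambda>A. A = {}) = (\<Prod>v\<in>D. 1 - p v)"
  proof -
    have "{A. A \<subseteq> D \<and> A = {}} = {{}}" by auto
    then show ?thesis by (simp add: bprob_def)
  qed
  have "bprob B p (\<lambda>A. C \<subseteq> A \<and> A \<inter> D = {}) =
        bprob B p (\<lambda>A. C \<subseteq> (A \<inter> (C \<union> D)) \<inter> C \<and> (A \<inter> (C \<union> D)) \<inter> D = {})"
    by (rule bprob_cong) auto
  also have "\<dots> = bprob (B \<inter> (C \<union> D)) p (\<lambda>A. C \<subseteq> A \<inter> C \<and> A \<inter> D = {})"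
    using assms(1) by (rule bprob_restrict)
  also have "B \<inter> (C \<union> D) = C \<union> D" using assms by auto
  also have "bprob (C \<union> D) p (\<lambda>A. C \<subseteq> A \<inter> C \<and> A \<inter> D = {}) =
      bprob C p (\<lambda>A. C \<subseteq> A) * bprob D p (\<lambda>A. A = {})"
    using fin assms(4) by (rule bprob_indep)
  finally show ?thesis using C D by simp
qed

lemma bprob_all_open:
  assumes "finite B" "C \<subseteq> B"
  shows "bprob B p (\<lambda>A. C \<subseteq> A) = (\<Prod>v\<in>C. p v)"
  using bprob_cylinder[of B C "{}" p] assms by simp

lemma bprob_image:
  assumes "finite B" "inj_on f B"
  shows "bprob (f ` B) p E = bprob B (p \<circ> f) (\<lambda>A. E (f ` A))"
  using assms
proof (induction B arbitrary: E rule: finite_induct)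
  case (insert x B)
  then show ?case by (auto simp: bprob_insert)
qed simp

text \<open>The one-node case of comparing increasing events at densities \<open>p powr g\<close>
  and \<open>p\<close>: \<open>a\<close> and \<open>b\<close> stand for the probabilities with the
  node open and closed. For \<open>a = b\<close> both sides agree, and in \<open>a\<close> the right
  side grows at least as fast.\<close>

lemma powr_two_point:
  fixes a b p g :: real
  assumes "0 \<le> b" "b \<le> a" "0 < p" "p \<le> 1" "1 \<le> g"
  shows "p powr g * a powr g + (1 - p powr g) * b powr g \<le> (p * a + (1 - p) * b) powr g"
proof -
  \<comment> \<open>The claim is \<open>f b \<le> f a\<close>, because
    \<open>p * b + (1 - p) * b = b\<close>. The case \<open>b = 0\<close> is split off since the
    derivative of \<open>powr\<close> is taken at positive bases.\<close>
  define f where "f = (\<lambda>x. (p * x + (1 - p) * b) powr g - p powr g * x powr g)"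
  show ?thesis
  proof (cases "b = 0")
    case True
    with assms show ?thesis by (simp add: powr_mult)
  next
    case False
    then have b: "0 < b" using assms by simp
    have "f b \<le> f a"
    proof (rule DERIV_nonneg_imp_nondecreasing[OF assms(2)])
      fix x assume x: "b \<le> x" "x \<le> a"
      have pos: "0 < x" "0 < p * x + (1 - p) * b"
        using x b assms by (auto intro!: add_pos_nonneg mult_pos_pos)
      have "(f has_real_derivative
          g * (p * x + (1 - p) * b) powr (g - 1) * p - p powr g * (g * x powr (g - 1))) (at x)"
        unfolding f_def using pos
        by (auto intro!: derivative_eq_intros simp: powr_diff field_simps)
      moreover have "p powr g * x powr (g - 1) \<le> (p * x + (1 - p) * b) powr (g - 1) * p"
      proof -
        have "p powr g * x powr (g - 1) = (p * x) powr (g - 1) * p"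
          using assms pos by (simp add: powr_mult powr_diff)
        also have "\<dots> \<le> (p * x + (1 - p) * b) powr (g - 1) * p"
          using assms pos b by (intro mult_right_mono powr_mono2) auto
        finally show ?thesis .
      qed
      ultimately show "\<exists>y. (f has_real_derivative y) (at x) \<and> 0 \<le> y"
      proof (intro exI conjI)
        assume *: "p powr g * x powr (g - 1) \<le> (p * x + (1 - p) * b) powr (g - 1) * p"
        have "g * (p powr g * x powr (g - 1)) \<le> g * ((p * x + (1 - p) * b) powr (g - 1) * p)"
          using assms(5) by (intro mult_left_mono[OF *]) simp
        then show "0 \<le> g * (p * x + (1 - p) * b) powr (g - 1) * p - p powr g * (g * x powr (g - 1))"
          by (simp add: mult_ac)
      qed
    qed
    then show ?thesis by (simp add: f_def algebra_simps)
  qed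
qed

text \<open>\<open>ln P\<^sub>p(E) / ln p\<close> is nonincreasing in \<open>p\<close> for increasing \<open>E\<close>.\<close>

lemma bprob_powr_increasing:
  assumes "finite B" "0 < p" "p \<le> 1" "1 \<le> g"
    and "\<And>A A'. A \<subseteq> A' \<Longrightarrow> E A \<Longrightarrow> E A'"
  shows "bprob B (\<lambda>_. p powr g) E \<le> bprob B (\<lambda>_. p) E powr g"
  using assms(1,5)
proof (induction B arbitrary: E rule: finite_induct)
  case (insert x B)
  let ?E1 = "\<lambda>A. E (insert x A)"
  let ?s = "p powr g"
  have s: "0 \<le> ?s" "?s \<le> 1"
    using assms powr_mono2[of g p 1] by auto
  have r: "bprob B (\<lambda>_. p) E \<le> bprob B (\<lambda>_. p) ?E1"
  proof (rule bprob_mono_event)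
    show "?E1 A" if "E A" for A
      using insert.prems[of A "insert x A"] that by blast
  qed (use insert.hyps assms in auto)
  have i1: "bprob B (\<lambda>_. ?s) ?E1 \<le> bprob B (\<lambda>_. p) ?E1 powr g"
  proof (rule insert.IH)
    show "?E1 A'" if "A \<subseteq> A'" "?E1 A" for A A'
      using insert.prems[of "insert x A" "insert x A'"] that by blast
  qed
  have i0: "bprob B (\<lambda>_. ?s) E \<le> bprob B (\<lambda>_. p) E powr g"
    using insert.prems by (intro insert.IH) blast
  have "?s * bprob B (\<lambda>_. ?s) ?E1 + (1 - ?s) * bprob B (\<lambda>_. ?s) E \<le>
        ?s * bprob B (\<lambda>_. p) ?E1 powr g + (1 - ?s) * bprob B (\<lambda>_. p) E powr g"
    using i1 i0 s by (intro add_mono mult_left_mono) auto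
  also have "\<dots> \<le> (p * bprob B (\<lambda>_. p) ?E1 + (1 - p) * bprob B (\<lambda>_. p) E) powr g"
    using assms r insert.hyps by (intro powr_two_point bprob_nonneg) auto
  finally show ?case
    using insert.hyps by (simp add: bprob_insert)
qed auto

text \<open>The bridge from product measures to finite sums. \<open>I\<close> may be infinite, as
  for percolation on the whole lattice, and the factors may differ, as under the alternative; the
  event sees only whether \<open>Q\<close> holds at finitely many coordinates.\<close>

lemma measure_PiM_eq_bprob:
  fixes M :: "'i \<Rightarrow> 'a measure"
  assumes "\<And>i. i \<in> I \<Longrightarrow> prob_space (M i)" "finite B" "B \<subseteq> I"
    and "\<And>i. i \<in> B \<Longrightarrow> {x \<in> space (M i). Q i x} \<in> sets (M i)"
  shows "{\<omega> \<in> space (PiM I M). E {i \<in> B. Q i (\<omega> i)}} \<in> sets (PiM I M)" (is ?S)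
    and "measure (PiM I M) {\<omega> \<in> space (PiM I M). E {i \<in> B. Q i (\<omega> i)}} =
           bprob B (\<lambda>i. measure (M i) {x \<in> space (M i). Q i x}) E" (is ?M)
proof -
  \<comment> \<open>The locale for product probability spaces asks for a probability measure at
    every index. A point mass is put outside \<open>I\<close>, which leaves the product over
    \<open>I\<close> unchanged.\<close>
  define N where "N i = (if i \<in> I then M i else return (count_space UNIV) undefined)" for i
  have N: "prob_space (N i)" for i
    using assms(1) by (auto simp: N_def intro!: prob_space_return)
  have PN: "PiM I M = PiM I N"
    by (rule PiM_cong) (auto simp: N_def)
  interpret product_prob_space N I
    unfolding product_prob_space_def product_prob_space_axioms_def product_sigma_finite_def
    using N by (auto intro: prob_space_imp_sigma_finite)
  interpret P: prob_space "PiM I N" by (rule prob_space_PiM) (rule N)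
  \<comment> \<open>The configurations whose open nodes in \<open>B\<close> are exactly those of
    \<open>A\<close>. For different subsets of \<open>B\<close> these cylinders are disjoint, and
    the event is a union of them.\<close>
  define c where "c A = {\<omega> \<in> space (PiM I N). \<forall>i\<in>B. \<omega> i \<in> {x \<in> space (N i). Q i x \<longleftrightarrow> i \<in> A}}" for A
  have NM: "N i = M i" if "i \<in> B" for i using that assms(3) by (auto simp: N_def)
  have Qs: "{x \<in> space (N i). Q i x} \<in> sets (N i)" if "i \<in> B" for i
    using assms(4)[OF that] NM[OF that] by simp
  have Qns: "{x \<in> space (N i). \<not> Q i x} \<in> sets (N i)" if "i \<in> B" for i
  proof -
    have "{x \<in> space (N i). \<not> Q i x} = space (N i) - {x \<in> space (N i). Q i x}" by auto
    then show ?thesis using Qs[OF that] by auto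
  qed
  have meas: "{x \<in> space (N i). Q i x \<longleftrightarrow> i \<in> A} \<in> sets (N i)" if "i \<in> B" for i A
    using Qs[OF that] Qns[OF that] by (cases "i \<in> A") auto
  have c_sets: "c A \<in> sets (PiM I N)" for A
    unfolding c_def
  proof (rule sets.sets_Collect_finite_All[OF _ assms(2)])
    fix i assume i: "i \<in> B"
    then have "i \<in> I" using assms(3) by auto
    from measurable_sets[OF measurable_component_singleton[OF this, of N] meas[OF i, of A]]
    show "{\<omega> \<in> space (PiM I N). \<omega> i \<in> {x \<in> space (N i). Q i x \<longleftrightarrow> i \<in> A}} \<in> sets (PiM I N)"
      by (simp add: vimage_def Int_def conj_commute)
  qed
  have eq: "{\<omega> \<in> space (PiM I N). E {i \<in> B. Q i (\<omega> i)}} = (\<Union>A\<in>{A. A \<subseteq> B \<and> E A}. c A)"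
  proof (intro equalityI subsetI)
    fix \<omega> assume w: "\<omega> \<in> {\<omega> \<in> space (PiM I N). E {i \<in> B. Q i (\<omega> i)}}"
    then have "\<omega> \<in> space (PiM I N)" by blast
    then have "\<omega> \<in> PiE I (\<lambda>i. space (N i))" unfolding space_PiM .
    then have "\<omega> i \<in> space (N i)" if "i \<in> B" for i
      using PiE_mem subsetD[OF assms(3) that] by metis
    with w have "\<omega> \<in> c {i \<in> B. Q i (\<omega> i)}"
      by (simp add: c_def)
    moreover have "{i \<in> B. Q i (\<omega> i)} \<in> {A. A \<subseteq> B \<and> E A}" using w by simp
    ultimately show "\<omega> \<in> (\<Union>A\<in>{A. A \<subseteq> B \<and> E A}. c A)" by (rule UN_I[rotated])
  next
    fix \<omega> assume "\<omega> \<in> (\<Union>A\<in>{A. A \<subseteq> B \<and> E A}. c A)"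
    then obtain A where A: "A \<subseteq> B" "E A" "\<omega> \<in> c A" by auto
    then have "{i \<in> B. Q i (\<omega> i)} = A" by (auto simp: c_def)
    with A show "\<omega> \<in> {\<omega> \<in> space (PiM I N). E {i \<in> B. Q i (\<omega> i)}}" by (auto simp: c_def)
  qed
  have fin: "finite {A. A \<subseteq> B \<and> E A}" using assms(2) by simp
  show ?S unfolding PN eq using fin c_sets by auto
  have disj: "disjoint_family_on c {A. A \<subseteq> B \<and> E A}"
  proof (unfold disjoint_family_on_def, intro ballI impI)
    fix A A' assume "A \<in> {A. A \<subseteq> B \<and> E A}" "A' \<in> {A. A \<subseteq> B \<and> E A}" "A \<noteq> A'"
    then obtain i where "i \<in> B" "(i \<in> A) \<noteq> (i \<in> A')" by auto
    then show "c A \<inter> c A' = {}" by (auto simp: c_def)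
  qed
  have "measure (PiM I N) (\<Union>A\<in>{A. A \<subseteq> B \<and> E A}. c A) = (\<Sum>A | A \<subseteq> B \<and> E A. measure (PiM I N) (c A))"
    using fin c_sets disj by (intro P.finite_measure_finite_Union) auto
  also have "\<dots> = bprob B (\<lambda>i. measure (N i) {x \<in> space (N i). Q i x}) E"
    unfolding bprob_def
  proof (rule sum.cong[OF refl])
    fix A assume "A \<in> {A. A \<subseteq> B \<and> E A}"
    then have A: "A \<subseteq> B" by auto
    have "emeasure (PiM I N) (c A) =
        (\<Prod>i\<in>B. emeasure (N i) {x \<in> space (N i). Q i x \<longleftrightarrow> i \<in> A})"
      unfolding c_def using assms(2,3) meas by (intro emeasure_PiM_Collect) auto
    then have "measure (PiM I N) (c A) =
        (\<Prod>i\<in>B. measure (N i) {x \<in> space (N i). Q i x \<longleftrightarrow> i \<in> A})"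
      by (simp add: P.emeasure_eq_measure M.emeasure_eq_measure prod_ennreal prod_nonneg)
    also have "\<dots> = (\<Prod>i\<in>A. measure (N i) {x \<in> space (N i). Q i x \<longleftrightarrow> i \<in> A}) *
        (\<Prod>i\<in>B - A. measure (N i) {x \<in> space (N i). Q i x \<longleftrightarrow> i \<in> A})"
      by (subst prod.subset_diff[OF A assms(2)]) (rule mult.commute)
    also have "(\<Prod>i\<in>A. measure (N i) {x \<in> space (N i). Q i x \<longleftrightarrow> i \<in> A}) =
        (\<Prod>i\<in>A. measure (N i) {x \<in> space (N i). Q i x})"
      by (rule prod.cong) auto
    also have "(\<Prod>i\<in>B - A. measure (N i) {x \<in> space (N i). Q i x \<longleftrightarrow> i \<in> A}) =
        (\<Prod>i\<in>B - A. 1 - measure (N i) {x \<in> space (N i). Q i x})"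
    proof (rule prod.cong[OF refl])
      fix i assume i: "i \<in> B - A"
      have "{x \<in> space (N i). Q i x \<longleftrightarrow> i \<in> A} = space (N i) - {x \<in> space (N i). Q i x}"
        using i by auto
      then show "measure (N i) {x \<in> space (N i). Q i x \<longleftrightarrow> i \<in> A} =
          1 - measure (N i) {x \<in> space (N i). Q i x}"
        using Qs i by (simp add: prob_space.prob_compl[OF N])
    qed
    finally show "measure (PiM I N) (c A) =
      (\<Prod>i\<in>A. measure (N i) {x \<in> space (N i). Q i x}) *
      (\<Prod>i\<in>B - A. 1 - measure (N i) {x \<in> space (N i). Q i x})" .
  qed
  also have "\<dots> = bprob B (\<lambda>i. measure (M i) {x \<in> space (M i). Q i x}) E"
    using NM by (intro bprob_cong) auto
  finally show ?M unfolding PN eq .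
qed

section \<open>Clusters\<close>

lemma adjacent_commute: "adjacent v w \<longleftrightarrow> adjacent w v"
  by (simp add: adjacent_def abs_minus_commute)

lemma adjacent_translate [simp]: "adjacent (u + v) (u + w) \<longleftrightarrow> adjacent v w"
  by (simp add: adjacent_def)

lemma adjacent_coord: "adjacent v w \<Longrightarrow> \<bar>v $ i - w $ i\<bar> \<le> 1"
  unfolding adjacent_def
  by (metis (no_types, lifting) abs_ge_zero finite member_le_sum UNIV_I)

lemma adjacent_axis: "adjacent v (v + axis i 1)"
proof -
  have "(\<Sum>j\<in>UNIV. \<bar>v $ j - (v + axis i 1) $ j\<bar>) = (\<Sum>j\<in>UNIV. if j = i then 1 else 0)"
    by (intro sum.cong) (auto simp: axis_def)
  then show ?thesis by (simp add: adjacent_def)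
qed

lemma bij_betw_vec_lambda: "bij_betw vec_lambda {f. \<forall>i. f i \<in> S i} {v. \<forall>i. v $ i \<in> S i}"
  by (rule bij_betwI[where g = vec_nth]) (auto simp: vec_lambda_inverse)

lemma
  fixes S :: "'d::finite \<Rightarrow> 'a set"
  assumes "\<And>i. finite (S i)"
  shows finite_vec_box: "finite {v::'a ^ 'd. \<forall>i. v $ i \<in> S i}"
    and card_vec_box: "card {v::'a ^ 'd. \<forall>i. v $ i \<in> S i} = (\<Prod>i\<in>UNIV. card (S i))"
proof -
  have eq: "{f. \<forall>i. f i \<in> S i} = PiE UNIV S" by (auto simp: PiE_def)
  show "finite {v::'a ^ 'd. \<forall>i. v $ i \<in> S i}"
    using bij_betw_finite[OF bij_betw_vec_lambda, of S] assms unfolding eq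
    by (simp add: finite_PiE)
  show "card {v::'a ^ 'd. \<forall>i. v $ i \<in> S i} = (\<Prod>i\<in>UNIV. card (S i))"
    using bij_betw_same_card[OF bij_betw_vec_lambda, of S] unfolding eq
    by (simp add: card_PiE)
qed

lemma finite_grid [simp]: "finite (grid m :: (int ^ 'd::finite) set)"
  using finite_vec_box[of "\<lambda>_. {1..int m}"] by (simp add: grid_def)

lemma card_grid: "card (grid m :: (int ^ 'd::finite) set) = m ^ CARD('d)"
  using card_vec_box[of "\<lambda>_. {1..int m}"] by (simp add: grid_def)

definition lbox :: "int ^ 'd \<Rightarrow> nat \<Rightarrow> (int ^ 'd) set" where
  "lbox v k = {w. \<forall>i. \<bar>w $ i - v $ i\<bar> \<le> int k}"

lemma finite_lbox [simp]: "finite (lbox v k :: (int ^ 'd::finite) set)"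
proof -
  have "lbox v k = {w. \<forall>i. w $ i \<in> {v $ i - int k..v $ i + int k}}"
    by (auto simp: lbox_def abs_le_iff algebra_simps)
  then show ?thesis using finite_vec_box[of "\<lambda>i. {v $ i - int k..v $ i + int k}"] by simp
qed

lemma lbox_self [simp]: "v \<in> lbox v k"
  by (simp add: lbox_def)

lemma lbox_mono: "k \<le> l \<Longrightarrow> lbox v k \<subseteq> lbox v l"
proof
  fix w assume "k \<le> l" "w \<in> lbox v k"
  then have "\<bar>w $ i - v $ i\<bar> \<le> int l" for i
    unfolding lbox_def using order_trans[of "\<bar>w $ i - v $ i\<bar>" "int k" "int l"] by simp
  then show "w \<in> lbox v l" by (simp add: lbox_def)
qed

lemma lbox_step:
  assumes "w \<in> lbox v k" "adjacent w x"
  shows "x \<in> lbox v (Suc k)"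
  unfolding lbox_def
proof (intro CollectI allI)
  fix i
  have "\<bar>w $ i - v $ i\<bar> \<le> int k" using assms(1) by (simp add: lbox_def)
  then show "\<bar>x $ i - v $ i\<bar> \<le> int (Suc k)" using adjacent_coord[OF assms(2), of i] by simp
qed

lemma lbox_translate: "lbox (u + v) k = (+) u ` lbox v k"
proof (intro equalityI subsetI)
  fix x assume "x \<in> lbox (u + v) k"
  then have "x - u \<in> lbox v k" by (simp add: lbox_def algebra_simps)
  then show "x \<in> (+) u ` lbox v k" by (intro image_eqI[where x = "x - u"]) auto
qed (auto simp: lbox_def)

lemma cluster_subset: "cluster A v \<subseteq> A"
proof
  fix w assume "w \<in> cluster A v"
  then have "v \<in> A" "(v, w) \<in> {(x, y). x \<in> A \<and> y \<in> A \<and> adjacent x y}\<^sup>*"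
    by (auto simp: cluster_def)
  from this(2,1) show "w \<in> A" by (induction rule: rtrancl_induct) auto
qed

lemma cluster_self: "v \<in> A \<Longrightarrow> v \<in> cluster A v"
  by (simp add: cluster_def)

lemma cluster_eq_empty: "v \<notin> A \<Longrightarrow> cluster A v = {}"
  by (simp add: cluster_def)

lemma cluster_root: "w \<in> cluster A v \<Longrightarrow> v \<in> A"
  by (simp add: cluster_def)

lemma cluster_step:
  assumes "w \<in> cluster A v" "x \<in> A" "adjacent w x"
  shows "x \<in> cluster A v"
  using assms cluster_subset[of A v] unfolding cluster_def
  by (auto intro: rtrancl_into_rtrancl)

lemma cluster_induct [consumes 1, case_names root step]:
  assumes "w \<in> cluster A v" "P v"
    "\<And>x y. x \<in> cluster A v \<Longrightarrow> P x \<Longrightarrow> y \<in> A \<Longrightarrow> adjacent x y \<Longrightarrow> P y"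
  shows "P w"
proof -
  have v: "v \<in> A" and r: "(v, w) \<in> {(x, y). x \<in> A \<and> y \<in> A \<and> adjacent x y}\<^sup>*"
    using assms(1) by (auto simp: cluster_def)
  from r show ?thesis
  proof (induction rule: rtrancl_induct)
    case (step x y)
    then show ?case using v by (intro assms(3)[of x y]) (auto simp: cluster_def)
  qed fact
qed

text \<open>The tool for upper bounds on clusters. Read contrapositively, it yields an edge leaving
  any set that contains the root but not the whole cluster.\<close>

lemma cluster_least:
  assumes "v \<in> D" "\<And>x y. x \<in> D \<Longrightarrow> y \<in> A \<Longrightarrow> adjacent x y \<Longrightarrow> y \<in> D"
  shows "cluster A v \<subseteq> D"
proof
  fix w assume "w \<in> cluster A v"
  then show "w \<in> D" by (induction rule: cluster_induct) (use assms in auto)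
qed

lemma cluster_mono:
  assumes "A \<subseteq> A'"
  shows "cluster A v \<subseteq> cluster A' v"
proof
  fix w assume w: "w \<in> cluster A v"
  then have "v \<in> A'" using assms by (auto dest: cluster_root)
  with w show "w \<in> cluster A' v"
    by (induction rule: cluster_induct) (use assms in \<open>auto intro: cluster_step cluster_self\<close>)
qed

lemma cluster_idem [simp]: "cluster (cluster A v) v = cluster A v"
proof (rule equalityI[OF cluster_subset], rule subsetI)
  fix w assume w: "w \<in> cluster A v"
  then have "v \<in> cluster A v" using cluster_root cluster_self by metis
  with w show "w \<in> cluster (cluster A v) v"
    by (induction rule: cluster_induct) (auto intro: cluster_step cluster_self)
qed

lemma cluster_sym:
  assumes "w \<in> cluster A v"
  shows "v \<in> cluster A w"
proof -
  have v: "v \<in> A" by (rule cluster_root[OF assms])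
  from assms show ?thesis
  proof (induction rule: cluster_induct)
    case root then show ?case using v by (rule cluster_self)
  next
    case (step x y)
    have x: "x \<in> A" using step cluster_subset by blast
    have "x \<in> cluster A y"
      by (rule cluster_step[OF cluster_self]) (use x step adjacent_commute in auto)
    then have "cluster A x \<subseteq> cluster A y"
      by (intro cluster_least) (auto intro: cluster_step)
    with step show ?case by blast
  qed
qed

lemma cluster_eqI:
  assumes "w \<in> cluster A v"
  shows "cluster A w = cluster A v"
  by (intro equalityI cluster_least) (use assms cluster_sym in \<open>auto intro: cluster_step\<close>)

lemma cluster_translate: "cluster ((+) u ` A) (u + v) = (+) u ` cluster A v"
proof -
  have sub: "(+) u ` cluster A v \<subseteq> cluster ((+) u ` A) (u + v)" for u :: "int ^ 'b" and A v
  proof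
    fix x assume "x \<in> (+) u ` cluster A v"
    then obtain w where w: "w \<in> cluster A v" "x = u + w" by auto
    from w(1) have "u + w \<in> cluster ((+) u ` A) (u + v)"
    proof (induction rule: cluster_induct)
      case root
      show ?case using cluster_root[OF w(1)] by (intro cluster_self) auto
    next
      case (step x y)
      then show ?case by (intro cluster_step[OF step.IH]) auto
    qed
    with w show "x \<in> cluster ((+) u ` A) (u + v)" by simp
  qed
  have "(+) (-u) ` cluster ((+) u ` A) (u + v) \<subseteq> cluster ((+) (-u) ` (+) u ` A) (-u + (u + v))"
    by (rule sub)
  then have "(+) u ` (+) (-u) ` cluster ((+) u ` A) (u + v) \<subseteq> (+) u ` cluster A v"
    by (intro image_mono) (simp add: image_image)
  then show ?thesis using sub[of u A v] by (simp add: image_image)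
qed

lemma cluster_eq_imp_root: "cluster D v = D \<Longrightarrow> D \<noteq> {} \<Longrightarrow> v \<in> D"
  using cluster_eq_empty by blast

text \<open>The equation \<open>cluster D v = D\<close> is the form in which connectedness is used;
  for nonempty \<open>D\<close> it also makes \<open>v\<close> a node of \<open>D\<close>. Adding a
  neighbour and joining two sets along an edge are the two ways to enlarge such sets.\<close>

lemma cluster_insert_eq:
  assumes "cluster D v = D" "x \<in> D" "adjacent x y"
  shows "cluster (insert y D) v = insert y D"
proof (rule equalityI[OF cluster_subset])
  have "D \<subseteq> cluster (insert y D) v"
    using cluster_mono[of D "insert y D" v] assms(1) by auto
  moreover from this assms have "y \<in> cluster (insert y D) v"
    by (intro cluster_step[of x _ v y]) auto
  ultimately show "insert y D \<subseteq> cluster (insert y D) v" by blast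
qed

lemma cluster_Un_eq:
  assumes "cluster D v = D" "cluster D' v' = D'" "x \<in> D" "v' \<in> D'" "adjacent x v'"
  shows "cluster (D \<union> D') v = D \<union> D'"
proof (rule equalityI[OF cluster_subset])
  have D: "D \<subseteq> cluster (D \<union> D') v"
    using cluster_mono[of D "D \<union> D'" v] assms(1) by auto
  then have v': "v' \<in> cluster (D \<union> D') v"
    using assms by (intro cluster_step[of x _ v v']) auto
  have "D' \<subseteq> cluster (D \<union> D') v'"
    using cluster_mono[of D' "D \<union> D'" v'] assms(2) by auto
  then have "D' \<subseteq> cluster (D \<union> D') v" using cluster_eqI[OF v'] by simp
  with D show "D \<union> D' \<subseteq> cluster (D \<union> D') v" by blast
qed

text \<open>Grow \<open>D\<close> from the root by one node at a time. While \<open>D\<close> is not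
  the whole cluster, an edge leaves it inside \<open>A\<close>; this works for infinite clusters as
  well.\<close>

lemma ex_connected_subset:
  assumes "v \<in> A" "infinite (cluster A v) \<or> Suc n \<le> card (cluster A v)"
  shows "\<exists>D\<subseteq>A. card D = Suc n \<and> cluster D v = D"
  using assms(2)
proof (induction n)
  case 0
  have "cluster {v} v = {v}" using cluster_subset[of "{v}" v] cluster_self[of v "{v}"] by auto
  then show ?case using assms(1) by (intro exI[of _ "{v}"]) auto
next
  case (Suc n)
  then have "infinite (cluster A v) \<or> Suc n \<le> card (cluster A v)" by auto
  from Suc.IH[OF this] obtain D where D: "D \<subseteq> A" "card D = Suc n" "cluster D v = D"
    by blast
  have fin: "finite D" using D(2) by (intro card_ge_0_finite) simp
  have v: "v \<in> D" using D(2) by (intro cluster_eq_imp_root[OF D(3)]) auto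
  have DC: "D \<subseteq> cluster A v" using cluster_mono[OF D(1), of v] D(3) by simp
  have "\<not> cluster A v \<subseteq> D"
  proof
    assume "cluster A v \<subseteq> D"
    with DC have "cluster A v = D" by simp
    with Suc.prems D(2) fin show False by simp
  qed
  then obtain x y where xy: "x \<in> D" "y \<in> A" "adjacent x y" "y \<notin> D"
    using cluster_least[OF v, of A] by blast
  show ?case
    using D xy fin cluster_insert_eq[OF D(3) xy(1,3)]
    by (intro exI[of _ "insert y D"]) auto
qed

lemma connected_subset_lbox:
  assumes "finite D" "cluster D v = D"
  shows "D \<subseteq> lbox v (card D)"
proof (cases "D = {}")
  case False
  then have v: "v \<in> D" using assms cluster_eq_imp_root by blast
  \<comment> \<open>While \<open>D\<close> sticks out of the box, enlarging the radius by one
    catches a new node. At \<open>n = card D\<close> the second alternative would require more nodes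
    than \<open>D\<close> has.\<close>
  have claim: "D \<subseteq> lbox v n \<or> (Suc n \<le> card (D \<inter> lbox v n))" for n
  proof (induction n)
    case 0
    have "card {v} \<le> card (D \<inter> lbox v 0)"
      using v assms(1) by (intro card_mono) auto
    then show ?case by simp
  next
    case (Suc n)
    show ?case
    proof (cases "D \<subseteq> lbox v n")
      case True
      then show ?thesis using lbox_mono[of n "Suc n" v] by auto
    next
      case False
      then obtain x y where xy: "x \<in> D \<inter> lbox v n" "y \<in> D" "adjacent x y" "y \<notin> D \<inter> lbox v n"
        using cluster_least[of v "D \<inter> lbox v n" D] v assms(2) by auto
      then have "insert y (D \<inter> lbox v n) \<subseteq> D \<inter> lbox v (Suc n)"
        using lbox_step[of x v n y] lbox_mono[of n "Suc n" v] by auto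
      then have "card (insert y (D \<inter> lbox v n)) \<le> card (D \<inter> lbox v (Suc n))"
        using assms(1) by (intro card_mono) auto
      moreover have "card (insert y (D \<inter> lbox v n)) = Suc (card (D \<inter> lbox v n))"
        using assms(1) xy by (intro card_insert_disjoint) auto
      moreover have "Suc n \<le> card (D \<inter> lbox v n)" using Suc False by blast
      ultimately show ?thesis by linarith
    qed
  qed
  have "card (D \<inter> lbox v (card D)) \<le> card D" using assms(1) by (intro card_mono) auto
  then show ?thesis using claim[of "card D"] by auto
qed simp

text \<open>For \<open>k \<ge> 1\<close> this says that the cluster of \<open>v\<close> has at least \<open>k\<close> nodes; in contrast to
  \<open>k \<le> card (cluster A v)\<close> it is also correct for infinite clusters.\<close>

definition big :: "(int ^ 'd) set \<Rightarrow> int ^ 'd \<Rightarrow> nat \<Rightarrow> bool" where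
  "big A v k \<longleftrightarrow> (\<exists>D\<subseteq>A. finite D \<and> card D = k \<and> cluster D v = D)"

lemma big_iff:
  assumes "1 \<le> k"
  shows "big A v k \<longleftrightarrow> infinite (cluster A v) \<or> k \<le> card (cluster A v)"
proof
  assume "big A v k"
  then obtain D where D: "D \<subseteq> A" "finite D" "card D = k" "cluster D v = D"
    by (auto simp: big_def)
  then have "D \<subseteq> cluster A v" using cluster_mono[OF D(1), of v] by simp
  then show "infinite (cluster A v) \<or> k \<le> card (cluster A v)"
    using D card_mono by blast
next
  assume r: "infinite (cluster A v) \<or> k \<le> card (cluster A v)"
  have "v \<in> A"
  proof (rule ccontr)
    assume "v \<notin> A"
    with r assms show False by (simp add: cluster_eq_empty)
  qed
  moreover obtain n where n: "k = Suc n" using assms by (cases k) auto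
  ultimately obtain D where "D \<subseteq> A" "card D = Suc n" "cluster D v = D"
    using ex_connected_subset r by blast
  then show "big A v k" unfolding big_def n
    by (intro exI[of _ D]) (auto intro: card_ge_0_finite)
qed

lemma big_mono: "A \<subseteq> A' \<Longrightarrow> big A v k \<Longrightarrow> big A' v k"
  by (auto simp: big_def)

text \<open>A witness of \<open>k\<close> nodes rooted at \<open>v\<close> cannot reach beyond
  distance \<open>k\<close>. A statement about a possibly infinite cluster is thus decided by
  finitely many nodes, and disjoint boxes give independent events.\<close>

lemma big_local: "big (A \<inter> lbox v k) v k \<longleftrightarrow> big A v k"
proof
  assume "big A v k"
  then obtain D where D: "D \<subseteq> A" "finite D" "card D = k" "cluster D v = D"
    by (auto simp: big_def)
  then have "D \<subseteq> lbox v k" using connected_subset_lbox by metis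
  with D show "big (A \<inter> lbox v k) v k" by (auto simp: big_def)
qed (rule big_mono[rotated], auto)

lemma big_antimono: 
  assumes "1 \<le> k" "k \<le> l" "big A v l"
  shows "big A v k"
  using assms by (auto simp: big_iff)

lemma big_translate: "big ((+) u ` A) (u + v) k \<longleftrightarrow> big A v k"
proof -
  have imp: "big ((+) u ` A) (u + v) k" if "big A v k" for u :: "int ^ 'b" and A v
  proof -
    from that obtain D where D: "D \<subseteq> A" "finite D" "card D = k" "cluster D v = D"
      by (auto simp: big_def)
    then show ?thesis unfolding big_def
      by (intro exI[of _ "(+) u ` D"]) (auto simp: cluster_translate card_image)
  qed
  show ?thesis
    using imp[of A v u] imp[of "(+) u ` A" "u + v" "-u"] by (auto simp: image_image)
qed

lemma big_iff_card:
  assumes "finite A" "1 \<le> k"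
  shows "big A v k \<longleftrightarrow> k \<le> card (cluster A v)"
  using assms cluster_subset[of A v] finite_subset by (auto simp: big_iff)

lemma successively_adjacent_connected:
  assumes "successively adjacent vs" "vs \<noteq> []"
  shows "cluster (set vs) (hd vs) = set vs"
  using assms
proof (induction vs rule: induct_list012)
  case (2 x)
  then show ?case using cluster_subset[of "{x}" x] cluster_self[of x "{x}"] by auto
next
  case (3 x y zs)
  then have IH: "cluster (set (y # zs)) y = set (y # zs)" and xy: "adjacent x y" by auto
  have "cluster ({x} \<union> set (y # zs)) x = {x} \<union> set (y # zs)"
    by (rule cluster_Un_eq[OF _ IH])
      (use xy cluster_subset[of "{x}" x] cluster_self[of x "{x}"] in auto)
  then show ?case by (simp add: insert_commute)
qed simp

section \<open>The tail of the cluster of the origin\<close>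

lemma bprob_big_eq:
  fixes v :: "int ^ 'd::finite"
  assumes "finite B" "lbox v k \<subseteq> B"
  shows "bprob B (\<lambda>_. p) (\<lambda>A. big A v k) = bprob (lbox 0 k) (\<lambda>_. p) (\<lambda>A. big A (0 :: int ^ 'd) k)"
proof -
  have "bprob B (\<lambda>_. p) (\<lambda>A. big A v k) = bprob B (\<lambda>_. p) (\<lambda>A. big (A \<inter> lbox v k) v k)"
    by (simp add: big_local)
  also have "\<dots> = bprob (lbox v k) (\<lambda>_. p) (\<lambda>A. big A v k)"
    using assms by (simp add: bprob_restrict[where E = "\<lambda>A. big A v k"] Int_absorb1)
  also have "lbox v k = (+) v ` lbox 0 k"
    using lbox_translate[of v 0 k] by simp
  also have "bprob \<dots> (\<lambda>_. p) (\<lambda>A. big A v k) = bprob (lbox 0 k) (\<lambda>_. p) (\<lambda>A. big ((+) v ` A) (v + 0) k)"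
    by (simp add: bprob_image o_def)
  finally show ?thesis by (simp only: big_translate)
qed

lemma origin_cluster_size_ge_iff:
  assumes "1 \<le> k"
  shows "enat k \<le> origin_cluster_size \<omega> \<longleftrightarrow> big {v. \<omega> v} 0 k"
  using assms by (auto simp: origin_cluster_size_def big_iff Let_def)

lemma
  fixes D :: "'d::finite itself"
  assumes "p \<in> {0..1}" "1 \<le> k"
  shows sets_cluster_tail: "{\<omega> \<in> space (site_percolation p). enat k \<le> origin_cluster_size \<omega>}
            \<in> sets (site_percolation p :: (int ^ 'd \<Rightarrow> bool) measure)"
    and cluster_tail_eq: "cluster_tail D p k =
            bprob (lbox 0 k) (\<lambda>_. p) (\<lambda>A. big A (0 :: int ^ 'd) k)"
proof -
  let ?M = "\<lambda>_ :: int ^ 'd. measure_pmf (bernoulli_pmf p)"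
  have ev: "enat k \<le> origin_cluster_size \<omega> \<longleftrightarrow> big {v \<in> lbox 0 k. \<omega> v} 0 k" for \<omega> :: "int ^ 'd \<Rightarrow> bool"
  proof -
    have "{v. \<omega> v} \<inter> lbox 0 k = {v \<in> lbox 0 k. \<omega> v}" by auto
    then show ?thesis
      using big_local[of "{v. \<omega> v}" 0 k] assms(2) by (simp add: origin_cluster_size_ge_iff)
  qed
  have ps: "prob_space (?M i)" for i by (rule prob_space_measure_pmf)
  have Q: "{x \<in> space (?M i). x} \<in> sets (?M i)" for i by simp
  note * = measure_PiM_eq_bprob[where I = UNIV and M = ?M and Q = "\<lambda>_ x. x" and
      E = "\<lambda>A. big A 0 k", OF ps finite_lbox[of 0 k] subset_UNIV Q]
  show "{\<omega> \<in> space (site_percolation p). enat k \<le> origin_cluster_size \<omega>}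
            \<in> sets (site_percolation p :: (int ^ 'd \<Rightarrow> bool) measure)"
    using *(1) unfolding site_percolation_def ev .
  have "measure (measure_pmf (bernoulli_pmf p)) {x. x} = p"
  proof -
    have "{x. x} = {True}" by auto
    then show ?thesis using assms(1) by (simp add: measure_pmf_single)
  qed
  then show "cluster_tail D p k = bprob (lbox 0 k) (\<lambda>_. p) (\<lambda>A. big A (0 :: int ^ 'd) k)"
    using *(2) unfolding site_percolation_def cluster_tail_def Let_def ev by simp
qed

context
  fixes D :: "'d::finite itself"
begin

text \<open>\<open>B\<close> may cut off part of the box around \<open>v\<close>, as happens near
  the edge of the grid: all probabilities are raised to \<open>q\<close>, and then the cluster may
  use nodes outside \<open>B\<close> as well.\<close>

lemma bprob_big_le:
  fixes v :: "int ^ 'd"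
  assumes "finite B" "1 \<le> k" "\<And>v. v \<in> B \<Longrightarrow> 0 \<le> p v \<and> p v \<le> q" "0 \<le> q" "q \<le> 1"
  shows "bprob B p (\<lambda>A. big A v k) \<le> cluster_tail D q k"
proof -
  let ?B = "B \<union> lbox v k"
  have "bprob B p (\<lambda>A. big A v k) \<le> bprob B (\<lambda>_. q) (\<lambda>A. big A v k)"
    using assms by (intro bprob_mono_increasing) (auto intro: big_mono)
  also have "\<dots> = bprob ?B (\<lambda>_. q) (\<lambda>A. big (A \<inter> B) v k)"
    using assms by (subst bprob_restrict) (auto simp: Int_absorb1)
  also have "\<dots> \<le> bprob ?B (\<lambda>_. q) (\<lambda>A. big A v k)"
    using assms by (intro bprob_mono_event) (auto intro: big_mono)
  also have "\<dots> = cluster_tail D q k"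
    using assms by (subst bprob_big_eq) (auto simp: cluster_tail_eq)
  finally show ?thesis .
qed

lemma bprob_big_eq_tail:
  fixes v :: "int ^ 'd"
  assumes "finite B" "1 \<le> k" "lbox v k \<subseteq> B" "q \<in> {0..1}"
  shows "bprob B (\<lambda>_. q) (\<lambda>A. big A v k) = cluster_tail D q k"
  using assms by (subst bprob_big_eq) (auto simp: cluster_tail_eq)

lemma cluster_tail_nonneg: "0 \<le> cluster_tail D p k"
  by (simp add: cluster_tail_def Let_def)

lemma cluster_tail_le_1:
  assumes "p \<in> {0..1}" "1 \<le> k"
  shows "cluster_tail D p k \<le> 1"
  using assms by (auto simp: cluster_tail_eq intro!: bprob_le_1)

lemma cluster_tail_mono:
  assumes "0 \<le> p" "p \<le> q" "q \<le> 1" "1 \<le> k"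
  shows "cluster_tail D p k \<le> cluster_tail D q k"
  using assms by (auto simp: cluster_tail_eq intro!: bprob_mono_increasing intro: big_mono)

lemma cluster_tail_antimono:
  assumes "p \<in> {0..1}" "1 \<le> k" "k \<le> l"
  shows "cluster_tail D p l \<le> cluster_tail D p k"
proof -
  have "cluster_tail D p l = bprob (lbox 0 l) (\<lambda>_. p) (\<lambda>A. big A (0 :: int ^ 'd) l)"
    using assms by (intro cluster_tail_eq) auto
  also have "\<dots> \<le> bprob (lbox 0 l) (\<lambda>_. p) (\<lambda>A. big A (0 :: int ^ 'd) k)"
    using assms by (intro bprob_mono_event) (auto intro: big_antimono)
  also have "\<dots> = cluster_tail D p k"
    using assms by (intro bprob_big_eq_tail) (auto simp: lbox_mono)
  finally show ?thesis .
qed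

lemma cluster_tail_powr:
  assumes "0 < p" "p \<le> 1" "1 \<le> g" "1 \<le> k"
  shows "cluster_tail D (p powr g) k \<le> cluster_tail D p k powr g"
proof -
  have "p powr g \<in> {0..1}" using assms powr_mono2[of g p 1] by auto
  then show ?thesis
    using assms by (auto simp: cluster_tail_eq intro!: bprob_powr_increasing intro: big_mono)
qed

lemma AE_origin_cluster_finite_iff:
  assumes "p \<in> {0..1}"
  shows "(AE \<omega> in (site_percolation p :: (int ^ 'd \<Rightarrow> bool) measure). origin_cluster_size \<omega> < \<infinity>)
           \<longleftrightarrow> (\<lambda>k. cluster_tail D p k) \<longlonglongrightarrow> 0"
proof -
  let ?P = "site_percolation p :: (int ^ 'd \<Rightarrow> bool) measure"
  interpret P: prob_space ?P
    unfolding site_percolation_def by (intro prob_space_PiM prob_space_measure_pmf)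
  \<comment> \<open>The index is shifted by one because the reduction of the tail events to finitely
    many nodes is stated for \<open>k \<ge> 1\<close>.\<close>
  let ?E = "\<lambda>k. {\<omega> \<in> space ?P. enat (Suc k) \<le> origin_cluster_size \<omega>}"
  have E: "?E k \<in> P.events" for k
    using assms by (intro sets_cluster_tail) auto
  have inf: "{\<omega> \<in> space ?P. \<not> origin_cluster_size \<omega> < \<infinity>} = (\<Inter>k. ?E k)"
  proof (intro equalityI subsetI)
    fix \<omega> assume w: "\<omega> \<in> (\<Inter>k. ?E k)"
    have "\<not> origin_cluster_size \<omega> < \<infinity>"
    proof
      assume "origin_cluster_size \<omega> < \<infinity>"
      then obtain n where "origin_cluster_size \<omega> = enat n" using less_infinityE by blast
      moreover have "enat (Suc n) \<le> origin_cluster_size \<omega>" using w by auto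
      ultimately show False by simp
    qed
    then show "\<omega> \<in> {\<omega> \<in> space ?P. \<not> origin_cluster_size \<omega> < \<infinity>}" using w by auto
  qed auto
  have "(\<lambda>k. measure ?P (?E k)) \<longlonglongrightarrow> measure ?P (\<Inter>k. ?E k)"
    using E by (intro P.finite_Lim_measure_decseq)
      (auto simp: decseq_def intro: order_trans[rotated])
  then have lim: "(\<lambda>k. cluster_tail D p (Suc k)) \<longlonglongrightarrow> measure ?P (\<Inter>k. ?E k)"
    unfolding cluster_tail_def Let_def .
  have "(AE \<omega> in ?P. origin_cluster_size \<omega> < \<infinity>) \<longleftrightarrow> emeasure ?P (\<Inter>k. ?E k) = 0"
    by (rule AE_iff_measurable[OF _ inf]) (use E in \<open>auto intro!: sets.countable_INT\<close>)
  also have "\<dots> \<longleftrightarrow> measure ?P (\<Inter>k. ?E k) = 0"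
    by (simp add: P.emeasure_eq_measure)
  also have "\<dots> \<longleftrightarrow> (\<lambda>k. cluster_tail D p (Suc k)) \<longlonglongrightarrow> 0"
    using lim LIMSEQ_unique by fastforce
  also have "\<dots> \<longleftrightarrow> (\<lambda>k. cluster_tail D p k) \<longlonglongrightarrow> 0"
    by (rule filterlim_sequentially_Suc)
  finally show ?thesis .
qed

section \<open>Self-avoiding paths and the existence of a subcritical density\<close>

lemma finite_neighbours: "finite {w :: int ^ 'd. adjacent v w}"
proof (rule finite_subset)
  show "{w :: int ^ 'd. adjacent v w} \<subseteq> lbox v 1"
    using adjacent_coord by (fastforce simp: lbox_def adjacent_commute)
qed simp

text \<open>The path is listed from the endpoint back to the root, so that a step extends it at the
  head. If the new node already lies on the path, the part before it is cut off (loop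
  erasure).\<close>

lemma connected_path:
  assumes "w \<in> cluster A v"
  shows "\<exists>vs. vs \<noteq> [] \<and> last vs = v \<and> hd vs = w \<and> set vs \<subseteq> A \<and> distinct vs \<and> successively adjacent vs"
  using assms
proof (induction rule: cluster_induct)
  case root
  show ?case using cluster_root[OF assms] by (intro exI[of _ "[v]"]) auto
next
  case (step x y)
  then obtain vs where vs: "vs \<noteq> []" "last vs = v" "hd vs = x" "set vs \<subseteq> A" "distinct vs"
    "successively adjacent vs" by blast
  show ?case
  proof (cases "y \<in> set vs")
    case False
    then show ?thesis using vs step adjacent_commute
      by (intro exI[of _ "y # vs"]) (auto simp: successively_Cons)
  next
    case True
    then obtain as bs where "vs = as @ y # bs" by (meson split_list)
    then show ?thesis using vs
      by (intro exI[of _ "y # bs"]) (auto simp: successively_append_iff split: if_splits)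
  qed
qed

lemma finite_walks_bound:
  defines "N \<equiv> card {w :: int ^ 'd. adjacent 0 w}"
  shows "finite {vs :: (int ^ 'd) list. length vs = Suc n \<and> last vs = 0 \<and> successively adjacent vs} \<and>
    card {vs :: (int ^ 'd) list. length vs = Suc n \<and> last vs = 0 \<and> successively adjacent vs} \<le> N ^ n"
proof (induction n)
  case 0
  have "{vs :: (int ^ 'd) list. length vs = Suc 0 \<and> last vs = 0 \<and> successively adjacent vs} = {[0]}"
    by (auto simp: length_Suc_conv)
  then show ?case by simp
next
  case (Suc n)
  let ?W = "\<lambda>n. {vs :: (int ^ 'd) list. length vs = Suc n \<and> last vs = 0 \<and> successively adjacent vs}"
  let ?N = "{w :: int ^ 'd. adjacent 0 w}"
  let ?f = "\<lambda>(vs, s). (hd vs + s) # vs"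
  have sub: "?W (Suc n) \<subseteq> ?f ` (?W n \<times> ?N)"
  proof
    fix us assume us: "us \<in> ?W (Suc n)"
    then obtain x vs where x: "us = x # vs" "length vs = Suc n" by (auto simp: length_Suc_conv)
    then obtain y zs where y: "vs = y # zs" by (auto simp: length_Suc_conv)
    have "adjacent (y + 0) (y + (x - y))" using us x y adjacent_commute[of x y] by simp
    then have "x - y \<in> ?N" by (simp only: adjacent_translate) simp
    moreover have "vs \<in> ?W n" using us x y by auto
    ultimately show "us \<in> ?f ` (?W n \<times> ?N)"
      using x y by (intro image_eqI[of _ _ "(vs, x - y)"]) auto
  qed
  have fin: "finite (?W n \<times> ?N)" using Suc finite_neighbours by simp
  then have "finite (?W (Suc n))" using sub finite_surj by blast
  moreover have "card (?W (Suc n)) \<le> card (?W n) * card ?N"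
    using surj_card_le[OF fin sub] by (simp add: card_cartesian_product)
  moreover have "card (?W n) * card ?N \<le> N ^ n * N"
    unfolding N_def[symmetric] using Suc by (intro mult_right_mono) auto
  ultimately show ?case by (simp add: mult.commute)
qed

text \<open>A cluster that leaves the box of radius \<open>n\<close> contains a self-avoiding path of \<open>n\<close> steps from
  the origin.\<close>

lemma cluster_tail_le_walks:
  assumes "p \<in> {0..1}"
  shows "cluster_tail D p (Suc (card (lbox (0 :: int ^ 'd) n))) \<le>
           (real (card {w :: int ^ 'd. adjacent 0 w}) * p) ^ n"
proof -
  \<comment> \<open>One node more than the box holds, so a cluster of this size must leave the
    box.\<close>
  define k where "k = Suc (card (lbox (0 :: int ^ 'd) n))"
  define W where "W = {vs :: (int ^ 'd) list. length vs = Suc n \<and> last vs = 0 \<and> successively adjacent vs}"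
  let ?W' = "{vs \<in> W. distinct vs}"
  let ?N = "real (card {w :: int ^ 'd. adjacent 0 w})"
  have W: "finite W" "real (card W) \<le> ?N ^ n"
    using finite_walks_bound[of n] unfolding W_def by (auto simp flip: of_nat_power)
  have n: "n \<le> k"
  proof -
    have "inj_on (\<lambda>j::nat. axis undefined (int j) :: int ^ 'd) {..<n}"
      by (auto simp: inj_on_def axis_eq_axis)
    moreover have "(\<lambda>j::nat. axis undefined (int j) :: int ^ 'd) ` {..<n} \<subseteq> lbox 0 n"
      by (auto simp: lbox_def axis_def)
    ultimately have "card {..<n} \<le> card (lbox (0 :: int ^ 'd) n)"
      by (intro card_inj_on_le) auto
    then show ?thesis by (simp add: k_def)
  qed
  let ?B = "lbox (0 :: int ^ 'd) k \<union> (\<Union>vs\<in>W. set vs)"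
  have finB: "finite ?B" using W by auto
  have ex: "\<exists>vs\<in>?W'. set vs \<subseteq> A" if "big A 0 k" "A \<subseteq> ?B" for A :: "(int ^ 'd) set"
  proof -
    have fin: "finite (cluster A 0)"
      using that(2) finB cluster_subset finite_subset by metis
    then have "k \<le> card (cluster A 0)" using that(1) by (simp add: big_iff k_def)
    then have "\<not> cluster A 0 \<subseteq> lbox 0 n"
      using card_mono[OF finite_lbox, of "cluster A 0" 0 n] unfolding k_def by linarith
    then obtain w where w: "w \<in> cluster A 0" "w \<notin> lbox 0 n" by auto
    obtain vs where vs: "vs \<noteq> []" "last vs = 0" "hd vs = w" "set vs \<subseteq> A" "distinct vs"
      "successively adjacent vs" using connected_path[OF w(1)] by blast
    have "n < length vs"
    proof (rule ccontr)
      assume "\<not> n < length vs"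
      then have "length vs \<le> n" by simp
      moreover have "hd us \<in> lbox 0 (length us)"
        if "us \<noteq> []" "last us = 0" "successively adjacent us" for us :: "(int ^ 'd) list"
        using that
      proof (induction us rule: induct_list012)
        case (3 x y zs)
        then show ?case using lbox_step[of y 0 "length (y # zs)" x] adjacent_commute[of x y] by simp
      qed auto
      ultimately show False using vs w(2) lbox_mono by blast
    qed
    then have d: "Suc n \<le> length vs" by simp
    \<comment> \<open>The last \<open>Suc n\<close> nodes still form a path that ends at the origin,
      now of the prescribed length.\<close>
    define us where "us = drop (length vs - Suc n) vs"
    have "us \<in> W" using vs d unfolding W_def us_def
      by (auto simp: successively_append_iff last_drop)
        (metis append_take_drop_id successively_append_iff)
    moreover have "distinct us" using vs by (simp add: us_def)
    moreover have "set us \<subseteq> A" using vs set_drop_subset unfolding us_def by fastforce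
    ultimately show ?thesis by blast
  qed
  have "cluster_tail D p k = bprob ?B (\<lambda>_. p) (\<lambda>A. big A (0 :: int ^ 'd) k)"
    using assms finB by (intro bprob_big_eq_tail[symmetric]) (auto simp: k_def)
  also have "\<dots> \<le> bprob ?B (\<lambda>_. p) (\<lambda>A. \<exists>vs\<in>?W'. set vs \<subseteq> A)"
    using assms finB ex by (intro bprob_mono_event) auto
  also have "\<dots> \<le> (\<Sum>vs\<in>?W'. bprob ?B (\<lambda>_. p) (\<lambda>A. set vs \<subseteq> A))"
    using assms finB W by (intro bprob_Ex_le) auto
  also have "\<dots> = (\<Sum>vs\<in>?W'. p ^ Suc n)"
  proof (rule sum.cong[OF refl])
    fix vs assume vs: "vs \<in> ?W'"
    then have "bprob ?B (\<lambda>_. p) (\<lambda>A. set vs \<subseteq> A) = (\<Prod>v\<in>set vs. p)"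
      using finB by (intro bprob_all_open) auto
    then show "bprob ?B (\<lambda>_. p) (\<lambda>A. set vs \<subseteq> A) = p ^ Suc n"
      using vs by (simp add: W_def distinct_card)
  qed
  also have "\<dots> = real (card ?W') * p ^ Suc n" by simp
  also have "\<dots> \<le> real (card W) * p ^ n"
  proof (rule mult_mono)
    have "card ?W' \<le> card W" using W by (intro card_mono) auto
    then show "real (card ?W') \<le> real (card W)" by simp
    show "p ^ Suc n \<le> p ^ n" using assms by (intro power_decreasing) auto
  qed (use assms in auto)
  also have "\<dots> \<le> ?N ^ n * p ^ n"
    using W assms by (intro mult_right_mono) auto
  finally show ?thesis by (simp add: k_def power_mult_distrib)
qed

lemma decseq_tendsto_zeroI:
  fixes f :: "nat \<Rightarrow> real"
  assumes "\<And>k. 0 \<le> f k" "\<And>k l. 1 \<le> k \<Longrightarrow> k \<le> l \<Longrightarrow> f l \<le> f k"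
    "\<And>e. 0 < e \<Longrightarrow> \<exists>k\<ge>1. f k < e"
  shows "f \<longlonglongrightarrow> 0"
proof (rule LIMSEQ_I)
  fix e :: real assume "0 < e"
  then obtain k where k: "1 \<le> k" "f k < e" using assms(3) by blast
  then have "norm (f l - 0) < e" if "l \<ge> k" for l
    using assms(1)[of l] assms(2)[OF k(1) that] by simp
  then show "\<exists>k. \<forall>l\<ge>k. norm (f l - 0) < e" by blast
qed

text \<open>This makes the set behind the critical probability nonempty, so that the usual facts
  about suprema of reals apply to it.\<close>

lemma subcritical_set_nonempty:
  "\<exists>p. 0 < p \<and> p < 1 \<and> (\<lambda>k. cluster_tail D p k) \<longlonglongrightarrow> 0"
proof -
  let ?N = "real (card {w :: int ^ 'd. adjacent 0 w})"
  \<comment> \<open>Chosen so that \<open>?N * p \<le> 1 / 2\<close>, which turns the path bound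
    into a geometric sequence; the added \<open>1\<close> keeps the denominator away from
    zero.\<close>
  define p where "p = 1 / (2 * (?N + 1))"
  have p: "0 < p" "p < 1" by (auto simp: p_def field_simps)
  have Np: "?N * p \<le> 1 / 2" "0 \<le> ?N * p" using p by (auto simp: p_def field_simps)
  have "(\<lambda>k. cluster_tail D p k) \<longlonglongrightarrow> 0"
  proof (rule decseq_tendsto_zeroI)
    fix e :: real assume "0 < e"
    then obtain n where n: "(1 / 2) ^ n < e" using real_arch_pow_inv[of e "1/2"] by auto
    have "cluster_tail D p (Suc (card (lbox (0 :: int ^ 'd) n))) \<le> (?N * p) ^ n"
      using p by (intro cluster_tail_le_walks) auto
    also have "\<dots> \<le> (1 / 2) ^ n" using Np by (intro power_mono)
    finally show "\<exists>k\<ge>1. cluster_tail D p k < e" using n by (intro exI[of _ "Suc (card (lbox (0 :: int ^ 'd) n))"]) auto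
  qed (use p in \<open>auto intro: cluster_tail_antimono cluster_tail_nonneg\<close>)
  then show ?thesis using p by blast
qed

lemma critical_prob_eq:
  "critical_prob D = Sup {p. 0 < p \<and> p < 1 \<and> (\<lambda>k. cluster_tail D p k) \<longlonglongrightarrow> 0}"
proof -
  have "{p. 0 < p \<and> p < 1 \<and> (AE \<omega> in (site_percolation p :: (int ^ 'd \<Rightarrow> bool) measure).
                origin_cluster_size \<omega> < \<infinity>)} =
        {p. 0 < p \<and> p < 1 \<and> (\<lambda>k. cluster_tail D p k) \<longlonglongrightarrow> 0}"
    using AE_origin_cluster_finite_iff by (intro Collect_cong) auto
  then show ?thesis unfolding critical_prob_def by simp
qed

lemma critical_prob_le_1: "critical_prob D \<le> 1"
  unfolding critical_prob_eq using subcritical_set_nonempty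
  by (intro cSup_least) auto

lemma cluster_tail_tendsto_0:
  assumes "0 < p" "p < critical_prob D"
  shows "(\<lambda>k. cluster_tail D p k) \<longlonglongrightarrow> 0"
proof -
  have "bdd_above {p. 0 < p \<and> p < 1 \<and> (\<lambda>k. cluster_tail D p k) \<longlonglongrightarrow> 0}"
    by (intro bdd_aboveI[of _ 1]) auto
  moreover have "{p. 0 < p \<and> p < 1 \<and> (\<lambda>k. cluster_tail D p k) \<longlonglongrightarrow> 0} \<noteq> {}"
    using subcritical_set_nonempty by blast
  ultimately obtain q where q: "0 < q" "q < 1" "(\<lambda>k. cluster_tail D q k) \<longlonglongrightarrow> 0" "p < q"
    using assms(2) unfolding critical_prob_eq by (subst (asm) less_cSup_iff) auto
  show ?thesis
  proof (rule Lim_null_comparison[OF _ q(3)])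
    show "\<forall>\<^sub>F k in sequentially. norm (cluster_tail D p k) \<le> cluster_tail D q k"
      using eventually_ge_at_top[of 1]
      by eventually_elim (use assms q in \<open>auto simp: cluster_tail_nonneg intro: cluster_tail_mono\<close>)
  qed
qed

end

section \<open>Lattice animals and the decay rate\<close>

text \<open>The limit is the supremum of \<open>u n / n\<close>. Hence
  \<open>u n \<le> L * real n\<close> holds for every \<open>n \<ge> 1\<close>, which later bounds
  the animal weights without any asymptotics.\<close>

lemma fekete_superadditive:
  fixes u :: "nat \<Rightarrow> real"
  assumes super: "\<And>m n. 1 \<le> m \<Longrightarrow> 1 \<le> n \<Longrightarrow> u m + u n \<le> u (m + n)"
    and le0: "\<And>n. 1 \<le> n \<Longrightarrow> u n \<le> 0"
  obtains L where "L \<le> 0" "(\<lambda>n. u n / real n) \<longlonglongrightarrow> L" "\<And>n. 1 \<le> n \<Longrightarrow> u n \<le> L * real n"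
proof -
  let ?S = "(\<lambda>n. u n / real n) ` {1..}"
  define L where "L = Sup ?S"
  have bdd: "bdd_above ?S"
    using le0 by (intro bdd_aboveI[of _ 0]) (auto simp: divide_nonpos_nonneg)
  have upper: "u n / real n \<le> L" if "1 \<le> n" for n
    unfolding L_def using bdd that by (intro cSup_upper) auto
  have "L \<le> 0"
    unfolding L_def using le0 by (intro cSup_least) (auto simp: divide_nonpos_nonneg)
  moreover have "u n \<le> L * real n" if "1 \<le> n" for n
    using upper[OF that] that by (simp add: field_simps)
  moreover have "(\<lambda>n. u n / real n) \<longlonglongrightarrow> L"
  proof (rule order_tendstoI)
    fix a assume "a > L"
    show "\<forall>\<^sub>F n in sequentially. u n / real n < a"
      using eventually_ge_at_top[of 1] by eventually_elim (rule le_less_trans[OF upper \<open>L < a\<close>])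
  next
    fix a assume "a < L"
    then obtain m where m: "1 \<le> m" "a < u m / real m"
      using less_cSup_iff[OF _ bdd, of a] unfolding L_def by auto
    \<comment> \<open>All \<open>u r\<close> are nonpositive, so \<open>- M\<close> lies below each
      of them and handles all remainders at once.\<close>
    define M where "M = (\<Sum>r=1..m. - u r)"
    have ur: "- M \<le> u r" if "r \<in> {1..m}" for r
      using member_le_sum[of r "{1..m}" "\<lambda>r. - u r"] that le0 by (auto simp: M_def)
    have mult: "real q * u m + u r \<le> u (q * m + r)" if "1 \<le> r" for q r
    proof (induction q)
      case (Suc q)
      have "u m + u (q * m + r) \<le> u (m + (q * m + r))" using m that by (intro super) auto
      with Suc show ?case by (simp add: algebra_simps)
    qed simp
    have lower: "u m / real m - M / real n \<le> u n / real n" if n: "1 \<le> n" for n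
    proof -
      \<comment> \<open>Dividing \<open>n - 1\<close> instead of \<open>n\<close> puts the remainder
        into \<open>{1..m}\<close>; superadditivity is available for positive arguments
        only.\<close>
      define q where "q = (n - 1) div m"
      define r where "r = Suc ((n - 1) mod m)"
      have nqr: "n = q * m + r" and r: "r \<in> {1..m}"
        using n m by (auto simp: q_def r_def Suc_le_eq)
      have "real q * real m * (u m / real m) \<ge> real n * (u m / real m)"
        using le0[OF m(1)] by (intro mult_right_mono_neg)
          (auto simp: nqr divide_nonpos_nonneg simp flip: of_nat_mult)
      then have "real n * (u m / real m) - M \<le> real q * u m + u r"
        using ur[OF r] m by simp
      also have "\<dots> \<le> u n" unfolding nqr using r by (intro mult) auto
      finally have "(real n * (u m / real m) - M) / real n \<le> u n / real n"
        by (rule divide_right_mono) simp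
      then show ?thesis using n by (simp add: diff_divide_distrib)
    qed
    have "(\<lambda>n. u m / real m - M / real n) \<longlonglongrightarrow> u m / real m - 0"
      by (intro tendsto_intros lim_const_over_n)
    then have "\<forall>\<^sub>F n in sequentially. a < u m / real m - M / real n"
      using m by (auto dest: order_tendstoD(1))
    then show "\<forall>\<^sub>F n in sequentially. a < u n / real n"
      using eventually_ge_at_top[of 1] by eventually_elim (use lower in force)
  qed
  ultimately show ?thesis using that by blast
qed

section \<open>Lattice animals and their weights\<close>

definition outer_boundary :: "(int ^ 'd) set \<Rightarrow> (int ^ 'd) set" where
  "outer_boundary C = {y. y \<notin> C \<and> (\<exists>x\<in>C. adjacent x y)}"

definition animals :: "nat \<Rightarrow> (int ^ 'd) set set" where
  "animals k = {C. finite C \<and> card C = k \<and> cluster C 0 = C}"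

text \<open>For a nonempty animal \<open>C\<close> this is the probability that the open cluster of
  the origin equals \<open>C\<close>: the nodes of \<open>C\<close> are open and its outer boundary
  is closed.\<close>

definition animal_weight :: "real \<Rightarrow> (int ^ 'd) set \<Rightarrow> real" where
  "animal_weight p C = p ^ card C * (1 - p) ^ card (outer_boundary C)"

lemma finite_outer_boundary:
  fixes C :: "(int ^ 'd::finite) set"
  assumes "finite C"
  shows "finite (outer_boundary C)"
proof (rule finite_subset)
  show "outer_boundary C \<subseteq> (\<Union>x\<in>C. {y. adjacent x y})" by (auto simp: outer_boundary_def)
qed (use assms finite_neighbours in auto)

lemma outer_boundary_translate: "outer_boundary ((+) u ` C) = (+) u ` outer_boundary C"
proof -
  have sub: "(+) u ` outer_boundary C \<subseteq> outer_boundary ((+) u ` C)" for u :: "int ^ 'b" and C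
    by (auto simp: outer_boundary_def)
  have "(+) (-u) ` outer_boundary ((+) u ` C) \<subseteq> outer_boundary ((+) (-u) ` (+) u ` C)"
    by (rule sub)
  then have "(+) u ` (+) (-u) ` outer_boundary ((+) u ` C) \<subseteq> (+) u ` outer_boundary C"
    by (intro image_mono) (simp add: image_image)
  then show ?thesis using sub[of u C] by (simp add: image_image)
qed

lemma animal_weight_translate: "animal_weight p ((+) u ` C) = animal_weight p C"
  by (simp add: animal_weight_def outer_boundary_translate card_image)

lemma animals_subset_lbox: "C \<in> animals k \<Longrightarrow> C \<subseteq> lbox 0 k"
  using connected_subset_lbox by (auto simp: animals_def)

lemma outer_boundary_subset_lbox:
  assumes "C \<subseteq> lbox v k"
  shows "outer_boundary C \<subseteq> lbox v (Suc k)"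
proof
  fix y assume "y \<in> outer_boundary C"
  then obtain x where "x \<in> C" "adjacent x y" by (auto simp: outer_boundary_def)
  then show "y \<in> lbox v (Suc k)" using assms lbox_step by blast
qed

lemma finite_animals: "finite (animals k :: (int ^ 'd::finite) set set)"
  by (rule finite_subset[of _ "Pow (lbox 0 k)"]) (use animals_subset_lbox in auto)

lemma zero_in_animal: "C \<in> animals k \<Longrightarrow> 1 \<le> k \<Longrightarrow> 0 \<in> C"
  by (rule cluster_eq_imp_root) (auto simp: animals_def)

lemma cluster_eq_animal:
  assumes "C \<in> animals k" "1 \<le> k" "C \<subseteq> A" "A \<inter> outer_boundary C = {}"
  shows "cluster A 0 = C"
proof
  show "cluster A 0 \<subseteq> C"
    using zero_in_animal[OF assms(1,2)] assms(4)
    by (intro cluster_least) (auto simp: outer_boundary_def)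
  show "C \<subseteq> cluster A 0"
    using cluster_mono[OF assms(3), of 0] assms(1) by (auto simp: animals_def)
qed

lemma bprob_animal:
  fixes C :: "(int ^ 'd::finite) set"
  assumes "C \<in> animals k" "finite B" "lbox 0 (Suc k) \<subseteq> B"
  shows "bprob B (\<lambda>_. p) (\<lambda>A. C \<subseteq> A \<and> A \<inter> outer_boundary C = {}) = animal_weight p C"
proof -
  have "C \<subseteq> B"
    using animals_subset_lbox[OF assms(1)] lbox_mono[of k "Suc k" 0] assms(3) by auto
  moreover have "outer_boundary C \<subseteq> B"
    using outer_boundary_subset_lbox[OF animals_subset_lbox[OF assms(1)]] assms(3) by auto
  moreover have "C \<inter> outer_boundary C = {}" by (auto simp: outer_boundary_def)
  ultimately show ?thesis
    using assms by (subst bprob_cylinder) (auto simp: animal_weight_def)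
qed

text \<open>Animals rooted at a lowest point in the direction \<open>i\<close>. They can be concatenated
  without overlap, and up to translation and choice of the root every animal is of this form.\<close>

definition rooted_animals :: "'d \<Rightarrow> nat \<Rightarrow> (int ^ 'd) set set" where
  "rooted_animals i k = {C \<in> animals k. \<forall>v\<in>C. 0 \<le> v $ i}"

definition rooted_weight :: "'d::finite \<Rightarrow> real \<Rightarrow> nat \<Rightarrow> real" where
  "rooted_weight i p k = (\<Sum>C\<in>rooted_animals i k. animal_weight p C)"

lemma finite_rooted_animals: "finite (rooted_animals i k :: (int ^ 'd::finite) set set)"
  unfolding rooted_animals_def using finite_animals by (rule finite_subset[rotated]) auto

lemma animal_weight_nonneg: "p \<in> {0..1} \<Longrightarrow> 0 \<le> animal_weight p C"
  by (auto simp: animal_weight_def)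

text \<open>Translate an animal so that a lowest node in direction \<open>i\<close> becomes the
  origin. The result and the new position of the old origin determine the animal. This position is
  one of \<open>k\<close> nodes, hence the factor \<open>k\<close>, which is harmless on the
  exponential scale.\<close>

lemma sum_animal_weight_le:
  fixes i :: "'d::finite"
  assumes "p \<in> {0..1}" "1 \<le> k"
  shows "(\<Sum>C\<in>animals k. animal_weight p (C :: (int ^ 'd) set)) \<le> real k * rooted_weight i p k"
proof -
  define low where "low C = arg_min_on (\<lambda>y :: int ^ 'd. y $ i) C" for C
  have low: "low C \<in> C" "\<forall>v\<in>C. low C $ i \<le> v $ i" if C: "C \<in> animals k" for C
  proof -
    have "finite C" "C \<noteq> {}" using C assms(2) by (auto simp: animals_def)
    then show "low C \<in> C" "\<forall>v\<in>C. low C $ i \<le> v $ i"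
      using arg_min_if_finite(1)[of C] arg_min_least[of C _ "\<lambda>y. y $ i"]
      by (auto simp: low_def)
  qed
  define f where "f C = ((+) (- low C) ` C, - low C)" for C
  have inj: "inj_on f (animals k)"
  proof (rule inj_onI)
    fix C C' assume "f C = f C'"
    then have "low C = low C'" "(+) (- low C) ` C = (+) (- low C') ` C'" by (auto simp: f_def)
    then have "(+) (low C) ` (+) (- low C) ` C = (+) (low C) ` (+) (- low C) ` C'" by simp
    then show "C = C'" by (simp add: image_image)
  qed
  have img: "f ` animals k \<subseteq> Sigma (rooted_animals i k) (\<lambda>C. C)"
  proof
    fix z assume "z \<in> f ` animals k"
    then obtain C where C: "C \<in> animals k" and z: "z = f C" by auto
    have "cluster C (low C) = C"
      using cluster_eqI[of "low C" C 0] low[OF C] C by (simp add: animals_def)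
    then have "cluster ((+) (- low C) ` C) (- low C + low C) = (+) (- low C) ` C"
      by (simp only: cluster_translate)
    then have "(+) (- low C) ` C \<in> rooted_animals i k"
      using C low[OF C] by (auto simp: rooted_animals_def animals_def card_image)
    moreover have "- low C \<in> (+) (- low C) ` C"
      using zero_in_animal[OF C assms(2)] by (intro image_eqI[of _ _ 0]) auto
    ultimately show "z \<in> Sigma (rooted_animals i k) (\<lambda>C. C)" by (simp add: z f_def)
  qed
  have fin: "finite (Sigma (rooted_animals i k) (\<lambda>C. C))"
    using finite_rooted_animals by (intro finite_SigmaI) (auto simp: rooted_animals_def animals_def)
  have "(\<Sum>C\<in>animals k. animal_weight p (C :: (int ^ 'd) set)) = (\<Sum>C\<in>animals k. animal_weight p (fst (f C)))"
    unfolding f_def fst_conv animal_weight_translate ..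
  also have "\<dots> = (\<Sum>z\<in>f ` animals k. animal_weight p (fst z))"
    by (simp add: sum.reindex[OF inj])
  also have "\<dots> \<le> (\<Sum>z\<in>Sigma (rooted_animals i k) (\<lambda>C. C). animal_weight p (fst z))"
    using img fin assms(1) by (intro sum_mono2) (auto simp: animal_weight_nonneg)
  also have "\<dots> = (\<Sum>C\<in>rooted_animals i k. \<Sum>v\<in>C. animal_weight p C)"
    using finite_rooted_animals
    by (subst sum.Sigma) (auto simp: rooted_animals_def animals_def split_def)
  also have "\<dots> = (\<Sum>C\<in>rooted_animals i k. real k * animal_weight p C)"
    by (intro sum.cong) (auto simp: rooted_animals_def animals_def)
  finally show ?thesis by (simp add: rooted_weight_def sum_distrib_left)
qed

text \<open>A boundary node of the union is a boundary node of one of the parts, so the union pays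
  for at most as many closed nodes as the two parts together.\<close>

lemma animal_weight_Un:
  fixes A :: "(int ^ 'd::finite) set"
  assumes "finite A" "finite B" "A \<inter> B = {}" "p \<in> {0..1}"
  shows "animal_weight p A * animal_weight p B \<le> animal_weight p (A \<union> B)"
proof -
  have "outer_boundary (A \<union> B) \<subseteq> outer_boundary A \<union> outer_boundary B"
    by (auto simp: outer_boundary_def)
  then have "card (outer_boundary (A \<union> B)) \<le> card (outer_boundary A \<union> outer_boundary B)"
    using assms finite_outer_boundary by (intro card_mono) auto
  also have "\<dots> \<le> card (outer_boundary A) + card (outer_boundary B)" by (rule card_Un_le)
  finally have "(1 - p) ^ (card (outer_boundary A) + card (outer_boundary B))
      \<le> (1 - p) ^ card (outer_boundary (A \<union> B))"
    using assms(4) by (intro power_decreasing) auto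
  then have "p ^ (card A + card B) * (1 - p) ^ (card (outer_boundary A) + card (outer_boundary B))
      \<le> p ^ (card A + card B) * (1 - p) ^ card (outer_boundary (A \<union> B))"
    using assms(4) by (intro mult_left_mono) auto
  then show ?thesis
    using assms by (simp add: animal_weight_def card_Un_disjoint power_add mult_ac)
qed

text \<open>A highest point of the first animal is joined to the root of the second one. The first
  animal can be recovered as the set of the \<open>m\<close> lowest vertices of the union.\<close>

lemma rooted_weight_supermult:
  fixes i :: "'d::finite"
  assumes "p \<in> {0..1}" "1 \<le> m" "1 \<le> n"
  shows "rooted_weight i p m * rooted_weight i p n \<le> rooted_weight i p (m + n)"
proof -
  define top where "top C = arg_min_on (\<lambda>y :: int ^ 'd. - y $ i) C" for C
  have top: "top C \<in> C" "\<forall>v\<in>C. v $ i \<le> top C $ i" if C: "C \<in> rooted_animals i m" for C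
  proof -
    have "finite C" "C \<noteq> {}" using C assms(2) by (auto simp: rooted_animals_def animals_def)
    then show "top C \<in> C" "\<forall>v\<in>C. v $ i \<le> top C $ i"
      using arg_min_if_finite(1)[of C] arg_min_least[of C _ "\<lambda>y. - y $ i"]
      by (auto simp: top_def)
  qed
  \<comment> \<open>The root of \<open>B\<close> is placed one step above \<open>top A\<close>. As
    \<open>B\<close> lies in the half-space \<open>0 \<le> v $ i\<close>, its copy lies strictly
    above \<open>A\<close>.\<close>
  define sh where "sh A B = (+) (top A + axis i 1) ` B" for A B
  define glue where "glue = (\<lambda>(A, B). A \<union> sh A B)"
  let ?R = "rooted_animals i m \<times> rooted_animals i n"
  have shl: "top A $ i < v $ i" if "B \<in> rooted_animals i n" "v \<in> sh A B" for A B v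
    using that by (auto simp: sh_def rooted_animals_def axis_def)
  have disj: "A \<inter> sh A B = {}" if "A \<in> rooted_animals i m" "B \<in> rooted_animals i n" for A B
    using top[OF that(1)] shl[OF that(2), of _ A] by fastforce
  have lower: "A = {v \<in> glue (A, B). v $ i \<le> top A $ i}"
    if "A \<in> rooted_animals i m" "B \<in> rooted_animals i n" for A B
    using top[OF that(1)] shl[OF that(2), of _ A] by (fastforce simp: glue_def)
  have inj: "inj_on glue ?R"
  proof (rule inj_onI, clarsimp)
    fix A B A' B'
    assume *: "A \<in> rooted_animals i m" "B \<in> rooted_animals i n"
      "A' \<in> rooted_animals i m" "B' \<in> rooted_animals i n"
      and eq: "glue (A, B) = glue (A', B')"
    \<comment> \<open>Both are sublevel sets, in direction \<open>i\<close>, of the same union,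
      hence nested; equal cardinality then makes them equal.\<close>
    have "A \<subseteq> A' \<or> A' \<subseteq> A"
    proof (cases "top A $ i \<le> top A' $ i")
      case True
      then have "A \<subseteq> A'"
        by (subst lower[OF *(1,2)], subst lower[OF *(3,4)], unfold eq) auto
      then show ?thesis ..
    next
      case False
      then have "A' \<subseteq> A"
        by (subst lower[OF *(1,2)], subst lower[OF *(3,4)], unfold eq) auto
      then show ?thesis ..
    qed
    moreover have "finite A" "finite A'" "card A = card A'"
      using * by (auto simp: rooted_animals_def animals_def)
    ultimately have AA: "A = A'" using card_subset_eq by metis
    have "sh A B = glue (A, B) - A" "sh A' B' = glue (A', B') - A'"
      using disj[OF *(1,2)] disj[OF *(3,4)] by (auto simp: glue_def)
    then have "sh A B = sh A B'" using eq AA by simp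
    then have "B = B'" unfolding sh_def by (subst (asm) inj_image_eq_iff) auto
    then show "A = A' \<and> B = B'" using AA by simp
  qed
  have img: "glue ` ?R \<subseteq> rooted_animals i (m + n)"
  proof clarify
    fix A B assume AB: "A \<in> rooted_animals i m" "B \<in> rooted_animals i n"
    have A: "finite A" "card A = m" "cluster A 0 = A" "\<forall>v\<in>A. 0 \<le> v $ i"
      and B: "finite B" "card B = n" "cluster B 0 = B" "\<forall>v\<in>B. 0 \<le> v $ i"
      using AB by (auto simp: rooted_animals_def animals_def)
    have "0 \<in> B" using AB(2) assms(3) zero_in_animal by (auto simp: rooted_animals_def)
    then have root: "top A + axis i 1 \<in> sh A B" unfolding sh_def by (intro image_eqI[of _ _ 0]) auto
    have "cluster (sh A B) (top A + axis i 1 + 0) = sh A B"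
      unfolding sh_def cluster_translate B(3) ..
    then have "cluster (A \<union> sh A B) 0 = A \<union> sh A B"
      using A(3) root top(1)[OF AB(1)] adjacent_axis by (intro cluster_Un_eq) auto
    moreover have "card (sh A B) = n" "finite (sh A B)" using B by (auto simp: sh_def card_image)
    moreover have "0 \<le> v $ i" if "v \<in> sh A B" for v
      using shl[OF AB(2) that] top(1)[OF AB(1)] A(4) by fastforce
    ultimately show "glue (A, B) \<in> rooted_animals i (m + n)"
      using A disj[OF AB] by (auto simp: rooted_animals_def animals_def glue_def card_Un_disjoint)
  qed
  have "rooted_weight i p m * rooted_weight i p n =
      (\<Sum>(A, B)\<in>?R. animal_weight p A * animal_weight p B)"
    by (simp add: rooted_weight_def sum_product sum.cartesian_product)
  also have "\<dots> \<le> (\<Sum>z\<in>?R. animal_weight p (glue z))"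
  proof (rule sum_mono, clarify)
    fix A B assume AB: "A \<in> rooted_animals i m" "B \<in> rooted_animals i n"
    have "finite A" "finite (sh A B)" using AB by (auto simp: rooted_animals_def animals_def sh_def)
    from animal_weight_Un[OF this disj[OF AB] assms(1)]
    show "animal_weight p A * animal_weight p B \<le> animal_weight p (glue (A, B))"
      by (simp add: glue_def sh_def animal_weight_translate)
  qed
  also have "\<dots> = (\<Sum>C\<in>glue ` ?R. animal_weight p C)"
    by (simp add: sum.reindex[OF inj])
  also have "\<dots> \<le> rooted_weight i p (m + n)"
    unfolding rooted_weight_def using img finite_rooted_animals assms(1)
    by (intro sum_mono2) (auto simp: animal_weight_nonneg)
  finally show ?thesis .
qed

lemma rooted_weight_1_pos:
  assumes "0 < p" "p < 1"
  shows "0 < rooted_weight i p 1"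
proof -
  have "{0} \<in> rooted_animals i 1"
    using cluster_subset[of "{0}" 0] cluster_self[of 0 "{0}"]
    by (auto simp: rooted_animals_def animals_def)
  moreover have "0 < animal_weight p {0}" using assms by (simp add: animal_weight_def)
  ultimately show ?thesis
    unfolding rooted_weight_def using assms finite_rooted_animals
    by (intro sum_pos2[of _ "{0}"]) (auto simp: animal_weight_nonneg)
qed

lemma rooted_weight_pos:
  assumes "0 < p" "p < 1" "1 \<le> k"
  shows "0 < rooted_weight i p k"
  using assms(3)
proof (induction k rule: dec_induct)
  case base
  show ?case using rooted_weight_1_pos assms by simp
next
  case (step k)
  then have "0 < rooted_weight i p k * rooted_weight i p 1"
    by (intro mult_pos_pos rooted_weight_1_pos assms)
  also have "\<dots> \<le> rooted_weight i p (k + 1)"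
    using assms step by (intro rooted_weight_supermult) auto
  finally show ?case by simp
qed

section \<open>From animal weights to the tail of the cluster size\<close>

context
  fixes D :: "'d::finite itself"
begin

text \<open>The cluster of the origin equals at most one animal, so the weights add up to the
  probability of a subevent of \<open>big A 0 k\<close>. The box has radius \<open>Suc k\<close> in
  order to contain the outer boundaries.\<close>

lemma rooted_weight_le_tail:
  fixes i :: 'd
  assumes "p \<in> {0..1}" "1 \<le> k"
  shows "rooted_weight i p k \<le> cluster_tail D p k"
proof -
  let ?B = "lbox (0 :: int ^ 'd) (Suc k)"
  let ?E = "\<lambda>C A. C \<subseteq> A \<and> A \<inter> outer_boundary C = {}"
  have "rooted_weight i p k = (\<Sum>C\<in>rooted_animals i k. bprob ?B (\<lambda>_. p) (?E C))"
    unfolding rooted_weight_def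
    by (intro sum.cong) (auto simp: bprob_animal rooted_animals_def)
  also have "\<dots> = bprob ?B (\<lambda>_. p) (\<lambda>A. \<exists>C\<in>rooted_animals i k. ?E C A)"
  proof (rule bprob_Ex_disjoint[symmetric])
    fix C C' A assume "C \<in> rooted_animals i k" "C' \<in> rooted_animals i k" "?E C A" "?E C' A"
    then show "C = C'"
      using cluster_eq_animal[of C k A] cluster_eq_animal[of C' k A] assms(2)
      by (simp add: rooted_animals_def)
  qed (auto simp: finite_rooted_animals)
  also have "\<dots> \<le> bprob ?B (\<lambda>_. p) (\<lambda>A. big A 0 k)"
    using assms
    by (intro bprob_mono_event) (auto simp: big_def rooted_animals_def animals_def)
  also have "\<dots> = cluster_tail D p k"
    using assms by (intro bprob_big_eq_tail lbox_mono) auto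
  finally show ?thesis .
qed

text \<open>The difference is the probability that the cluster has exactly \<open>k\<close> nodes,
  and such a cluster is an animal whose outer boundary is closed.\<close>

lemma cluster_tail_diff_le:
  fixes i :: 'd
  assumes "p \<in> {0..1}" "1 \<le> k"
  shows "cluster_tail D p k - cluster_tail D p (Suc k) \<le> real k * rooted_weight i p k"
proof -
  let ?B = "lbox (0 :: int ^ 'd) (Suc k)"
  let ?E = "\<lambda>C A. C \<subseteq> A \<and> A \<inter> outer_boundary C = {}"
  have "cluster_tail D p k = bprob ?B (\<lambda>_. p) (\<lambda>A. big A 0 k)"
    using assms by (intro bprob_big_eq_tail[symmetric] lbox_mono) auto
  also have "\<dots> \<le> bprob ?B (\<lambda>_. p) (\<lambda>A. big A 0 (Suc k) \<or> (\<exists>C\<in>animals k. ?E C A))"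
  proof (rule bprob_mono_event)
    fix A assume A: "A \<subseteq> ?B" "big A 0 k"
    let ?C = "cluster A 0"
    have fin: "finite A" using A(1) by (rule finite_subset) simp
    show "big A 0 (Suc k) \<or> (\<exists>C\<in>animals k. ?E C A)"
    proof (cases "card ?C = k")
      case True
      have "finite ?C" using fin cluster_subset finite_subset by metis
      then have "?C \<in> animals k" using True by (simp add: animals_def)
      moreover have "A \<inter> outer_boundary ?C = {}"
        using cluster_step unfolding outer_boundary_def by blast
      ultimately show ?thesis using cluster_subset[of A 0] by blast
    next
      case False
      then show ?thesis using A fin assms(2) by (auto simp: big_iff_card)
    qed
  qed (use assms in auto)
  also have "\<dots> \<le> bprob ?B (\<lambda>_. p) (\<lambda>A. big A 0 (Suc k)) +
      bprob ?B (\<lambda>_. p) (\<lambda>A. \<exists>C\<in>animals k. ?E C A)"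
    using assms by (intro bprob_disj_le) auto
  also have "bprob ?B (\<lambda>_. p) (\<lambda>A. big A 0 (Suc k)) = cluster_tail D p (Suc k)"
    using assms by (intro bprob_big_eq_tail) auto
  also have "bprob ?B (\<lambda>_. p) (\<lambda>A. \<exists>C\<in>animals k. ?E C A) \<le>
      (\<Sum>C\<in>animals k. bprob ?B (\<lambda>_. p) (?E C))"
    using assms finite_animals by (intro bprob_Ex_le) auto
  also have "\<dots> = (\<Sum>C\<in>animals k. animal_weight p (C :: (int ^ 'd) set))"
    by (rule sum.cong[OF refl]) (rule bprob_animal, assumption, simp_all)
  also have "\<dots> \<le> real k * rooted_weight i p k"
    using assms by (rule sum_animal_weight_le)
  finally show ?thesis by simp
qed

text \<open>Sum the probabilities of the exact sizes from \<open>n\<close> on. They exhaust the tail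
  because the tail tends to zero below the critical probability. The factor \<open>k\<close> is
  absorbed by passing from the rate \<open>L\<close> to the larger \<open>s\<close>.\<close>

lemma cluster_tail_exp_bound:
  fixes i :: 'd
  assumes p: "0 < p" "p < critical_prob D"
    and L: "\<And>k. 1 \<le> k \<Longrightarrow> rooted_weight i p k \<le> exp (L * real k)" and s: "L < s" "s < 0"
  shows "\<exists>M>0. \<forall>n\<ge>1. cluster_tail D p n \<le> M * exp (s * real n)"
proof -
  have p1: "p \<in> {0..1}" using p critical_prob_le_1[of D] by auto
  \<comment> \<open>\<open>1 / (s - L)\<close> comes from
    \<open>k \<le> exp ((s - L) * k) / (s - L)\<close>, and \<open>1 / (1 - exp s)\<close> from a
    geometric series, which converges as \<open>s < 0\<close>.\<close>
  define M where "M = 1 / ((s - L) * (1 - exp s))"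
  have M: "0 < M" using s by (simp add: M_def)
  have step: "cluster_tail D p k - cluster_tail D p (Suc k) \<le> exp (s * real k) / (s - L)"
    if "1 \<le> k" for k
  proof -
    have "cluster_tail D p k - cluster_tail D p (Suc k) \<le> real k * exp (L * real k)"
      using cluster_tail_diff_le[OF p1 that, of i] L[OF that] that
        mult_left_mono[OF L[OF that], of "real k"] by linarith
    also have "real k \<le> exp ((s - L) * real k) / (s - L)"
      using exp_ge_add_one_self[of "(s - L) * real k"] s by (simp add: field_simps)
    then have "real k * exp (L * real k) \<le> exp ((s - L) * real k) / (s - L) * exp (L * real k)"
      by (intro mult_right_mono) auto
    also have "\<dots> = exp (s * real k) / (s - L)"
      by (simp add: algebra_simps flip: exp_add)
    finally show ?thesis .
  qed
  have tele: "cluster_tail D p n - cluster_tail D p (n + N) \<le>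
      M * (exp (s * real n) - exp (s * real (n + N)))" if "1 \<le> n" for n N
  proof (induction N)
    case (Suc N)
    have "M * (exp (s * real (n + N)) - exp (s * real (n + Suc N))) =
        M * (1 - exp s) * exp (s * real (n + N))"
      by (simp add: algebra_simps exp_add)
    also have "M * (1 - exp s) = 1 / (s - L)"
      using s by (simp add: M_def)
    finally have "M * (exp (s * real (n + N)) - exp (s * real (n + Suc N))) =
        exp (s * real (n + N)) / (s - L)" by simp
    with Suc step[of "n + N"] that show ?case by (simp add: algebra_simps)
  qed simp
  have "cluster_tail D p n \<le> M * exp (s * real n)" if n: "1 \<le> n" for n
  proof (rule LIMSEQ_le_const2)
    have "(\<lambda>N. cluster_tail D p (N + n)) \<longlonglongrightarrow> 0"
      using cluster_tail_tendsto_0[OF p] by (rule LIMSEQ_ignore_initial_segment)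
    from tendsto_diff[OF tendsto_const this]
    show "(\<lambda>N. cluster_tail D p n - cluster_tail D p (N + n)) \<longlonglongrightarrow> cluster_tail D p n"
      by simp
    have "cluster_tail D p n - cluster_tail D p (N + n) \<le> M * exp (s * real n)" for N
    proof -
      have "0 \<le> M * exp (s * real (n + N))" using M by simp
      with tele[OF n, of N] show ?thesis by (simp add: add.commute right_diff_distrib)
    qed
    then show "\<exists>N. \<forall>N'\<ge>N. cluster_tail D p n - cluster_tail D p (N' + n) \<le> M * exp (s * real n)"
      by blast
  qed
  with M show ?thesis by blast
qed

lemma cluster_tail_limit:
  assumes p: "0 < p" "p < critical_prob D"
  shows "(\<lambda>k. ln (cluster_tail D p k) / real k) \<longlonglongrightarrow> - zeta D p"
    and "0 \<le> zeta D p" and "\<And>k. 1 \<le> k \<Longrightarrow> 0 < cluster_tail D p k"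
proof -
  have p1: "p < 1" "p \<in> {0..1}" using p critical_prob_le_1[of D] by auto
  define i :: 'd where "i = undefined"
  define u where "u k = ln (rooted_weight i p k)" for k
  have pos: "0 < rooted_weight i p k" if "1 \<le> k" for k
    using rooted_weight_pos p p1 that by blast
  have le: "rooted_weight i p k \<le> cluster_tail D p k" "cluster_tail D p k \<le> 1" if "1 \<le> k" for k
    using rooted_weight_le_tail[OF p1(2) that] cluster_tail_le_1[OF p1(2) that] by auto
  show tpos: "0 < cluster_tail D p k" if "1 \<le> k" for k
    using pos[OF that] le[OF that] by linarith
  obtain L where L: "L \<le> 0" "(\<lambda>n. u n / real n) \<longlonglongrightarrow> L" "\<And>n. 1 \<le> n \<Longrightarrow> u n \<le> L * real n"
  proof (rule fekete_superadditive[of u])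
    fix m n :: nat assume mn: "1 \<le> m" "1 \<le> n"
    have "u m + u n = ln (rooted_weight i p m * rooted_weight i p n)"
      using pos[OF mn(1)] pos[OF mn(2)] by (simp add: u_def ln_mult)
    also have "\<dots> \<le> u (m + n)"
      unfolding u_def using rooted_weight_supermult[OF p1(2) mn, of i] pos[OF mn(1)] pos[OF mn(2)]
      by (intro ln_mono) auto
    finally show "u m + u n \<le> u (m + n)" .
  next
    fix n :: nat assume n: "1 \<le> n"
    then show "u n \<le> 0" using pos[OF n] le[OF n] by (simp add: u_def)
  qed (rule that)
  have bound: "rooted_weight i p k \<le> exp (L * real k)" if "1 \<le> k" for k
    using L(3)[OF that] pos[OF that] unfolding u_def by (metis exp_le_cancel_iff exp_ln)
  have "(\<lambda>k. ln (cluster_tail D p k) / real k) \<longlonglongrightarrow> L"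
  proof (rule order_tendstoI)
    fix a assume a: "a < L"
    have "\<forall>\<^sub>F n in sequentially. a < u n / real n" using L(2) a by (rule order_tendstoD)
    then show "\<forall>\<^sub>F n in sequentially. a < ln (cluster_tail D p n) / real n"
      using eventually_ge_at_top[of 1]
    proof eventually_elim
      case (elim n)
      have "u n \<le> ln (cluster_tail D p n)"
        unfolding u_def using pos le elim by (intro ln_mono) auto
      then have "u n / real n \<le> ln (cluster_tail D p n) / real n" by (intro divide_right_mono) auto
      with elim show ?case by simp
    qed
  next
    fix a assume a: "L < a"
    show "\<forall>\<^sub>F n in sequentially. ln (cluster_tail D p n) / real n < a"
    \<comment> \<open>The exponential bound requires a negative rate, available between
      \<open>L\<close> and \<open>a\<close> if \<open>a \<le> 0\<close>. For \<open>a > 0\<close>,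
      which is always the case when \<open>L = 0\<close>, the bound of the tail by one
      suffices.\<close>
    proof (cases "0 < a")
      case True
      show ?thesis using eventually_ge_at_top[of 1]
      proof eventually_elim
        case (elim n)
        have "ln (cluster_tail D p n) / real n \<le> 0"
          using tpos[OF elim] le[OF elim] by (intro divide_nonpos_nonneg) auto
        with True show ?case by simp
      qed
    next
      case False
      define s where "s = (L + a) / 2"
      have s: "L < s" "s < 0" "s < a" using a False by (auto simp: s_def field_simps)
      obtain M where M: "M > 0" "\<And>n. 1 \<le> n \<Longrightarrow> cluster_tail D p n \<le> M * exp (s * real n)"
        using cluster_tail_exp_bound[OF p bound s(1,2)] by blast
      have "(\<lambda>n. ln M / real n + s) \<longlonglongrightarrow> 0 + s" by (intro tendsto_intros lim_const_over_n)
      then have "\<forall>\<^sub>F n in sequentially. ln M / real n + s < a"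
        using s by (auto dest: order_tendstoD(2))
      then show ?thesis using eventually_ge_at_top[of 1]
      proof eventually_elim
        case (elim n)
        have "ln (cluster_tail D p n) \<le> ln (M * exp (s * real n))"
          using tpos M elim by (intro ln_mono) auto
        also have "\<dots> = ln M + s * real n" using M by (simp add: ln_mult)
        finally have "ln (cluster_tail D p n) / real n \<le> (ln M + s * real n) / real n"
          by (intro divide_right_mono) auto
        also have "\<dots> = ln M / real n + s" using elim by (simp add: field_simps)
        finally show ?case using elim by simp
      qed
    qed
  qed
  moreover from this have "zeta D p = - L" using p by (simp add: zeta_def limI)
  ultimately show "(\<lambda>k. ln (cluster_tail D p k) / real k) \<longlonglongrightarrow> - zeta D p" "0 \<le> zeta D p"
    using L(1) by simp_all
qed

lemma cluster_tail_le_exp: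
  assumes "0 < p" "p < critical_prob D" "s < zeta D p"
  shows "\<forall>\<^sub>F k in sequentially. cluster_tail D p k \<le> exp (- s * real k)"
proof -
  have "\<forall>\<^sub>F k in sequentially. ln (cluster_tail D p k) / real k < - s"
    using cluster_tail_limit(1)[OF assms(1,2)] assms(3) by (intro order_tendstoD) auto
  then show ?thesis using eventually_ge_at_top[of 1]
  proof eventually_elim
    case (elim k)
    then have "ln (cluster_tail D p k) \<le> - s * real k" by (simp add: field_simps)
    then show ?case using cluster_tail_limit(3)[OF assms(1,2)] elim
      by (metis exp_le_cancel_iff exp_ln)
  qed
qed

lemma cluster_tail_ge_exp:
  assumes "0 < p" "p < critical_prob D" "zeta D p < s"
  shows "\<forall>\<^sub>F k in sequentially. exp (- s * real k) \<le> cluster_tail D p k"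
proof -
  have "\<forall>\<^sub>F k in sequentially. - s < ln (cluster_tail D p k) / real k"
    using cluster_tail_limit(1)[OF assms(1,2)] assms(3) by (intro order_tendstoD) auto
  then show ?thesis using eventually_ge_at_top[of 1]
  proof eventually_elim
    case (elim k)
    then have "- s * real k \<le> ln (cluster_tail D p k)" by (simp add: field_simps)
    then show ?case using cluster_tail_limit(3)[OF assms(1,2)] elim
      by (metis exp_le_cancel_iff exp_ln)
  qed
qed

text \<open>The comparison of densities yields
  \<open>zeta D p \<ge> (ln p / ln q) * zeta D q\<close>. The factor exceeds one, and
  \<open>0 < zeta D q\<close> makes the inequality strict.\<close>

lemma zeta_strict_antimono:
  assumes "0 < p" "p < q" "q < critical_prob D" "0 < zeta D q"
  shows "zeta D q < zeta D p"
proof -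
  have q: "0 < q" "q < 1" using assms critical_prob_le_1[of D] by auto
  define g where "g = ln p / ln q"
  have g: "1 < g" using assms q by (simp add: g_def)
  have pg: "p = q powr g" using assms q by (simp add: g_def powr_def)
  have "- zeta D p \<le> g * - zeta D q"
  proof (rule tendsto_le)
    show "(\<lambda>k. ln (cluster_tail D p k) / real k) \<longlonglongrightarrow> - zeta D p"
      using assms by (intro cluster_tail_limit) auto
    show "(\<lambda>k. g * (ln (cluster_tail D q k) / real k)) \<longlonglongrightarrow> g * - zeta D q"
      using assms by (intro tendsto_mult_left cluster_tail_limit) auto
    show "\<forall>\<^sub>F k in sequentially. ln (cluster_tail D p k) / real k \<le>
        g * (ln (cluster_tail D q k) / real k)"
      using eventually_ge_at_top[of 1]
    proof eventually_elim
      case (elim k)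
      have pos: "0 < cluster_tail D p k" "0 < cluster_tail D q k"
        using assms elim by (auto intro: cluster_tail_limit(3))
      have "cluster_tail D p k \<le> cluster_tail D q k powr g"
        unfolding pg using q g elim by (intro cluster_tail_powr) auto
      then have "ln (cluster_tail D p k) \<le> ln (cluster_tail D q k powr g)"
        using pos by (intro ln_mono) auto
      also have "\<dots> = g * ln (cluster_tail D q k)" using pos by (simp add: ln_powr)
      finally have "ln (cluster_tail D p k) / real k \<le> g * ln (cluster_tail D q k) / real k"
        by (rule divide_right_mono) simp
      then show ?case by simp
    qed
  qed simp
  moreover have "1 * zeta D q < g * zeta D q"
    using g assms(4) by (intro mult_strict_right_mono) auto
  ultimately show ?thesis by simp
qed

end

section \<open>The exponential family and asymptotic estimates\<close>

lemma (in finite_measure) integral_pos_of_pos_on: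
  fixes f :: "'a \<Rightarrow> real"
  assumes "integrable M f" "\<And>x. 0 \<le> f x" "\<And>x. x \<in> A \<Longrightarrow> 0 < f x" "A \<in> sets M" "0 < measure M A"
  shows "0 < (\<integral>x. f x \<partial>M)"
proof -
  have "(\<integral>x. f x \<partial>M) \<noteq> 0"
  proof
    assume "(\<integral>x. f x \<partial>M) = 0"
    then have "AE x in M. f x = 0"
      using assms(1,2) by (subst (asm) integral_nonneg_eq_0_iff_AE) auto
    then have "AE x in M. x \<notin> A" by eventually_elim (use assms(3) in force)
    then have "emeasure M A = 0"
      using assms(4) sets.sets_into_space[OF assms(4)]
      by (subst (asm) AE_iff_measurable[of A]) auto
    then show False using assms(5) by (simp add: measure_def)
  qed
  moreover have "0 \<le> (\<integral>x. f x \<partial>M)" using assms(2) by simp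
  ultimately show ?thesis by simp
qed

context
  fixes F :: "real measure"
  assumes F: "real_distribution F"
begin

interpretation real_distribution F by (rule F)

lemma integrable_exp_on:
  assumes "integrable F (\<lambda>x. exp (x * \<eta>))" "A \<in> sets borel"
  shows "integrable F (\<lambda>x. indicat_real A x * exp (x * \<eta>))"
  using integrable_mult_indicator[of A F, OF _ assms(1)] assms(2) by simp

lemma mgf_pos:
  assumes "integrable F (\<lambda>x. exp (x * \<eta>))"
  shows "0 < mgf F \<eta>"
  unfolding mgf_def
  by (rule integral_pos_of_pos_on[OF assms, of UNIV]) (use prob_space in auto)

lemma measure_tilted:
  assumes "integrable F (\<lambda>x. exp (x * \<eta>))" "A \<in> sets borel"
  shows "measure (tilted F \<eta>) A = (\<integral>x. indicat_real A x * exp (x * \<eta>) \<partial>F) / mgf F \<eta>"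
proof -
  have "measure (tilted F \<eta>) A = (\<integral>x. indicat_real A x \<partial>tilted F \<eta>)"
    by (simp add: tilted_def)
  also have "\<dots> = (\<integral>x. exp (\<eta> * x - ln (mgf F \<eta>)) *\<^sub>R indicat_real A x \<partial>F)"
    unfolding tilted_def using assms(2) by (intro integral_density) auto
  also have "\<dots> = (\<integral>x. indicat_real A x * exp (x * \<eta>) / mgf F \<eta> \<partial>F)"
    using mgf_pos[OF assms(1)]
    by (intro Bochner_Integration.integral_cong) (auto simp: exp_diff mult_ac)
  finally show ?thesis by simp
qed

lemma sets_tilted [simp]: "sets (tilted F \<eta>) = sets borel"
  by (simp add: tilted_def)

lemma space_tilted [simp]: "space (tilted F \<eta>) = UNIV"
  by (simp add: tilted_def)

lemma prob_space_tilted: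
  assumes "integrable F (\<lambda>x. exp (x * \<eta>))"
  shows "prob_space (tilted F \<eta>)"
proof
  have "measure (tilted F \<eta>) UNIV = 1"
    using measure_tilted[OF assms, of UNIV] mgf_pos[OF assms] by (simp add: mgf_def)
  then show "emeasure (tilted F \<eta>) (space (tilted F \<eta>)) = 1"
    by (simp add: measure_def)
qed

lemma exceed_prob_0: "exceed_prob F t 0 = measure F {t<..}"
  using measure_tilted[of 0 "{t<..}"] prob_space by (simp add: exceed_prob_def mgf_def)

text \<open>Splitting the normalising constant at \<open>t\<close> shows that the exceedance
  probability increases with the ratio of \<open>N\<close> to \<open>L\<close>, which is easy to
  compare for two parameters.\<close>

lemma exceed_prob_eq:
  fixes t :: real
  assumes "integrable F (\<lambda>x. exp (x * \<eta>))"
  defines "N \<equiv> (\<integral>x. indicat_real {t<..} x * exp (x * \<eta>) \<partial>F)"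
    and "L \<equiv> (\<integral>x. indicat_real {..t} x * exp (x * \<eta>) \<partial>F)"
  shows "exceed_prob F t \<eta> = N / (N + L)"
proof -
  have "mgf F \<eta> = (\<integral>x. indicat_real {t<..} x * exp (x * \<eta>) + indicat_real {..t} x * exp (x * \<eta>) \<partial>F)"
    unfolding mgf_def by (intro Bochner_Integration.integral_cong) (auto simp: indicator_def)
  also have "\<dots> = N + L"
    unfolding N_def L_def
    by (intro Bochner_Integration.integral_add integrable_exp_on assms(1)) auto
  finally show ?thesis
    using measure_tilted[OF assms(1), of "{t<..}"] by (simp add: exceed_prob_def N_def)
qed

lemma
  assumes "integrable F (\<lambda>x. exp (x * \<eta>))" "0 < exceed_prob F t 0" "exceed_prob F t 0 < 1"
  shows exceed_integral_pos: "0 < (\<integral>x. indicat_real {t<..} x * exp (x * \<eta>) \<partial>F)"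
    and nonexceed_integral_pos: "0 < (\<integral>x. indicat_real {..t} x * exp (x * \<eta>) \<partial>F)"
proof -
  show "0 < (\<integral>x. indicat_real {t<..} x * exp (x * \<eta>) \<partial>F)"
    using assms by (intro integral_pos_of_pos_on[of _ "{t<..}"] integrable_exp_on)
      (auto simp: exceed_prob_0)
  have "measure F {..t} = 1 - measure F {t<..}"
    using prob_compl[of "{t<..}"] by (simp add: Compl_eq_Diff_UNIV[symmetric])
  then show "0 < (\<integral>x. indicat_real {..t} x * exp (x * \<eta>) \<partial>F)"
    using assms by (intro integral_pos_of_pos_on[of _ "{..t}"] integrable_exp_on)
      (auto simp: exceed_prob_0)
qed

lemma exceed_prob_bounds:
  assumes "integrable F (\<lambda>x. exp (x * \<eta>))" "0 < exceed_prob F t 0" "exceed_prob F t 0 < 1"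
  shows "0 < exceed_prob F t \<eta>" "exceed_prob F t \<eta> < 1"
  using exceed_integral_pos[OF assms] nonexceed_integral_pos[OF assms]
  unfolding exceed_prob_eq[OF assms(1)] by auto

lemma exceed_prob_strict_mono:
  assumes int: "integrable F (\<lambda>x. exp (x * \<eta>))" "integrable F (\<lambda>x. exp (x * \<eta>'))"
    and t: "0 < exceed_prob F t 0" "exceed_prob F t 0 < 1" and less: "\<eta> < \<eta>'"
  shows "exceed_prob F t \<eta> < exceed_prob F t \<eta>'"
proof -
  define N where "N \<eta> = (\<integral>x. indicat_real {t<..} x * exp (x * \<eta>) \<partial>F)" for \<eta>
  define L where "L \<eta> = (\<integral>x. indicat_real {..t} x * exp (x * \<eta>) \<partial>F)" for \<eta>
  \<comment> \<open>Passing from \<open>\<eta>\<close> to \<open>\<eta>'\<close> multiplies the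
    integrand by \<open>exp ((\<eta>' - \<eta>) * x)\<close>, and \<open>e\<close> is this factor at
    \<open>x = t\<close>. Beyond \<open>t\<close> the factor is larger, so \<open>N\<close> grows by
    more than \<open>e\<close>, while \<open>L\<close> grows by at most \<open>e\<close>.\<close>
  define e where "e = exp ((\<eta>' - \<eta>) * t)"
  have pos: "0 < N \<eta>" "0 < L \<eta>" "0 < N \<eta>'" "0 < L \<eta>'" "0 < e"
    using exceed_integral_pos[OF int(1) t] exceed_integral_pos[OF int(2) t]
      nonexceed_integral_pos[OF int(1) t] nonexceed_integral_pos[OF int(2) t]
    by (auto simp: N_def L_def e_def)
  have split: "exp (x * \<eta>') = exp ((\<eta>' - \<eta>) * x) * exp (x * \<eta>)" for x
    by (simp add: algebra_simps flip: exp_add)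
  have up: "e * exp (x * \<eta>) < exp (x * \<eta>')" if "t < x" for x
    unfolding split e_def using less that by simp
  have down: "exp (x * \<eta>') \<le> e * exp (x * \<eta>)" if "x \<le> t" for x
    unfolding split e_def using less that by simp
  have ints: "integrable F (\<lambda>x. indicat_real {t<..} x * exp (x * \<eta>))"
    "integrable F (\<lambda>x. indicat_real {t<..} x * exp (x * \<eta>'))"
    "integrable F (\<lambda>x. indicat_real {..t} x * exp (x * \<eta>))"
    "integrable F (\<lambda>x. indicat_real {..t} x * exp (x * \<eta>'))"
    using int by (auto intro: integrable_exp_on)
  have "0 < (\<integral>x. indicat_real {t<..} x * exp (x * \<eta>') - e * (indicat_real {t<..} x * exp (x * \<eta>)) \<partial>F)"
    using ints t up
    by (intro integral_pos_of_pos_on[of _ "{t<..}"])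
      (auto simp: indicator_def exceed_prob_0 less_imp_le)
  also have "\<dots> = N \<eta>' - e * N \<eta>"
    using ints by (simp add: N_def)
  finally have 1: "e * N \<eta> < N \<eta>'" by simp
  have "L \<eta>' \<le> (\<integral>x. e * (indicat_real {..t} x * exp (x * \<eta>)) \<partial>F)"
    unfolding L_def using ints down
    by (intro integral_mono) (auto simp: indicator_def)
  then have 2: "L \<eta>' \<le> e * L \<eta>" by (simp add: L_def)
  have "N \<eta> * L \<eta>' \<le> N \<eta> * (e * L \<eta>)" using 2 pos by (intro mult_left_mono) auto
  also have "\<dots> < N \<eta>' * L \<eta>" using 1 pos by (simp add: mult_ac)
  finally have "N \<eta> / (N \<eta> + L \<eta>) < N \<eta>' / (N \<eta>' + L \<eta>')"
    using pos by (simp add: divide_less_eq less_divide_eq field_simps)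
  then show ?thesis using exceed_prob_eq int by (simp add: N_def L_def)
qed

end

section \<open>Orders of magnitude at the scale \<open>c * ln m\<close>\<close>

lemma powr_times_exp_ceil_log_tendsto_0:
  fixes a c s :: real
  assumes "0 < s" "a < s * c"
  shows "(\<lambda>m. real m powr a * exp (- s * real (nat \<lceil>c * ln (real m)\<rceil>))) \<longlonglongrightarrow> 0"
proof (rule Lim_null_comparison)
  show "(\<lambda>m. real m powr (a - s * c)) \<longlonglongrightarrow> 0"
    using assms by real_asymp
  show "\<forall>\<^sub>F m in sequentially. norm (real m powr a * exp (- s * real (nat \<lceil>c * ln (real m)\<rceil>)))
      \<le> real m powr (a - s * c)"
    using eventually_ge_at_top[of 1]
  proof eventually_elim
    case (elim m)
    have "exp (- s * real (nat \<lceil>c * ln (real m)\<rceil>)) \<le> exp (- s * (c * ln (real m)))"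
      using assms(1) real_nat_ceiling_ge[of "c * ln (real m)"] by simp
    also have "\<dots> = real m powr (- s * c)" using elim by (simp add: powr_def)
    finally have "real m powr a * exp (- s * real (nat \<lceil>c * ln (real m)\<rceil>)) \<le>
        real m powr a * real m powr (- s * c)" by (intro mult_left_mono) auto
    then show ?case by (simp add: powr_diff powr_minus divide_inverse)
  qed
qed

lemma nat_ceil_log_at_top:
  fixes c :: real
  assumes "0 < c"
  shows "filterlim (\<lambda>m. nat \<lceil>c * ln (real m)\<rceil>) at_top sequentially"
  using assms by real_asymp

lemma nat_ceil_log_le:
  fixes c :: real
  assumes "0 \<le> c" "1 \<le> m"
  shows "real (nat \<lceil>c * ln (real m)\<rceil>) \<le> c * ln (real m) + 1"
proof -
  have "0 \<le> c * ln (real m)" using assms by simp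
  then show ?thesis by linarith
qed

lemma div_ge_real: "real m / real k - 1 \<le> real (m div k)"
proof (cases "k = 0")
  case False
  have "real m = real (m div k) * real k + real (m mod k)"
    by (metis div_mult_mod_eq of_nat_add of_nat_mult)
  also have "\<dots> \<le> (real (m div k) + 1) * real k"
    using False by (simp add: algebra_simps)
  finally show ?thesis using False by (simp add: field_simps)
qed simp

text \<open>Up to logarithms this is \<open>m powr (\<alpha> - b)\<close> with
  \<open>b = c * ln (1 / q)\<close>. In the minorant \<open>?g\<close> the factor \<open>q\<close>
  pays for the ceiling in \<open>k\<close>, and the two subtracted ones pay for the integer part of
  the path length and for the division into blocks.\<close>

lemma power_blocks_at_top:
  fixes \<alpha> c q :: real
  assumes "0 < \<alpha>" "0 < c" "0 < q" "q < 1" "c * ln (1 / q) < \<alpha>"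
  defines "k \<equiv> \<lambda>m. nat \<lceil>c * ln (real m)\<rceil>"
  shows "filterlim (\<lambda>m. q ^ k m * real (nat \<lfloor>real m powr \<alpha>\<rfloor> div k m)) at_top sequentially"
proof -
  define b where "b = c * ln (1 / q)"
  have b: "0 < b" "b < \<alpha>" using assms by (auto simp: b_def)
  let ?g = "\<lambda>m::nat. q * real m powr (- b) * ((real m powr \<alpha> - 1) / (c * ln (real m) + 1) - 1)"
  have "filterlim ?g at_top sequentially"
    using assms(1-3) b by real_asymp
  moreover have "\<forall>\<^sub>F m in sequentially. ?g m \<le> q ^ k m * real (nat \<lfloor>real m powr \<alpha>\<rfloor> div k m)"
  proof -
    have "filterlim (\<lambda>m::nat. (real m powr \<alpha> - 1) / (c * ln (real m) + 1) - 1) at_top sequentially"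
      using assms(1-3) by real_asymp
    then have "\<forall>\<^sub>F m::nat in sequentially. 0 \<le> (real m powr \<alpha> - 1) / (c * ln (real m) + 1) - 1"
      by (rule filterlim_at_top[THEN iffD1, THEN spec])
    moreover have "\<forall>\<^sub>F m in sequentially. 1 \<le> k m"
      unfolding k_def using nat_ceil_log_at_top[OF assms(2)] by (simp add: filterlim_at_top)
    ultimately show ?thesis using eventually_ge_at_top[of 1]
    proof eventually_elim
      case (elim m)
      have k: "real (k m) \<le> c * ln (real m) + 1"
        unfolding k_def using assms elim by (intro nat_ceil_log_le) auto
      have "q * real m powr (- b) = q powr (c * ln (real m) + 1)"
        using assms elim by (simp add: powr_def b_def ln_div exp_add algebra_simps)
      also have "\<dots> \<le> q powr (real (k m))"
        using k assms by (intro powr_mono') auto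
      also have "\<dots> = q ^ k m" using assms by (simp add: powr_realpow)
      finally have 1: "q * real m powr (- b) \<le> q ^ k m" .
      have "(real m powr \<alpha> - 1) / (c * ln (real m) + 1) \<le> real (nat \<lfloor>real m powr \<alpha>\<rfloor>) / real (k m)"
        using k elim by (intro frac_le) linarith+
      also have "\<dots> - 1 \<le> real (nat \<lfloor>real m powr \<alpha>\<rfloor> div k m)" by (rule div_ge_real)
      finally have 2: "(real m powr \<alpha> - 1) / (c * ln (real m) + 1) - 1 \<le>
          real (nat \<lfloor>real m powr \<alpha>\<rfloor> div k m)" by simp
      show ?case using 1 2 elim assms by (intro mult_mono) auto
    qed
  qed
  ultimately show ?thesis by (rule filterlim_at_top_mono)
qed

lemma exp_boxes_at_top:
  fixes c s :: real and d :: nat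
  assumes "0 < c" "0 < d" "0 < s" "s * c < real d"
  defines "k \<equiv> \<lambda>m. nat \<lceil>c * ln (real m)\<rceil>"
  shows "filterlim (\<lambda>m. exp (- s * real (k m)) * real (m div (2 * k m + 1)) ^ d) at_top sequentially"
proof -
  \<comment> \<open>Half of the slack \<open>d - s * c\<close>, spread over the \<open>d\<close>
    coordinates: passing to \<open>m powr (1 - e)\<close> removes the logarithm in the box side, and
    the exponent \<open>d * (1 - e) - s * c\<close> stays positive.\<close>
  define e where "e = (real d - s * c) / (2 * real d)"
  have e: "0 < e" "real d * (1 - e) - s * c > 0"
    using assms by (auto simp: e_def field_simps)
  let ?g = "\<lambda>m::nat. exp (- s) * real m powr (real d * (1 - e) - s * c)"
  have "filterlim ?g at_top sequentially"
    using e by real_asymp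
  moreover have "\<forall>\<^sub>F m in sequentially. ?g m \<le> exp (- s * real (k m)) * real (m div (2 * k m + 1)) ^ d"
  proof -
    have "\<forall>\<^sub>F m::nat in sequentially. real m powr (1 - e) \<le> real m / (2 * c * ln (real m) + 3) - 1"
      using assms(1) e by real_asymp
    then show ?thesis using eventually_ge_at_top[of 1]
    proof eventually_elim
      case (elim m)
      have k: "real (k m) \<le> c * ln (real m) + 1"
        unfolding k_def using assms elim by (intro nat_ceil_log_le) auto
      have "exp (- s) * real m powr (- s * c) = exp (- s * (c * ln (real m) + 1))"
        using elim by (simp add: powr_def exp_add[symmetric] algebra_simps)
      also have "\<dots> \<le> exp (- s * real (k m))" using k assms by simp
      finally have 1: "exp (- s) * real m powr (- s * c) \<le> exp (- s * real (k m))" .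
      have "real m / (2 * c * ln (real m) + 3) \<le> real m / real (2 * k m + 1)"
        using k by (intro divide_left_mono) (auto simp: add_nonneg_pos intro!: mult_pos_pos add_nonneg_pos)
      also have "\<dots> - 1 \<le> real (m div (2 * k m + 1))" by (rule div_ge_real)
      finally have "real m powr (1 - e) \<le> real (m div (2 * k m + 1))" using elim by simp
      then have "(real m powr (1 - e)) ^ d \<le> real (m div (2 * k m + 1)) ^ d"
        by (intro power_mono) auto
      also have "(real m powr (1 - e)) ^ d = real m powr (real d * (1 - e))"
        using elim by (simp add: powr_power mult.commute)
      finally have 2: "real m powr (real d * (1 - e)) \<le> real (m div (2 * k m + 1)) ^ d" .
      have "?g m = exp (- s) * real m powr (- s * c) * real m powr (real d * (1 - e))"
        by (simp add: powr_diff powr_minus divide_inverse)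
      also have "\<dots> \<le> exp (- s * real (k m)) * real (m div (2 * k m + 1)) ^ d"
        using 1 2 by (intro mult_mono) auto
      finally show ?case .
    qed
  qed
  ultimately show ?thesis by (rule filterlim_at_top_mono)
qed

section \<open>The largest cluster in a box\<close>

text \<open>A function of the set \<open>A\<close> of open nodes alone, so that it can appear in
  events of \<open>bprob\<close>; \<open>B\<close> is the set of roots over which the maximum
  runs.\<close>

definition max_cluster :: "(int ^ 'd) set \<Rightarrow> (int ^ 'd) set \<Rightarrow> nat" where
  "max_cluster B A = (SUP v\<in>B. card (cluster A v))"

lemma largest_cluster_eq: "largest_cluster t m x = max_cluster (grid m) {v \<in> grid m. t < x v}"
  by (simp add: largest_cluster_def max_cluster_def)

lemma less_max_cluster_iff:
  assumes "finite B" "B \<noteq> {}"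
  shows "c < real (max_cluster B A) \<longleftrightarrow> (\<exists>v\<in>B. c < real (card (cluster A v)))"
proof -
  have "max_cluster B A = Max ((\<lambda>v. card (cluster A v)) ` B)"
    unfolding max_cluster_def using assms by (intro cSup_eq_Max) auto
  moreover have "Max ((\<lambda>v. card (cluster A v)) ` B) \<in> (\<lambda>v. card (cluster A v)) ` B"
    using assms by (intro Max_in) auto
  moreover have "card (cluster A v) \<le> Max ((\<lambda>v. card (cluster A v)) ` B)" if "v \<in> B" for v
    using assms that by (intro Max_ge) auto
  ultimately show ?thesis by force
qed

lemma le_max_cluster_iff:
  assumes "finite B" "B \<noteq> {}" "finite A" "1 \<le> k"
  shows "k \<le> max_cluster B A \<longleftrightarrow> (\<exists>v\<in>B. big A v k)"
proof -
  have "k \<le> max_cluster B A \<longleftrightarrow> real k - 1 < real (max_cluster B A)" by linarith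
  also have "\<dots> \<longleftrightarrow> (\<exists>v\<in>B. k \<le> card (cluster A v))"
    unfolding less_max_cluster_iff[OF assms(1,2)] by (intro bex_cong) auto
  finally show ?thesis using assms by (simp add: big_iff_card)
qed

lemma grid_nonempty: "1 \<le> m \<Longrightarrow> grid m \<noteq> {}"
  by (auto simp: grid_def intro!: exI[of _ "\<chi> i. 1"])

text \<open>Disjoint blocks fail independently, each with probability at most
  \<open>1 - q \<le> exp (- q)\<close>. The blocks are segments of a path in one application and
  boxes of the grid in the other.\<close>

lemma bprob_no_block_le:
  assumes "finite B" "\<And>v. v \<in> B \<Longrightarrow> p v \<in> {0..1}" "finite J" "\<And>j. j \<in> J \<Longrightarrow> D j \<subseteq> B"
    "disjoint_family_on D J" "\<And>j. j \<in> J \<Longrightarrow> q \<le> bprob (D j) p (E j)"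
  shows "bprob B p (\<lambda>A. \<forall>j\<in>J. \<not> E j (A \<inter> D j)) \<le> exp (- (q * real (card J)))"
proof -
  let ?U = "\<Union>j\<in>J. D j"
  have finD: "finite (D j)" if "j \<in> J" for j using assms(1) assms(4)[OF that] finite_subset by auto
  have "bprob B p (\<lambda>A. \<forall>j\<in>J. \<not> E j (A \<inter> D j)) = bprob B p (\<lambda>A. \<forall>j\<in>J. \<not> E j ((A \<inter> ?U) \<inter> D j))"
  proof (rule bprob_cong)
    fix A
    have "(A \<inter> ?U) \<inter> D j = A \<inter> D j" if "j \<in> J" for j using that by auto
    then show "(\<forall>j\<in>J. \<not> E j (A \<inter> D j)) = (\<forall>j\<in>J. \<not> E j ((A \<inter> ?U) \<inter> D j))" by simp
  qed simp
  also have "\<dots> = bprob (B \<inter> ?U) p (\<lambda>A. \<forall>j\<in>J. \<not> E j (A \<inter> D j))"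
    using assms(1) by (rule bprob_restrict)
  also have "B \<inter> ?U = ?U" using assms(4) by auto
  also have "bprob ?U p (\<lambda>A. \<forall>j\<in>J. \<not> E j (A \<inter> D j)) = (\<Prod>j\<in>J. bprob (D j) p (\<lambda>A. \<not> E j A))"
    using assms(3) finD assms(5) by (rule bprob_indep_family)
  also have "\<dots> \<le> (\<Prod>j\<in>J. exp (- q))"
  proof (rule prod_mono)
    fix j assume j: "j \<in> J"
    have "bprob (D j) p (\<lambda>A. \<not> E j A) = 1 - bprob (D j) p (E j)"
      using finD[OF j] by (rule bprob_not)
    also have "\<dots> \<le> 1 - q" using assms(6)[OF j] by simp
    also have "\<dots> \<le> exp (- q)" using exp_ge_add_one_self[of "- q"] by simp
    finally show "0 \<le> bprob (D j) p (\<lambda>A. \<not> E j A) \<and> bprob (D j) p (\<lambda>A. \<not> E j A) \<le> exp (- q)"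
      using bprob_nonneg[OF finD[OF j], of p "\<lambda>A. \<not> E j A"] assms(2) subsetD[OF assms(4)[OF j]]
      by blast
  qed
  also have "\<dots> = exp (- (q * real (card J)))"
    by (simp add: mult.commute flip: exp_of_nat_mult)
  finally show ?thesis .
qed

lemma bprob_max_cluster_le:
  fixes D :: "'d::finite itself"
  assumes "1 \<le> m" "1 \<le> k" "p \<in> {0..1}"
  shows "bprob (grid m :: (int ^ 'd) set) (\<lambda>_. p) (\<lambda>A. k \<le> max_cluster (grid m) A) \<le>
           real m ^ CARD('d) * cluster_tail D p k"
proof -
  let ?B = "grid m :: (int ^ 'd) set"
  have "bprob ?B (\<lambda>_. p) (\<lambda>A. k \<le> max_cluster ?B A) \<le> bprob ?B (\<lambda>_. p) (\<lambda>A. \<exists>v\<in>?B. big A v k)"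
  proof (rule bprob_mono_event)
    show "\<exists>v\<in>?B. big A v k" if "A \<subseteq> ?B" "k \<le> max_cluster ?B A" for A
      using that(2) le_max_cluster_iff[OF finite_grid grid_nonempty[OF assms(1)]
          finite_subset[OF that(1) finite_grid] assms(2)] by blast
  qed (use assms in auto)
  also have "\<dots> \<le> (\<Sum>v\<in>?B. bprob ?B (\<lambda>_. p) (\<lambda>A. big A v k))"
    using assms by (intro bprob_Ex_le) auto
  also have "\<dots> \<le> (\<Sum>v\<in>?B. cluster_tail D p k)"
    using assms by (intro sum_mono bprob_big_le) auto
  finally show ?thesis by (simp add: card_grid)
qed

text \<open>The path is cut into disjoint segments of length \<open>k\<close>, each of which is entirely open with
  probability at least \<open>q ^ k\<close>.\<close>

lemma bprob_path_max_cluster: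
  fixes vs :: "(int ^ 'd::finite) list"
  assumes "1 \<le> m" "1 \<le> k" "\<And>v. v \<in> grid m \<Longrightarrow> p v \<in> {0..1}" "0 \<le> q"
    and vs: "set vs \<subseteq> grid m" "distinct vs" "successively adjacent vs"
    and q: "\<And>v. v \<in> set vs \<Longrightarrow> q \<le> p v"
  shows "bprob (grid m) p (\<lambda>A. \<not> k \<le> max_cluster (grid m) A) \<le>
           exp (- (q ^ k * real (length vs div k)))"
proof -
  define n where "n = length vs div k"
  define S where "S j = take k (drop (j * k) vs)" for j
  have len: "j * k + k \<le> length vs" if "j < n" for j
  proof -
    have "Suc j * k \<le> n * k" using that by (intro mult_right_mono) auto
    also have "\<dots> \<le> length vs" by (simp add: n_def)
    finally show ?thesis by simp
  qed
  have Slen: "length (S j) = k" if "j < n" for j using len[OF that] by (simp add: S_def)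
  have Snth: "S j ! l = vs ! (j * k + l)" if "j < n" "l < k" for j l
    using len[OF that(1)] that(2) by (simp add: S_def)
  have Ssub: "set (S j) \<subseteq> set vs" for j
    unfolding S_def using set_take_subset set_drop_subset by (metis order_trans)
  have Sdist: "distinct (S j)" for j using vs by (simp add: S_def)
  have Ssucc: "successively adjacent (S j)" for j
  proof -
    have "successively adjacent (drop (j * k) vs)"
      using vs(3) by (metis append_take_drop_id successively_append_iff)
    then show ?thesis unfolding S_def by (metis append_take_drop_id successively_append_iff)
  qed
  have disj: "disjoint_family_on (\<lambda>j. set (S j)) {..<n}"
  proof (unfold disjoint_family_on_def, intro ballI impI)
    fix i j assume ij: "i \<in> {..<n}" "j \<in> {..<n}" "i \<noteq> j"
    show "set (S i) \<inter> set (S j) = {}"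
    proof (rule ccontr)
      assume "set (S i) \<inter> set (S j) \<noteq> {}"
      then obtain x where "x \<in> set (S i)" "x \<in> set (S j)" by auto
      then obtain a b where ab: "a < k" "b < k" "S i ! a = S j ! b"
        using ij Slen by (metis in_set_conv_nth lessThan_iff)
      then have "vs ! (i * k + a) = vs ! (j * k + b)" using ij Snth by simp
      then have "i * k + a = j * k + b"
        using vs(2) len[of i] len[of j] ij ab by (simp add: nth_eq_iff_index_eq)
      then have "(i * k + a) div k = (j * k + b) div k" by simp
      then show False using ab ij(3) by simp
    qed
  qed
  have "bprob (grid m) p (\<lambda>A. \<not> k \<le> max_cluster (grid m) A) \<le>
      bprob (grid m) p (\<lambda>A. \<forall>j\<in>{..<n}. \<not> set (S j) \<subseteq> A \<inter> set (S j))"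
  proof (rule bprob_mono_event)
    fix A :: "(int ^ 'd) set" assume A: "A \<subseteq> grid m" "\<not> k \<le> max_cluster (grid m) A"
    show "\<forall>j\<in>{..<n}. \<not> set (S j) \<subseteq> A \<inter> set (S j)"
    proof (intro ballI notI)
      fix j assume j: "j \<in> {..<n}" and sub: "set (S j) \<subseteq> A \<inter> set (S j)"
      have ne: "S j \<noteq> []" using Slen[of j] j assms(2) by auto
      have "cluster (set (S j)) (hd (S j)) = set (S j)"
        using Ssucc ne by (rule successively_adjacent_connected)
      moreover have "card (set (S j)) = k" using Sdist Slen j by (simp add: distinct_card)
      ultimately have "big A (hd (S j)) k" using sub unfolding big_def by blast
      moreover have "hd (S j) \<in> grid m" using ne Ssub vs(1) hd_in_set by blast
      ultimately show False
        using A le_max_cluster_iff[OF finite_grid grid_nonempty[OF assms(1)] _ assms(2)]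
          finite_subset[OF A(1) finite_grid] by blast
    qed
  qed (use assms in auto)
  also have "\<dots> \<le> exp (- (q ^ k * real (card {..<n})))"
  proof (rule bprob_no_block_le)
    show "set (S j) \<subseteq> grid m" for j using Ssub vs(1) by blast
    show "disjoint_family_on (\<lambda>j. set (S j)) {..<n}" by (rule disj)
    show "q ^ k \<le> bprob (set (S j)) p (\<lambda>A. set (S j) \<subseteq> A)" if "j \<in> {..<n}" for j
    proof -
      have "q ^ k = (\<Prod>v\<in>set (S j). q)" using Sdist Slen that by (simp add: distinct_card)
      also have "\<dots> \<le> (\<Prod>v\<in>set (S j). p v)"
        using Ssub q assms(4) by (intro prod_mono) auto
      also have "\<dots> = bprob (set (S j)) p (\<lambda>A. set (S j) \<subseteq> A)"
        by (rule bprob_all_open[symmetric]) auto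
      finally show ?thesis .
    qed
  qed (use assms in auto)
  finally show ?thesis by (simp add: n_def)
qed

text \<open>A box of radius \<open>k\<close> decides whether its centre has a cluster of at least
  \<open>k\<close> nodes. The success probability of a block is therefore the tail itself, without a
  boundary effect.\<close>

lemma bprob_boxes_max_cluster:
  fixes D :: "'d::finite itself"
  assumes "1 \<le> m" "1 \<le> k" "p \<in> {0..1}"
  shows "bprob (grid m :: (int ^ 'd) set) (\<lambda>_. p) (\<lambda>A. \<not> k \<le> max_cluster (grid m) A) \<le>
           exp (- (cluster_tail D p k * real (m div (2 * k + 1)) ^ CARD('d)))"
proof -
  define n where "n = m div (2 * k + 1)"
  define W where "W = int (2 * k + 1)"
  \<comment> \<open>The box of radius \<open>k\<close> around \<open>z j\<close> occupies the
    coordinates from \<open>W * (j $ i - 1) + 1\<close> to \<open>W * j $ i\<close>; for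
    \<open>j\<close> in \<open>grid n\<close> these boxes are disjoint and fit into
    \<open>grid m\<close>.\<close>
  define z where "z j = (\<chi> i. W * j $ i - int k) " for j :: "int ^ 'd"
  let ?B = "grid m :: (int ^ 'd) set"
  let ?J = "grid n :: (int ^ 'd) set"
  have nW: "int n * W \<le> int m"
  proof -
    have "n * (2 * k + 1) \<le> m" unfolding n_def by (rule div_times_less_eq_dividend)
    then have "int (n * (2 * k + 1)) \<le> int m" by (simp only: of_nat_le_iff)
    then show ?thesis by (simp only: W_def of_nat_mult)
  qed
  have box: "W * (j $ i - 1) + 1 \<le> w $ i \<and> w $ i \<le> W * j $ i" if "w \<in> lbox (z j) k" for j w i
  proof -
    have "\<bar>w $ i - (W * j $ i - int k)\<bar> \<le> int k" using that by (simp add: lbox_def z_def)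
    then show ?thesis by (simp add: W_def algebra_simps abs_le_iff)
  qed
  have sub: "lbox (z j) k \<subseteq> ?B" if "j \<in> ?J" for j
  proof
    fix w assume w: "w \<in> lbox (z j) k"
    show "w \<in> ?B"
      unfolding grid_def
    proof (intro CollectI allI conjI)
      fix i
      have j: "1 \<le> j $ i" "j $ i \<le> int n" using that by (auto simp: grid_def)
      have "0 \<le> W * (j $ i - 1)" using j by (simp add: W_def)
      then show "1 \<le> w $ i" using box[OF w, of i] by simp
      have "W * j $ i \<le> W * int n" using j by (intro mult_left_mono) (auto simp: W_def)
      then show "w $ i \<le> int m" using box[OF w, of i] nW by (simp add: mult.commute)
    qed
  qed
  have disj: "disjoint_family_on (\<lambda>j. lbox (z j) k) ?J"
  proof (unfold disjoint_family_on_def, intro ballI impI)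
    fix j l :: "int ^ 'd" assume "j \<noteq> l"
    show "lbox (z j) k \<inter> lbox (z l) k = {}"
    proof (rule ccontr)
      assume "lbox (z j) k \<inter> lbox (z l) k \<noteq> {}"
      then obtain w where w: "w \<in> lbox (z j) k" "w \<in> lbox (z l) k" by auto
      have W: "0 < W" by (simp add: W_def)
      have "j $ i = l $ i" for i
      proof -
        have "W * (j $ i - 1) < W * l $ i" "W * (l $ i - 1) < W * j $ i"
          using box[OF w(1), of i] box[OF w(2), of i] by linarith+
        then show ?thesis using W by (simp add: mult_less_cancel_left_pos)
      qed
      then show False using \<open>j \<noteq> l\<close> by (simp add: vec_eq_iff)
    qed
  qed
  have "bprob ?B (\<lambda>_. p) (\<lambda>A. \<not> k \<le> max_cluster ?B A) \<le>
      bprob ?B (\<lambda>_. p) (\<lambda>A. \<forall>j\<in>?J. \<not> big (A \<inter> lbox (z j) k) (z j) k)"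
  proof (rule bprob_mono_event)
    fix A assume A: "A \<subseteq> ?B" "\<not> k \<le> max_cluster ?B A"
    have "z j \<in> ?B" if "j \<in> ?J" for j using sub[OF that] by (auto simp: subset_iff)
    moreover have "\<not> (\<exists>v\<in>?B. big A v k)"
      using A(2) le_max_cluster_iff[OF finite_grid grid_nonempty[OF assms(1)]
          finite_subset[OF A(1) finite_grid] assms(2)] by simp
    ultimately show "\<forall>j\<in>?J. \<not> big (A \<inter> lbox (z j) k) (z j) k"
      unfolding big_local by simp
  qed (use assms in auto)
  also have "\<dots> \<le> exp (- (cluster_tail D p k * real (card ?J)))"
  proof (rule bprob_no_block_le)
    show "cluster_tail D p k \<le> bprob (lbox (z j) k) (\<lambda>_. p) (\<lambda>A. big A (z j) k)" for j
      using bprob_big_eq_tail[of "lbox (z j) k" k "z j" p D] assms by simp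
  qed (use sub disj assms in auto)
  finally show ?thesis by (simp add: card_grid n_def)
qed

text \<open>Closing a node outside a cluster leaves the cluster as it is. This makes the existence
  of a large cluster that avoids \<open>K\<close> a decreasing event in the nodes of
  \<open>K\<close>.\<close>

lemma cluster_insert_avoiding:
  assumes "w \<notin> cluster (insert w A) v" "v \<in> cluster (insert w A) v"
  shows "cluster (insert w A) v = cluster A v"
proof
  have v: "v \<in> A" using assms cluster_root by fastforce
  show "cluster A v \<subseteq> cluster (insert w A) v" by (rule cluster_mono) auto
  show "cluster (insert w A) v \<subseteq> cluster A v"
  proof (rule cluster_least)
    show "v \<in> cluster A v" using v by (rule cluster_self)
    fix x y assume xy: "x \<in> cluster A v" "y \<in> insert w A" "adjacent x y"
    then have "x \<in> cluster (insert w A) v" using cluster_mono[of A "insert w A" v] by auto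
    then have "y \<in> cluster (insert w A) v" using xy(2,3) by (rule cluster_step)
    then have "y \<in> A" using assms(1) xy(2) by auto
    with xy(1) show "y \<in> cluster A v" using xy(3) by (rule cluster_step)
  qed
qed

text \<open>The event that some cluster larger than \<open>c\<close> avoids \<open>K\<close> is decreasing in the states of the
  nodes of \<open>K\<close>, so raising the probabilities on \<open>K\<close> can only create a large cluster that
  meets \<open>K\<close>.\<close>

lemma bprob_max_cluster_alt_le:
  fixes D :: "'d::finite itself" and K :: "(int ^ 'd) set"
  assumes "1 \<le> m" "1 \<le> k" "real k \<le> c + 1" "finite K"
    "\<And>v. v \<in> grid m \<Longrightarrow> 0 \<le> p v \<and> p v \<le> r v \<and> r v \<le> q" "0 \<le> q" "q \<le> 1"
    "\<And>v. v \<in> grid m - K \<Longrightarrow> p v = r v"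
  shows "bprob (grid m) r (\<lambda>A. c < real (max_cluster (grid m) A)) \<le>
    bprob (grid m) p (\<lambda>A. c < real (max_cluster (grid m) A)) + real (card K) * cluster_tail D q k"
proof -
  let ?B = "grid m :: (int ^ 'd) set"
  let ?E = "\<lambda>A. \<exists>v\<in>?B. c < real (card (cluster A v)) \<and> cluster A v \<inter> K = {}"
  have p01: "p v \<in> {0..1}" "r v \<in> {0..1}" if "v \<in> ?B" for v
    using assms(5)[OF that] assms(7) by auto
  have c: "0 \<le> c" using assms(2,3) by linarith
  have "bprob ?B r (\<lambda>A. c < real (max_cluster ?B A)) \<le>
      bprob ?B r (\<lambda>A. ?E A \<or> (\<exists>w\<in>K. big A w k))"
  proof (rule bprob_mono_event)
    fix A assume A: "A \<subseteq> ?B" "c < real (max_cluster ?B A)"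
    have finA: "finite A" using A(1) by (rule finite_subset) simp
    obtain v where v: "v \<in> ?B" "c < real (card (cluster A v))"
      using A(2) less_max_cluster_iff[OF finite_grid grid_nonempty[OF assms(1)]] by auto
    show "?E A \<or> (\<exists>w\<in>K. big A w k)"
    proof (cases "cluster A v \<inter> K = {}")
      case False
      then obtain w where w: "w \<in> K" "w \<in> cluster A v" by auto
      \<comment> \<open>Sizes are integers, so exceeding \<open>c\<close> with
        \<open>k \<le> c + 1\<close> means at least \<open>k\<close> nodes. The cluster is re-rooted
        at \<open>w\<close> to allow a union bound over \<open>K\<close>.\<close>
      have "k \<le> card (cluster A w)"
        using cluster_eqI[OF w(2)] v(2) assms(3) by simp
      then have "big A w k" using finA assms(2) by (simp add: big_iff_card)
      with w show ?thesis by blast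
    qed (use v in auto)
  qed (use p01 in auto)
  also have "\<dots> \<le> bprob ?B r ?E + bprob ?B r (\<lambda>A. \<exists>w\<in>K. big A w k)"
    using p01 by (intro bprob_disj_le) auto
  also have "bprob ?B r ?E \<le> bprob ?B p ?E"
  proof (rule bprob_antimono_on)
    fix A w assume w: "w \<in> K" "?E (insert w A)"
    then obtain v where v: "v \<in> ?B" "c < real (card (cluster (insert w A) v))"
      "cluster (insert w A) v \<inter> K = {}" by auto
    \<comment> \<open>A closed root has the empty cluster, whose size cannot exceed
      \<open>c \<ge> 0\<close>.\<close>
    have "v \<in> cluster (insert w A) v"
    proof (rule ccontr)
      assume "v \<notin> cluster (insert w A) v"
      then have "cluster (insert w A) v = {}" using cluster_self cluster_eq_empty by metis
      then show False using v(2) c by simp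
    qed
    then have "cluster (insert w A) v = cluster A v"
      using v w by (intro cluster_insert_avoiding) auto
    then show "?E A" using v by auto
  qed (use assms p01 in auto)
  also have "bprob ?B p ?E \<le> bprob ?B p (\<lambda>A. c < real (max_cluster ?B A))"
    using p01 by (intro bprob_mono_event)
      (auto simp: less_max_cluster_iff[OF finite_grid grid_nonempty[OF assms(1)]])
  also have "bprob ?B r (\<lambda>A. \<exists>w\<in>K. big A w k) \<le> (\<Sum>w\<in>K. bprob ?B r (\<lambda>A. big A w k))"
    using p01 assms(4) by (intro bprob_Ex_le) auto
  also have "\<dots> \<le> (\<Sum>w\<in>K. cluster_tail D q k)"
    using assms p01 by (intro sum_mono bprob_big_le) auto
  finally show ?thesis by simp
qed

section \<open>The class of paths and the laws of the statistic\<close>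

lemma finite_path_class: "finite (path_class \<alpha> m :: (int ^ 'd::finite) set set)"
  by (rule finite_subset[of _ "Pow (grid m)"]) (auto simp: path_class_def)

text \<open>A straight segment starting at the corner with all coordinates \<open>1\<close> fits
  into the grid, as \<open>\<alpha> < 1\<close> keeps its length at most \<open>m\<close>. The
  \<open>Max\<close> in the risk is meaningful because of this.\<close>

lemma path_class_nonempty:
  assumes "1 \<le> m" "0 < \<alpha>" "\<alpha> < 1"
  shows "path_class \<alpha> m \<noteq> ({} :: (int ^ 'd::finite) set set)"
proof -
  define n where "n = nat \<lfloor>real m powr \<alpha>\<rfloor>"
  have "real m powr \<alpha> \<le> real m powr 1" using assms by (intro powr_mono) auto
  then have n: "n \<le> m" using assms by (auto simp: n_def) linarith
  define x :: "nat \<Rightarrow> int ^ 'd" where "x j = (\<chi> i. 1) + axis undefined (int j)" for j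
  have "set (map x [0..<n]) \<subseteq> (grid m :: (int ^ 'd) set)"
    using n by (auto simp: grid_def x_def axis_def)
  moreover have "distinct (map x [0..<n])"
    by (auto simp: distinct_map inj_on_def x_def axis_eq_axis)
  moreover have "successively adjacent (map x [0..<n])"
  proof -
    have "adjacent (x j) (x (Suc j))" for j
    proof -
      have "x (Suc j) = x j + axis undefined 1"
        by (simp add: x_def vec_eq_iff axis_def)
      then show ?thesis using adjacent_axis by metis
    qed
    then show ?thesis by (simp add: successively_conv_nth)
  qed
  ultimately have "set (map x [0..<n]) \<in> path_class \<alpha> m"
    unfolding path_class_def by (intro imageI) (auto simp: n_def)
  then show ?thesis by blast
qed

context
  fixes F :: "real measure"
  assumes F: "real_distribution F"
begin

interpretation real_distribution F by (rule F)

lemma measure_null_law: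
  "measure (null_law F m) {x :: int ^ 'd::finite \<Rightarrow> real \<in> space (null_law F m). T (largest_cluster t m x)} =
     bprob (grid m :: (int ^ 'd) set) (\<lambda>_. exceed_prob F t 0) (\<lambda>A. T (max_cluster (grid m) A))"
proof -
  have "measure (PiM (grid m) (\<lambda>_. F))
      {\<omega> :: int ^ 'd \<Rightarrow> real \<in> space (PiM (grid m) (\<lambda>_. F)). T (max_cluster (grid m) {i \<in> grid m. t < \<omega> i})} =
    bprob (grid m :: (int ^ 'd) set) (\<lambda>_. measure F {x \<in> space F. t < x})
      (\<lambda>A. T (max_cluster (grid m) A))"
    using prob_space_axioms
    by (intro measure_PiM_eq_bprob(2)[where M = "\<lambda>_. F" and Q = "\<lambda>_ x. t < x"
          and E = "\<lambda>A. T (max_cluster (grid m) A)"]) auto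
  then show ?thesis
    by (simp add: null_law_def largest_cluster_eq exceed_prob_0[OF F] greaterThan_def)
qed

lemma measure_alt_law:
  assumes "integrable F (\<lambda>x. exp (x * \<eta>))"
  shows "measure (alt_law F \<eta> m K) {x \<in> space (alt_law F \<eta> m K). T (largest_cluster t m x)} =
     bprob (grid m :: (int ^ 'd::finite) set)
       (\<lambda>v. if v \<in> K then exceed_prob F t \<eta> else exceed_prob F t 0) (\<lambda>A. T (max_cluster (grid m) A))"
proof -
  let ?M = "\<lambda>v. if v \<in> K then tilted F \<eta> else F"
  have "measure (PiM (grid m) ?M) {\<omega> \<in> space (PiM (grid m) ?M). T (max_cluster (grid m) {i \<in> grid m. t < \<omega> i})} =
    bprob (grid m) (\<lambda>i. measure (?M i) {x \<in> space (?M i). t < x}) (\<lambda>A. T (max_cluster (grid m) A))"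
    using prob_space_axioms prob_space_tilted[OF F assms]
    by (intro measure_PiM_eq_bprob(2)) (auto simp: sets_tilted[OF F] space_tilted[OF F] greaterThan_def[symmetric])
  also have "\<dots> = bprob (grid m)
      (\<lambda>v. if v \<in> K then exceed_prob F t \<eta> else exceed_prob F t 0) (\<lambda>A. T (max_cluster (grid m) A))"
    by (intro bprob_cong) (auto simp: exceed_prob_0[OF F] space_tilted[OF F] exceed_prob_def[of _ _ \<eta>] greaterThan_def)
  finally show ?thesis by (simp add: alt_law_def largest_cluster_eq)
qed

end

section \<open>The risk of the test\<close>

context
  fixes F\<^sub>0 :: "real measure" and \<theta> :: "nat \<Rightarrow> real" and \<alpha> t :: real and D :: "'d::finite itself"
  assumes F: "real_distribution F\<^sub>0"
    and int: "\<And>m. integrable F\<^sub>0 (\<lambda>x. exp (x * \<theta> m))"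
    and \<alpha>: "0 < \<alpha>" "\<alpha> < 1"
    and pos: "0 < exceed_prob F\<^sub>0 t 0"
    and sub: "exceed_prob F\<^sub>0 t 0 < critical_prob D"
begin

abbreviation alt_prob :: "(int ^ 'd) set \<Rightarrow> nat \<Rightarrow> int ^ 'd \<Rightarrow> real" where
  "alt_prob K m v \<equiv> if v \<in> K then exceed_prob F\<^sub>0 t (\<theta> m) else exceed_prob F\<^sub>0 t 0"

abbreviation null_prob :: "int ^ 'd \<Rightarrow> real" where
  "null_prob v \<equiv> exceed_prob F\<^sub>0 t 0"

lemma exceed_lt_1: "exceed_prob F\<^sub>0 t 0 < 1"
  using sub critical_prob_le_1[of D] by simp

lemma exceed_alt: "0 < exceed_prob F\<^sub>0 t (\<theta> m)" "exceed_prob F\<^sub>0 t (\<theta> m) < 1"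
  using exceed_prob_bounds[OF F int pos exceed_lt_1] by auto

lemma path_risk_eq:
  "path_risk F\<^sub>0 \<theta> \<alpha> m (\<lambda>x :: int ^ 'd \<Rightarrow> real. c < real (largest_cluster t m x)) =
     bprob (grid m) null_prob (\<lambda>A. c < real (max_cluster (grid m) A)) +
     Max ((\<lambda>K. bprob (grid m) (alt_prob K m) (\<lambda>A. \<not> c < real (max_cluster (grid m) A))) ` path_class \<alpha> m)"
  unfolding path_risk_def
  by (intro arg_cong2[where f = "(+)"] arg_cong[where f = Max] image_cong refl
      measure_null_law[OF F, where T = "\<lambda>n. c < real n"]
      measure_alt_law[OF F int, where T = "\<lambda>n. \<not> c < real n"])

lemma path_risk_le:
  assumes "1 \<le> m" "1 \<le> k" "0 \<le> q" "q \<le> exceed_prob F\<^sub>0 t (\<theta> m)"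
  shows "path_risk F\<^sub>0 \<theta> \<alpha> m (\<lambda>x :: int ^ 'd \<Rightarrow> real. real k - 1 < real (largest_cluster t m x)) \<le>
    real m ^ CARD('d) * cluster_tail D (exceed_prob F\<^sub>0 t 0) k +
    exp (- (q ^ k * real (nat \<lfloor>real m powr \<alpha>\<rfloor> div k)))"
proof -
  \<comment> \<open>Rejection means strictly exceeding the critical value, so the value
    \<open>real k - 1\<close> gives the test that rejects from size \<open>k\<close> on.\<close>
  have eq: "real k - 1 < real n \<longleftrightarrow> k \<le> n" for n by linarith
  have fin: "finite (path_class \<alpha> m :: (int ^ 'd) set set)" by (rule finite_path_class)
  have ne: "path_class \<alpha> m \<noteq> ({} :: (int ^ 'd) set set)" by (rule path_class_nonempty[OF assms(1) \<alpha>])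
  have "bprob (grid m) (alt_prob K m) (\<lambda>A. \<not> k \<le> max_cluster (grid m) A) \<le>
      exp (- (q ^ k * real (nat \<lfloor>real m powr \<alpha>\<rfloor> div k)))" if K: "K \<in> path_class \<alpha> m" for K
  proof -
    obtain vs where vs: "K = set vs" "set vs \<subseteq> grid m" "distinct vs" "successively adjacent vs"
      "length vs = nat \<lfloor>real m powr \<alpha>\<rfloor>" using K by (auto simp: path_class_def)
    show ?thesis unfolding vs(5)[symmetric]
      using assms vs exceed_alt[of m] pos exceed_lt_1
      by (intro bprob_path_max_cluster) (auto simp: less_imp_le)
  qed
  then have "Max ((\<lambda>K. bprob (grid m) (alt_prob K m) (\<lambda>A. \<not> k \<le> max_cluster (grid m) A)) ` path_class \<alpha> m)
      \<le> exp (- (q ^ k * real (nat \<lfloor>real m powr \<alpha>\<rfloor> div k)))"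
    using fin ne by (subst Max_le_iff) auto
  moreover have "bprob (grid m) null_prob (\<lambda>A. k \<le> max_cluster (grid m) A) \<le>
      real m ^ CARD('d) * cluster_tail D (exceed_prob F\<^sub>0 t 0) k"
    using assms pos exceed_lt_1 by (intro bprob_max_cluster_le) auto
  ultimately show ?thesis
    unfolding path_risk_eq unfolding eq by linarith
qed

lemma path_risk_nonneg:
  assumes "1 \<le> m"
  shows "0 \<le> path_risk F\<^sub>0 \<theta> \<alpha> m (\<lambda>x :: int ^ 'd \<Rightarrow> real. c < real (largest_cluster t m x))"
proof -
  have fin: "finite (path_class \<alpha> m :: (int ^ 'd) set set)" by (rule finite_path_class)
  obtain K :: "(int ^ 'd) set" where K: "K \<in> path_class \<alpha> m"
    using path_class_nonempty[OF assms \<alpha>] by blast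
  have "0 \<le> bprob (grid m) (alt_prob K m) (\<lambda>A. \<not> c < real (max_cluster (grid m) A))"
    using exceed_alt[of m] pos exceed_lt_1 by (intro bprob_nonneg) (auto simp: less_imp_le)
  also have "\<dots> \<le> Max ((\<lambda>K. bprob (grid m) (alt_prob K m) (\<lambda>A. \<not> c < real (max_cluster (grid m) A))) ` path_class \<alpha> m)"
    using fin K by (intro Max_ge) auto
  finally show ?thesis
    unfolding path_risk_eq using pos exceed_lt_1
    by (intro add_nonneg_nonneg bprob_nonneg) auto
qed

text \<open>Critical values below \<open>k\<close> are exceeded under the null hypothesis, while for larger ones the
  clusters that meet the path do not matter.\<close>

lemma path_risk_ge:
  assumes "1 \<le> m" "1 \<le> k" "exceed_prob F\<^sub>0 t 0 \<le> exceed_prob F\<^sub>0 t (\<theta> m)"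
    "exceed_prob F\<^sub>0 t (\<theta> m) \<le> q" "q \<le> 1"
  shows "1 - real m powr \<alpha> * cluster_tail D q k -
      exp (- (cluster_tail D (exceed_prob F\<^sub>0 t 0) k * real (m div (2 * k + 1)) ^ CARD('d))) \<le>
    path_risk F\<^sub>0 \<theta> \<alpha> m (\<lambda>x :: int ^ 'd \<Rightarrow> real. c < real (largest_cluster t m x))"
    (is "1 - ?a - ?b \<le> ?R")
proof -
  have fin: "finite (path_class \<alpha> m :: (int ^ 'd) set set)" by (rule finite_path_class)
  obtain K :: "(int ^ 'd) set" where K: "K \<in> path_class \<alpha> m"
    using path_class_nonempty[OF assms(1) \<alpha>] by blast
  then obtain vs where vs: "K = set vs" "set vs \<subseteq> grid m" "distinct vs"
    "length vs = nat \<lfloor>real m powr \<alpha>\<rfloor>" by (auto simp: path_class_def)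
  have cardK: "real (card K) \<le> real m powr \<alpha>" using vs by (simp add: distinct_card)
  have a: "0 \<le> ?a" by (intro mult_nonneg_nonneg cluster_tail_nonneg) simp
  have b: "0 \<le> ?b" by simp
  let ?P0 = "bprob (grid m) null_prob (\<lambda>A. c < real (max_cluster (grid m) A))"
  let ?P1 = "bprob (grid m) (alt_prob K m) (\<lambda>A. c < real (max_cluster (grid m) A))"
  have p01: "null_prob v \<in> {0..1}" "alt_prob K m v \<in> {0..1}" for v
    using exceed_alt[of m] pos exceed_lt_1 by (auto simp: less_imp_le)
  have P1: "0 \<le> 1 - ?P1" using bprob_le_1[OF finite_grid p01(2)] by simp
  have "bprob (grid m) (alt_prob K m) (\<lambda>A. \<not> c < real (max_cluster (grid m) A)) \<le>
      Max ((\<lambda>K. bprob (grid m) (alt_prob K m) (\<lambda>A. \<not> c < real (max_cluster (grid m) A))) ` path_class \<alpha> m)"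
    using fin K by (intro Max_ge) auto
  then have R: "?P0 + (1 - ?P1) \<le> ?R"
    unfolding path_risk_eq by (simp add: bprob_not)
  show ?thesis
  proof (cases "c < real k")
    case True
    have "1 - ?b \<le> bprob (grid m :: (int ^ 'd) set) null_prob (\<lambda>A. k \<le> max_cluster (grid m) A)"
      using bprob_boxes_max_cluster[OF assms(1,2), of "exceed_prob F\<^sub>0 t 0" D] p01(1)
      by (simp add: bprob_not)
    also have "\<dots> \<le> ?P0"
      using p01 True by (intro bprob_mono_event) auto
    finally show ?thesis using R P1 a by linarith
  next
    case False
    have "?P1 \<le> ?P0 + real (card K) * cluster_tail D q k"
      using assms pos exceed_lt_1 vs False
      by (intro bprob_max_cluster_alt_le) auto
    also have "real (card K) * cluster_tail D q k \<le> ?a"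
      using cardK cluster_tail_nonneg by (intro mult_right_mono)
    finally show ?thesis using R b by linarith
  qed
qed

text \<open>Used with \<open>a = d\<close> for the nodes of the grid and with
  \<open>a = \<alpha>\<close> for those of a path. The tail is eventually bounded by
  \<open>exp (- s * k)\<close> for each \<open>s\<close> below its rate, and \<open>s\<close> is
  taken above \<open>a / c\<close>.\<close>

lemma powr_times_cluster_tail_tendsto_0:
  assumes "0 < p" "p < critical_prob D" "0 \<le> a" "0 < c" "a < c * zeta D p"
  shows "(\<lambda>m. real m powr a * cluster_tail D p (nat \<lceil>c * ln (real m)\<rceil>)) \<longlonglongrightarrow> 0"
proof -
  obtain s where s: "a / c < s" "s < zeta D p"
    using dense[of "a / c" "zeta D p"] assms by (auto simp: field_simps)
  have "0 \<le> a / c" using assms by simp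
  then have s0: "0 < s" using s(1) by linarith
  have sc: "a < s * c" using s(1) assms(4) by (simp add: field_simps)
  show ?thesis
  proof (rule Lim_null_comparison[OF _ powr_times_exp_ceil_log_tendsto_0[OF s0 sc]])
    show "\<forall>\<^sub>F m in sequentially. norm (real m powr a * cluster_tail D p (nat \<lceil>c * ln (real m)\<rceil>)) \<le>
        real m powr a * exp (- s * real (nat \<lceil>c * ln (real m)\<rceil>))"
      using eventually_compose_filterlim[OF cluster_tail_le_exp[OF assms(1,2) s(2)]
          nat_ceil_log_at_top[OF assms(4)]]
      by eventually_elim (auto simp: cluster_tail_nonneg intro!: mult_left_mono)
  qed
qed

text \<open>The parameters enter through one fixed lower bound \<open>q\<close> for the raised
  probabilities. The assumed strict inequality amounts to
  \<open>d / \<zeta> < \<alpha> / zeta1 q\<close>, and \<open>c\<close> is any number in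
  between.\<close>

lemma max_cluster_test_powerful:
  assumes "0 < q" "q < 1" "real CARD('d) * zeta1 q < \<alpha> * zeta D (exceed_prob F\<^sub>0 t 0)"
    and ev: "\<forall>\<^sub>F m in sequentially. q \<le> exceed_prob F\<^sub>0 t (\<theta> m)"
  shows "asymp_powerful
          (path_risk F\<^sub>0 \<theta> \<alpha> :: nat \<Rightarrow> ((int ^ 'd \<Rightarrow> real) \<Rightarrow> bool) \<Rightarrow> real)
          (\<lambda>m x. real (largest_cluster t m x))"
proof -
  let ?p = "exceed_prob F\<^sub>0 t 0" and ?d = "real CARD('d)"
  have b: "0 < zeta1 q" using assms(1,2) by (simp add: zeta1_def)
  then have "0 < ?d * zeta1 q" by simp
  then have "0 < \<alpha> * zeta D ?p" using assms(3) by linarith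
  then have z: "0 < zeta D ?p" using \<alpha> by (simp add: zero_less_mult_iff)
  have "?d / zeta D ?p < \<alpha> / zeta1 q" using assms(3) z b by (simp add: field_simps)
  then obtain c where c: "?d / zeta D ?p < c" "c < \<alpha> / zeta1 q" using dense by blast
  have "0 < ?d / zeta D ?p" using z by simp
  then have c0: "0 < c" using c by linarith
  have c1: "?d < c * zeta D ?p" "c * ln (1 / q) < \<alpha>"
    using c z b by (auto simp: field_simps zeta1_def)
  define k where "k m = nat \<lceil>c * ln (real m)\<rceil>" for m :: nat
  let ?R = "\<lambda>m. path_risk F\<^sub>0 \<theta> \<alpha> m (\<lambda>x :: int ^ 'd \<Rightarrow> real. real (largest_cluster t m x) > real (k m) - 1)"
  let ?u = "\<lambda>m. real m powr ?d * cluster_tail D ?p (k m) +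
      exp (- (q ^ k m * real (nat \<lfloor>real m powr \<alpha>\<rfloor> div k m)))"
  have "?R \<longlonglongrightarrow> 0"
  proof (rule Lim_null_comparison)
    have "(\<lambda>m. real m powr ?d * cluster_tail D ?p (k m)) \<longlonglongrightarrow> 0"
      unfolding k_def using pos sub c0 c1 by (intro powr_times_cluster_tail_tendsto_0) auto
    moreover have "filterlim (\<lambda>m. q ^ k m * real (nat \<lfloor>real m powr \<alpha>\<rfloor> div k m)) at_top sequentially"
      unfolding k_def using \<alpha>(1) c0 assms(1,2) c1(2) by (rule power_blocks_at_top)
    then have "(\<lambda>m. exp (- (q ^ k m * real (nat \<lfloor>real m powr \<alpha>\<rfloor> div k m)))) \<longlonglongrightarrow> 0"
      by (intro filterlim_compose[OF exp_at_bot]) (simp add: filterlim_uminus_at_top[symmetric])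
    ultimately show "?u \<longlonglongrightarrow> 0" by (rule tendsto_add_zero)
    have "\<forall>\<^sub>F m in sequentially. 1 \<le> k m"
      unfolding k_def using nat_ceil_log_at_top[OF c0] by (simp add: filterlim_at_top)
    then show "\<forall>\<^sub>F m in sequentially. norm (?R m) \<le> ?u m"
      using ev eventually_ge_at_top[of 1]
    proof eventually_elim
      case (elim m)
      have "real m powr ?d = real m ^ CARD('d)" using elim by (simp add: powr_realpow)
      then show ?case
        using path_risk_nonneg[OF elim(3), of "real (k m) - 1"] path_risk_le[OF elim(3,1) _ elim(2)] assms(1)
        by simp
    qed
  qed
  then show ?thesis unfolding asymp_powerful_def by (intro exI[of _ "\<lambda>m. real (k m) - 1"])
qed

text \<open>Now \<open>q\<close> bounds the raised probabilities from above, and \<open>c\<close>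
  lies between \<open>\<alpha> / zeta D q\<close> and \<open>d / \<zeta>\<close>, with
  \<open>\<zeta>\<close> the rate at the null level.\<close>

lemma max_cluster_test_powerless:
  assumes "0 < q" "q < critical_prob D"
    and "0 < zeta D (exceed_prob F\<^sub>0 t 0)" "\<alpha> * zeta D (exceed_prob F\<^sub>0 t 0) < real CARD('d) * zeta D q"
    and ev: "\<forall>\<^sub>F m in sequentially. exceed_prob F\<^sub>0 t 0 \<le> exceed_prob F\<^sub>0 t (\<theta> m) \<and>
                 exceed_prob F\<^sub>0 t (\<theta> m) \<le> q"
  shows "asymp_powerless
          (path_risk F\<^sub>0 \<theta> \<alpha> :: nat \<Rightarrow> ((int ^ 'd \<Rightarrow> real) \<Rightarrow> bool) \<Rightarrow> real)
          (\<lambda>m x. real (largest_cluster t m x))"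
proof -
  let ?p = "exceed_prob F\<^sub>0 t 0" and ?d = "real CARD('d)"
  have "0 < \<alpha> * zeta D ?p" using \<alpha> assms(3) by simp
  then have "0 < ?d * zeta D q" using assms(4) by linarith
  then have z: "0 < zeta D q" by (simp add: zero_less_mult_iff)
  have "\<alpha> / zeta D q < ?d / zeta D ?p" using assms(3,4) z by (simp add: field_simps)
  then obtain c where c: "\<alpha> / zeta D q < c" "c < ?d / zeta D ?p" using dense by blast
  have "0 < \<alpha> / zeta D q" using z \<alpha> by simp
  then have c0: "0 < c" using c by linarith
  have c1: "\<alpha> < c * zeta D q" using c z by (simp add: field_simps)
  have "zeta D ?p < ?d / c" using c assms(3) c0 by (simp add: field_simps)
  \<comment> \<open>The tail at the null level is bounded below only with rates above its own. The
    room left by \<open>c\<close> permits such an \<open>s\<close> with \<open>s * c < d\<close>, so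
    that the number of boxes still wins.\<close>
  then obtain s where s: "zeta D ?p < s" "s < ?d / c" using dense by blast
  have s0: "0 < s" "s * c < ?d" using s assms(3) c0 by (auto simp: field_simps)
  define k where "k m = nat \<lceil>c * ln (real m)\<rceil>" for m :: nat
  have q1: "q \<le> 1" using assms(2) critical_prob_le_1[of D] by simp
  let ?a = "\<lambda>m. real m powr \<alpha> * cluster_tail D q (k m)"
  let ?e = "\<lambda>m. exp (- (exp (- s * real (k m)) * real (m div (2 * k m + 1)) ^ CARD('d)))"
  have a: "?a \<longlonglongrightarrow> 0"
    unfolding k_def using assms \<alpha> c0 c1 by (intro powr_times_cluster_tail_tendsto_0) auto
  have "filterlim (\<lambda>m. exp (- s * real (k m)) * real (m div (2 * k m + 1)) ^ CARD('d)) at_top sequentially"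
    unfolding k_def using c0 s0 by (intro exp_boxes_at_top) auto
  then have e: "?e \<longlonglongrightarrow> 0"
    by (intro filterlim_compose[OF exp_at_bot]) (simp add: filterlim_uminus_at_top[symmetric])
  have lim: "(\<lambda>m. 1 - ?a m - ?e m) \<longlonglongrightarrow> 1"
    using tendsto_diff[OF tendsto_diff[OF tendsto_const a] e, of 1] by simp
  have "\<forall>\<^sub>F m in sequentially. 1 \<le> k m"
    unfolding k_def using nat_ceil_log_at_top[OF c0] by (simp add: filterlim_at_top)
  moreover have "\<forall>\<^sub>F m in sequentially. exp (- s * real (k m)) \<le> cluster_tail D ?p (k m)"
    using eventually_compose_filterlim[OF cluster_tail_ge_exp[OF pos sub s(1)]
        nat_ceil_log_at_top[OF c0]] by (simp add: k_def)
  \<comment> \<open>Whether \<open>m\<close> is large enough does not depend on the critical value,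
    so the bound applies to an arbitrary sequence of critical values.\<close>
  ultimately have bound: "\<forall>\<^sub>F m in sequentially. \<forall>c. 1 - ?a m - ?e m \<le>
      path_risk F\<^sub>0 \<theta> \<alpha> m (\<lambda>x :: int ^ 'd \<Rightarrow> real. c < real (largest_cluster t m x))"
    using ev eventually_ge_at_top[of 1]
  proof eventually_elim
    case (elim m)
    show ?case
    proof
      fix c
      have "exp (- (cluster_tail D ?p (k m) * real (m div (2 * k m + 1)) ^ CARD('d))) \<le> ?e m"
        using elim(2) by (simp add: mult_right_mono)
      then show "1 - ?a m - ?e m \<le>
          path_risk F\<^sub>0 \<theta> \<alpha> m (\<lambda>x :: int ^ 'd \<Rightarrow> real. c < real (largest_cluster t m x))"
        using path_risk_ge[OF elim(4,1) conjunct1[OF elim(3)] conjunct2[OF elim(3)] q1, of c]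
        by linarith
    qed
  qed
  show ?thesis
    unfolding asymp_powerless_def
  proof
    fix c :: "nat \<Rightarrow> real"
    let ?R = "\<lambda>m. path_risk F\<^sub>0 \<theta> \<alpha> m (\<lambda>x :: int ^ 'd \<Rightarrow> real. c m < real (largest_cluster t m x))"
    have "1 = liminf (\<lambda>m. ereal (1 - ?a m - ?e m))"
      using lim_imp_Liminf[OF _ tendsto_ereal[OF lim]] by (simp add: one_ereal_def)
    also have "\<dots> \<le> liminf (\<lambda>m. ereal (?R m))"
      using bound by (intro Liminf_mono) (auto elim: eventually_mono)
    finally show "1 \<le> liminf (\<lambda>m. ereal (?R m))" .
  qed
qed

end

theorem theorem2:
  fixes F\<^sub>0 :: "real measure" and \<theta>max :: ereal and \<theta> :: "nat \<Rightarrow> real" and \<alpha> t :: real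
  assumes "real_distribution F\<^sub>0"
    and "integrable F\<^sub>0 (\<lambda>x. x\<^sup>2)"
    and "prob_space.variance F\<^sub>0 (\<lambda>x. x) \<noteq> 0"
    and "0 < \<theta>max"
    and "\<And>\<eta>. \<eta> \<in> param_range \<theta>max \<Longrightarrow> integrable F\<^sub>0 (\<lambda>x. exp (x * \<eta>))"
    and "0 < \<alpha>" and "\<alpha> < 1"
    and "\<And>m. 0 < \<theta> m" and "\<And>m. \<theta> m \<in> param_range \<theta>max"
    and "0 < exceed_prob F\<^sub>0 t 0" and "exceed_prob F\<^sub>0 t 0 < critical_prob TYPE('d::finite)"
  shows
    "(\<forall>\<theta>_plus.
        unique_solution (param_range \<theta>max)
          (\<lambda>\<eta>. real CARD('d) * zeta1 (exceed_prob F\<^sub>0 t \<eta>)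
               = \<alpha> * zeta TYPE('d) (exceed_prob F\<^sub>0 t 0)) \<theta>_plus \<longrightarrow>
        liminf (\<lambda>m. ereal (\<theta> m)) > ereal \<theta>_plus \<longrightarrow>
        asymp_powerful
          (path_risk F\<^sub>0 \<theta> \<alpha> :: nat \<Rightarrow> ((int ^ 'd \<Rightarrow> real) \<Rightarrow> bool) \<Rightarrow> real)
          (\<lambda>m x. real (largest_cluster t m x))) \<and>
     (\<forall>\<theta>_minus.
        unique_solution (param_range \<theta>max)
          (\<lambda>\<eta>. real CARD('d) * zeta TYPE('d) (exceed_prob F\<^sub>0 t \<eta>)
               = \<alpha> * zeta TYPE('d) (exceed_prob F\<^sub>0 t 0)) \<theta>_minus \<longrightarrow>
        limsup (\<lambda>m. ereal (\<theta> m)) < ereal \<theta>_minus \<longrightarrow>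
        asymp_powerless
          (path_risk F\<^sub>0 \<theta> \<alpha> :: nat \<Rightarrow> ((int ^ 'd \<Rightarrow> real) \<Rightarrow> bool) \<Rightarrow> real)
          (\<lambda>m x. real (largest_cluster t m x)))"
proof (intro conjI allI impI)
  note F = assms(1) and int = assms(5) and pos = assms(10) and sub = assms(11)
  let ?p = "exceed_prob F\<^sub>0 t"
  have lt1: "?p 0 < 1" using sub critical_prob_le_1[of "TYPE('d)"] by simp
  have range0: "0 \<in> param_range \<theta>max" using assms(4) by (simp add: param_range_def zero_ereal_def)
  have range_le: "\<eta> \<in> param_range \<theta>max" if "\<eta>' \<in> param_range \<theta>max" "0 \<le> \<eta>" "\<eta> \<le> \<eta>'" for \<eta> \<eta>'
    using that le_less_trans[of "ereal \<eta>" "ereal \<eta>'" \<theta>max] by (simp add: param_range_def)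
  have bounds: "0 < ?p \<eta>" "?p \<eta> < 1" if "\<eta> \<in> param_range \<theta>max" for \<eta>
    using exceed_prob_bounds[OF F int[OF that] pos lt1] .
  have mono: "?p \<eta> < ?p \<eta>'" if "\<eta> \<in> param_range \<theta>max" "\<eta>' \<in> param_range \<theta>max" "\<eta> < \<eta>'" for \<eta> \<eta>'
    using exceed_prob_strict_mono[OF F int[OF that(1)] int[OF that(2)] pos lt1 that(3)] .
  have int\<theta>: "integrable F\<^sub>0 (\<lambda>x. exp (x * \<theta> m))" for m using int assms(9) by blast
  {
    fix \<theta>p
    assume u: "unique_solution (param_range \<theta>max)
          (\<lambda>\<eta>. real CARD('d) * zeta1 (?p \<eta>) = \<alpha> * zeta TYPE('d) (?p 0)) \<theta>p"
      and lim: "liminf (\<lambda>m. ereal (\<theta> m)) > ereal \<theta>p"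
    have p: "\<theta>p \<in> param_range \<theta>max" "real CARD('d) * zeta1 (?p \<theta>p) = \<alpha> * zeta TYPE('d) (?p 0)"
      using u by (auto simp: unique_solution_def)
    \<comment> \<open>A fixed parameter strictly between the threshold and the limit inferior turns
      the asymptotic hypothesis into an eventual bound by \<open>?p \<eta>\<close>; strict
      monotonicity then opens the window for \<open>c\<close>.\<close>
    obtain \<eta> where \<eta>: "\<theta>p < \<eta>" "ereal \<eta> < liminf (\<lambda>m. ereal (\<theta> m))"
      using ereal_dense2[OF lim] by auto
    have ev: "\<forall>\<^sub>F m in sequentially. \<eta> < \<theta> m"
      using less_LiminfD[OF \<eta>(2)] by simp
    then obtain m where "\<eta> < \<theta> m" using eventually_happens by fastforce
    \<comment> \<open>\<open>\<eta>\<close> lies between the threshold, which is nonnegative, and an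
      admissible \<open>\<theta> m\<close>, so it is admissible too.\<close>
    then have \<eta>r: "\<eta> \<in> param_range \<theta>max"
      using \<eta>(1) p(1) by (intro range_le[OF assms(9)[of m]]) (auto simp: param_range_def)
    have "?p \<theta>p < ?p \<eta>" using mono p \<eta>r \<eta> by blast
    then have "zeta1 (?p \<eta>) < zeta1 (?p \<theta>p)"
      using bounds[OF p(1)] bounds[OF \<eta>r] by (simp add: zeta1_def ln_div)
    then have "real CARD('d) * zeta1 (?p \<eta>) < \<alpha> * zeta TYPE('d) (?p 0)"
      unfolding p(2)[symmetric] by simp
    moreover have "\<forall>\<^sub>F m in sequentially. ?p \<eta> \<le> ?p (\<theta> m)"
      using ev by eventually_elim (use mono \<eta>r assms(9) in \<open>auto intro: less_imp_le\<close>)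
    ultimately show "asymp_powerful
          (path_risk F\<^sub>0 \<theta> \<alpha> :: nat \<Rightarrow> ((int ^ 'd \<Rightarrow> real) \<Rightarrow> bool) \<Rightarrow> real)
          (\<lambda>m x. real (largest_cluster t m x))"
      using bounds[OF \<eta>r] by (intro max_cluster_test_powerful[OF F int\<theta> assms(6,7) pos sub])
  }
  {
    fix \<theta>p
    assume u: "unique_solution (param_range \<theta>max)
          (\<lambda>\<eta>. real CARD('d) * zeta TYPE('d) (?p \<eta>) = \<alpha> * zeta TYPE('d) (?p 0)) \<theta>p"
      and lim: "limsup (\<lambda>m. ereal (\<theta> m)) < ereal \<theta>p"
    have p: "\<theta>p \<in> param_range \<theta>max"
      "real CARD('d) * zeta TYPE('d) (?p \<theta>p) = \<alpha> * zeta TYPE('d) (?p 0)"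
      using u by (auto simp: unique_solution_def)
    obtain \<eta> where \<eta>: "\<eta> < \<theta>p" "limsup (\<lambda>m. ereal (\<theta> m)) < ereal \<eta>"
      using ereal_dense2[OF lim] by auto
    have ev: "\<forall>\<^sub>F m in sequentially. \<theta> m < \<eta>"
      using Limsup_lessD[OF \<eta>(2)] by simp
    then obtain m where "\<theta> m < \<eta>" using eventually_happens by fastforce
    then have \<eta>0: "0 < \<eta>" using assms(8)[of m] by simp
    then have \<eta>r: "\<eta> \<in> param_range \<theta>max" using \<eta>(1) p(1) by (intro range_le[OF p(1)]) auto
    \<comment> \<open>With a zero rate at the null level the parameter \<open>0\<close> solves the
      equation, and uniqueness forces the threshold to be \<open>0\<close>, against
      \<open>0 < \<eta> < \<theta>p\<close>.\<close>
    have z0: "zeta TYPE('d) (?p 0) \<noteq> 0"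
    proof
      assume "zeta TYPE('d) (?p 0) = 0"
      then have "0 = \<theta>p" using u range0 by (simp add: unique_solution_def)
      then show False using \<eta>(1) \<eta>0 by simp
    qed
    then have z: "0 < zeta TYPE('d) (?p 0)"
      using cluster_tail_limit(2)[OF pos sub] by simp
    then have "0 < real CARD('d) * zeta TYPE('d) (?p \<theta>p)" using p(2) assms(6) by simp
    then have zp: "0 < zeta TYPE('d) (?p \<theta>p)" by (simp add: zero_less_mult_iff)
    \<comment> \<open>By definition \<open>zeta\<close> vanishes from the critical probability on,
      so a positive value certifies that \<open>?p \<theta>p\<close> is subcritical.\<close>
    then have subp: "?p \<theta>p < critical_prob TYPE('d)" by (simp add: zeta_def split: if_splits)
    have less: "?p \<eta> < ?p \<theta>p" using mono \<eta>r p(1) \<eta>(1) by blast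
    have "zeta TYPE('d) (?p \<theta>p) < zeta TYPE('d) (?p \<eta>)"
      using zeta_strict_antimono[OF bounds(1)[OF \<eta>r] less subp zp] .
    then have "\<alpha> * zeta TYPE('d) (?p 0) < real CARD('d) * zeta TYPE('d) (?p \<eta>)"
      unfolding p(2)[symmetric] by simp
    moreover have "\<forall>\<^sub>F m in sequentially. ?p 0 \<le> ?p (\<theta> m) \<and> ?p (\<theta> m) \<le> ?p \<eta>"
      using ev by eventually_elim (use mono \<eta>r range0 assms(8,9) in \<open>auto intro: less_imp_le\<close>)
    ultimately show "asymp_powerless
          (path_risk F\<^sub>0 \<theta> \<alpha> :: nat \<Rightarrow> ((int ^ 'd \<Rightarrow> real) \<Rightarrow> bool) \<Rightarrow> real)
          (\<lambda>m x. real (largest_cluster t m x))"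
      using bounds(1)[OF \<eta>r] less subp z
      by (intro max_cluster_test_powerless[OF F int\<theta> assms(6,7) pos sub, of "?p \<eta>"]) auto
  }
qed

end
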